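(* Let $R,C_1,C_2,C$ be closed surfaces and let $p:R\to C_1$, $q:R\to C_2$, $f:C_1\to C$, $g:C_2\to C$ be branched covering maps such that $f\circ p=g\circ q$ and $p$ and $q$ have no non-trivial common compositional right factor. Then for the branched covering map $h=f\circ p=g\circ q$ the equality $$\deg_t h=\mathrm{lcm}\big(\deg_{p(t)}f,\ \deg_{q(t)}g\big)$$ holds for all $t\in R$. Equivalently, $\gcd(\deg_tp,\deg_tq)=1$ for all $t\in R$. In particular, $S_h=S_f\cup S_g$.
   Context: A surface is an oriented connected two-dimensional topological manifold without boundary; closed means compact. A continuous map $f:R\to C$ between surfaces is a branched covering map if every $y\in C$ has an open neighborhood $V$ such that $f^{-1}(V)$ is a disjoint union of open sets $U_i$, $i\in I$ ($I\neq\emptyset$), each $U_i$ contains exactly one point $x_i$ of $f^{-1}\{y\}$, and there are orientation-preserving homeomorphisms $\varphi_i:U_i\to\mathbb D$, $\psi_i:V\to\mathbb D$ onto the open unit disk with $\varphi_i(x_i)=\psi_i(y)=0$ and $(\psi_i\circ f\circ\varphi_i^{-1})(z)=z^{d_i}$ for some integer $d_i\ge1$. The integer $d_i$ is the local degree $\deg_{x_i}f$. $S_f\subset C$ denotes the set of critical values of $f$, i.e. images of points of local degree at least $2$. Branched covering maps $p:R\to C_1$ and $q:R\to C_2$ between closed surfaces have no non-trivial common compositional right factor if whenever $p=\tilde p\circ w$, $q=\tilde q\circ w$ with branched covering maps $w:R\to\tilde R$, $\tilde p:\tilde R\to C_1$, $\tilde q:\tilde R\to C_2$ between closed surfaces,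 one has $\deg w=1$. *)

theory Defs
  imports "HOL-Complex_Analysis.Complex_Analysis"
begin

section \<open>Oriented surfaces\<close>

text \<open>
  The topologies are abstract ones (type \<^typ>\<open>'a topology\<close>), so that a surface is carried by the
  set \<open>topspace\<close>, and functions between surfaces matter on that set only.

  An injective continuous map \<open>h\<close> of an open plane set \<open>W\<close> has local mapping degree
  \<open>1\<close> or \<open>-1\<close> at every point; it preserves the orientation if the degree is \<open>1\<close> everywhere, that is,
  if small positively oriented circles around \<open>z\<close> are mapped to loops winding once around \<open>h z\<close>.
\<close>

definition orientation_preserving_on :: "complex set \<Rightarrow> (complex \<Rightarrow> complex) \<Rightarrow> bool" where
  "orientation_preserving_on W h \<longleftrightarrow>
     (\<forall>z\<in>W. \<forall>r>0. cball z r \<subseteq> W \<longrightarrow> winding_number (h \<circ> circlepath z r) (h z) = 1)"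

definition plane_chart :: "'a topology \<Rightarrow> 'a set \<Rightarrow> ('a \<Rightarrow> complex) \<Rightarrow> bool" where
  "plane_chart X U \<phi> \<longleftrightarrow> openin X U \<and> open (\<phi> ` U) \<and>
     homeomorphic_map (subtopology X U) (top_of_set (\<phi> ` U)) \<phi>"

text \<open>
  An orientation is given by an atlas whose transition maps preserve the orientation of the plane.
  The atlas need not be maximal: all notions below depend only on the charts that are positively
  oriented with respect to the atlas.
\<close>

record 'a oriented_space =
  surface_top :: "'a topology"
  atlas :: "('a set \<times> ('a \<Rightarrow> complex)) set"

definition compatible_charts ::
  "'a set \<Rightarrow> ('a \<Rightarrow> complex) \<Rightarrow> 'a set \<Rightarrow> ('a \<Rightarrow> complex) \<Rightarrow> bool" where
  "compatible_charts U \<phi> V \<psi> \<longleftrightarrow>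
     orientation_preserving_on (\<phi> ` (U \<inter> V)) (\<psi> \<circ> inv_into U \<phi>)"

definition positive_chart :: "'a oriented_space \<Rightarrow> 'a set \<Rightarrow> ('a \<Rightarrow> complex) \<Rightarrow> bool" where
  "positive_chart X U \<phi> \<longleftrightarrow> plane_chart (surface_top X) U \<phi> \<and>
     (\<forall>(V, \<psi>) \<in> atlas X. compatible_charts U \<phi> V \<psi>)"

definition surface :: "'a oriented_space \<Rightarrow> bool" where
  "surface X \<longleftrightarrow>
     topspace (surface_top X) \<noteq> {} \<and> connected_space (surface_top X) \<and>
     Hausdorff_space (surface_top X) \<and> second_countable (surface_top X) \<and>
     (\<forall>(U, \<phi>) \<in> atlas X. positive_chart X U \<phi>) \<and>
     (\<Union>(U, \<phi>) \<in> atlas X. U) = topspace (surface_top X)"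

definition closed_surface :: "'a oriented_space \<Rightarrow> bool" where
  "closed_surface X \<longleftrightarrow> surface X \<and> compact_space (surface_top X)"


section \<open>Branched covering maps\<close>

text \<open>In positive coordinates centred at \<open>x \<in> U\<close> and \<open>f x \<in> V\<close>, the map \<open>f\<close> is \<open>z \<mapsto> z ^ d\<close>.\<close>

definition power_map_at ::
  "'a oriented_space \<Rightarrow> 'b oriented_space \<Rightarrow> ('a \<Rightarrow> 'b) \<Rightarrow> 'a \<Rightarrow> 'a set \<Rightarrow> 'b set \<Rightarrow> nat \<Rightarrow> bool" where
  "power_map_at R C f x U V d \<longleftrightarrow>
     d \<ge> 1 \<and> x \<in> U \<and> f ` U \<subseteq> V \<and>
     (\<exists>\<phi> \<psi>. positive_chart R U \<phi> \<and> \<phi> ` U = ball 0 1 \<and> \<phi> x = 0 \<and>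
            positive_chart C V \<psi> \<and> \<psi> ` V = ball 0 1 \<and> \<psi> (f x) = 0 \<and>
            (\<forall>z \<in> ball 0 1. \<psi> (f (inv_into U \<phi> z)) = z ^ d))"

definition branched_covering_map ::
  "'a oriented_space \<Rightarrow> 'b oriented_space \<Rightarrow> ('a \<Rightarrow> 'b) \<Rightarrow> bool" where
  "branched_covering_map R C f \<longleftrightarrow>
     continuous_map (surface_top R) (surface_top C) f \<and>
     (\<forall>y \<in> topspace (surface_top C). \<exists>V \<U>. openin (surface_top C) V \<and> y \<in> V \<and>
        \<U> \<noteq> {} \<and> disjoint \<U> \<and> (\<forall>U\<in>\<U>. openin (surface_top R) U) \<and>
        {x \<in> topspace (surface_top R). f x \<in> V} = \<Union>\<U> \<and>
        (\<forall>U\<in>\<U>. \<exists>x d. {u \<in> U. f u = y} = {x} \<and> power_map_at R C f x U V d))"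

definition local_degree ::
  "'a oriented_space \<Rightarrow> 'b oriented_space \<Rightarrow> ('a \<Rightarrow> 'b) \<Rightarrow> 'a \<Rightarrow> nat" where
  "local_degree R C f x = (THE d. \<exists>U V. power_map_at R C f x U V d)"

definition critical_values ::
  "'a oriented_space \<Rightarrow> 'b oriented_space \<Rightarrow> ('a \<Rightarrow> 'b) \<Rightarrow> 'b set" where
  "critical_values R C f = f ` {x \<in> topspace (surface_top R). local_degree R C f x \<ge> 2}"

text \<open>
  For branched coverings of closed surfaces the number of preimages of a point, counted with
  multiplicity, is finite and does not depend on the point.
\<close>

definition covering_degree ::
  "'a oriented_space \<Rightarrow> 'b oriented_space \<Rightarrow> ('a \<Rightarrow> 'b) \<Rightarrow> nat" where
  "covering_degree R C f =
     (THE n. \<forall>y \<in> topspace (surface_top C). (\<Sum>x | x \<in> topspace (surface_top R) \<and> f x = y. local_degree R C f x) = n)"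


section \<open>Common compositional right factors\<close>

text \<open>
  HOL cannot quantify over the type that carries the intermediate surface \<open>S\<close>. Since \<open>w\<close> is
  surjective, the points of \<open>S\<close> correspond to the fibres of \<open>w\<close>, which are sets of points of \<open>R\<close>;
  hence it is no restriction to let \<open>S\<close> range over the surfaces whose points are of type
  \<^typ>\<open>'a set\<close>. See lemma \<open>no_common_right_factorD\<close> below for the version with arbitrary types.
\<close>

definition no_common_right_factor ::
  "'a oriented_space \<Rightarrow> 'b oriented_space \<Rightarrow> 'c oriented_space \<Rightarrow>
     ('a \<Rightarrow> 'b) \<Rightarrow> ('a \<Rightarrow> 'c) \<Rightarrow> bool" where
  "no_common_right_factor R C\<^sub>1 C\<^sub>2 p q \<longleftrightarrow>
     (\<forall>(S :: 'a set oriented_space) w p' q'.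
        closed_surface S \<and> branched_covering_map R S w \<and>
        branched_covering_map S C\<^sub>1 p' \<and> branched_covering_map S C\<^sub>2 q' \<and>
        (\<forall>t \<in> topspace (surface_top R). p t = p' (w t)) \<and>
        (\<forall>t \<in> topspace (surface_top R). q t = q' (w t)) \<longrightarrow>
        covering_degree R S w = 1)"

text \<open>
  The rest of this theory proves \<open>no_common_right_factorD\<close>: surfaces, branched coverings and
  degrees are invariant under moving the oriented surface \<open>X\<close> to another type along a bijection
  \<open>e\<close> that matches the charts of \<open>Y\<close> with those of \<open>X\<close>.
\<close>

definition same_charts ::
  "'a oriented_space \<Rightarrow> 'b oriented_space \<Rightarrow> ('a \<Rightarrow> 'b) \<Rightarrow> bool" where
  "same_charts X Y e \<longleftrightarrow>
     (\<forall>(V, \<psi>) \<in> atlas Y. \<exists>(U, \<phi>) \<in> atlas X.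
        V = e ` U \<and> U \<subseteq> topspace (surface_top X) \<and> (\<forall>u\<in>U. \<psi> (e u) = \<phi> u))"

lemma orientation_preserving_on_cong:
  assumes "\<And>z. z \<in> W \<Longrightarrow> h z = k z"
  shows "orientation_preserving_on W h = orientation_preserving_on W k"
proof -
  have "winding_number (h \<circ> circlepath z r) (h z) = winding_number (k \<circ> circlepath z r) (k z)"
    if "z \<in> W" "r > 0" "cball z r \<subseteq> W" for z r
  proof -
    have "circlepath z r t \<in> W" if "0 \<le> t" "t \<le> 1" for t
    proof -
      have "circlepath z r t \<in> path_image (circlepath z r)"
        using that by (auto simp: path_image_def)
      then have "circlepath z r t \<in> sphere z r"
        using \<open>r > 0\<close> by simp
      then show ?thesis
        using \<open>cball z r \<subseteq> W\<close> sphere_cball by blast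
    qed
    then have "winding_number (h \<circ> circlepath z r) (h z) = winding_number (k \<circ> circlepath z r) (h z)"
      by (intro winding_number_cong) (simp add: assms)
    then show ?thesis
      using assms that by simp
  qed
  then show ?thesis
    unfolding orientation_preserving_on_def by auto
qed

lemma plane_chart_inj_on:
  assumes "plane_chart X U \<phi>"
  shows "inj_on \<phi> U"
proof -
  have "homeomorphic_map (subtopology X U) (top_of_set (\<phi> ` U)) \<phi>" "U \<subseteq> topspace X"
    using assms by (auto simp: plane_chart_def dest: openin_subset)
  then show ?thesis
    using homeomorphic_imp_injective_map by (fastforce simp: inf_absorb2)
qed

lemma plane_chart_transfer:
  assumes e: "homeomorphic_maps X Y e e'" and c: "plane_chart X U \<phi>"
    and \<psi>: "\<And>u. u \<in> U \<Longrightarrow> \<psi> (e u) = \<phi> u"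
  shows "plane_chart Y (e ` U) \<psi>"
proof -
  have U: "openin X U" and o: "open (\<phi> ` U)"
    and hom: "homeomorphic_map (subtopology X U) (top_of_set (\<phi> ` U)) \<phi>"
    using c by (auto simp: plane_chart_def)
  have sub: "U \<subseteq> topspace X"
    using U by (rule openin_subset)
  have he: "homeomorphic_map X Y e" and he': "homeomorphic_map Y X e'"
    using e homeomorphic_maps_map by blast+
  have inv: "e' (e u) = u" if "u \<in> U" for u
    using e sub that by (auto simp: homeomorphic_maps_def)
  have im: "\<psi> ` e ` U = \<phi> ` U"
    using \<psi> by (force simp: image_image)
  have eU: "openin Y (e ` U)"
    using he U homeomorphic_map_openness_eq by blast
  have "e' ` e ` U = U"
    using inv by (force simp: image_image)
  then have "homeomorphic_map (subtopology Y (e ` U)) (subtopology X U) e'"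
    using homeomorphic_map_subtopologies[OF he', of "e ` U" U] sub openin_subset[OF eU]
    by (simp add: homeomorphic_imp_surjective_map[OF he'] inf_absorb2)
  then have "homeomorphic_map (subtopology Y (e ` U)) (top_of_set (\<phi> ` U)) (\<phi> \<circ> e')"
    using hom homeomorphic_map_compose by blast
  moreover have "(\<phi> \<circ> e') y = \<psi> y" if "y \<in> topspace (subtopology Y (e ` U))" for y
    using that inv \<psi> by auto
  ultimately have "homeomorphic_map (subtopology Y (e ` U)) (top_of_set (\<phi> ` U)) \<psi>"
    by (rule homeomorphic_map_eq)
  then show ?thesis
    using eU o im by (simp add: plane_chart_def)
qed

lemma positive_chart_transfer:
  assumes e: "homeomorphic_maps (surface_top X) (surface_top Y) e e'" and s: "same_charts X Y e"
    and c: "positive_chart X U \<phi>" and \<psi>: "\<And>u. u \<in> U \<Longrightarrow> \<psi> (e u) = \<phi> u"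
  shows "positive_chart Y (e ` U) \<psi>"
proof -
  have pc: "plane_chart (surface_top X) U \<phi>"
    using c by (simp add: positive_chart_def)
  have sub: "U \<subseteq> topspace (surface_top X)"
    using pc by (simp add: plane_chart_def openin_subset)
  have inj: "inj_on \<phi> U"
    using pc by (rule plane_chart_inj_on)
  have inje: "inj_on e (topspace (surface_top X))"
    using e by (meson homeomorphic_maps_map homeomorphic_imp_injective_map)
  have inj\<psi>: "inj_on \<psi> (e ` U)"
    using inj \<psi> by (auto simp: inj_on_def)
  have "compatible_charts (e ` U) \<psi> V' \<eta>'" if V': "(V', \<eta>') \<in> atlas Y" for V' \<eta>'
  proof -
    obtain V \<eta> where V: "(V, \<eta>) \<in> atlas X" "V' = e ` V" "V \<subseteq> topspace (surface_top X)"
      and \<eta>: "\<And>u. u \<in> V \<Longrightarrow> \<eta>' (e u) = \<eta> u"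
      using s V' unfolding same_charts_def by fast
    have int: "e ` U \<inter> V' = e ` (U \<inter> V)"
      using inje sub V by (simp add: inj_on_image_Int)
    have im: "\<psi> ` (e ` U \<inter> V') = \<phi> ` (U \<inter> V)"
      unfolding int using \<psi> by (force simp: image_image)
    have eq: "(\<eta>' \<circ> inv_into (e ` U) \<psi>) z = (\<eta> \<circ> inv_into U \<phi>) z" if z: "z \<in> \<phi> ` (U \<inter> V)" for z
    proof -
      obtain u where u: "u \<in> U" "u \<in> V" "z = \<phi> u"
        using z by blast
      have "inv_into (e ` U) \<psi> z = e u"
        using u \<psi> inj\<psi> by (metis image_eqI inv_into_f_f)
      then show ?thesis
        using u \<eta> inj by simp
    qed
    have "compatible_charts U \<phi> V \<eta>"
      using c V by (auto simp: positive_chart_def)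
    then show ?thesis
      unfolding compatible_charts_def im by (subst orientation_preserving_on_cong[OF eq])
  qed
  moreover have "plane_chart (surface_top Y) (e ` U) \<psi>"
    using e pc \<psi> by (rule plane_chart_transfer)
  ultimately show ?thesis
    unfolding positive_chart_def by blast
qed

locale oriented_iso =
  fixes X :: "'a oriented_space" and Y :: "'b oriented_space" and e e'
  assumes maps: "homeomorphic_maps (surface_top X) (surface_top Y) e e'"
    and charts: "same_charts X Y e" and charts': "same_charts Y X e'"
begin

lemma hom: "homeomorphic_map (surface_top X) (surface_top Y) e"
  and hom': "homeomorphic_map (surface_top Y) (surface_top X) e'"
  using maps homeomorphic_maps_map by blast+

lemma inv: "x \<in> topspace (surface_top X) \<Longrightarrow> e' (e x) = x"
  and inv': "y \<in> topspace (surface_top Y) \<Longrightarrow> e (e' y) = y"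
  using maps by (auto simp: homeomorphic_maps_def)

lemma in_Y: "x \<in> topspace (surface_top X) \<Longrightarrow> e x \<in> topspace (surface_top Y)"
  and in_X: "y \<in> topspace (surface_top Y) \<Longrightarrow> e' y \<in> topspace (surface_top X)"
  using hom hom' homeomorphic_imp_surjective_map by blast+

lemma positive_chart_subset: "positive_chart Z U \<phi> \<Longrightarrow> U \<subseteq> topspace (surface_top Z)"
  by (simp add: positive_chart_def plane_chart_def openin_subset)

lemma closed_surface_transfer:
  assumes "closed_surface X"
  shows "closed_surface Y"
proof -
  have top: "surface_top X homeomorphic_space surface_top Y"
    using maps homeomorphic_maps_imp_homeomorphic_space by blast
  have X: "surface X" "compact_space (surface_top X)"
    using assms by (auto simp: closed_surface_def)
  have pos: "positive_chart Y V \<psi>" if V: "(V, \<psi>) \<in> atlas Y" for V \<psi>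
  proof -
    obtain U \<phi> where "(U, \<phi>) \<in> atlas X" "V = e ` U" "\<And>u. u \<in> U \<Longrightarrow> \<psi> (e u) = \<phi> u"
      using charts V unfolding same_charts_def by fast
    then show ?thesis
      using X positive_chart_transfer[OF maps charts] by (auto simp: surface_def)
  qed
  have "y \<in> (\<Union>(V, \<psi>) \<in> atlas Y. V)" if y: "y \<in> topspace (surface_top Y)" for y
  proof -
    have "e' y \<in> (\<Union>(U, \<phi>) \<in> atlas X. U)"
      using X in_X[OF y] by (simp add: surface_def)
    then obtain U \<phi> where U: "(U, \<phi>) \<in> atlas X" "e' y \<in> U"
      by auto
    then obtain V \<psi> where V: "(V, \<psi>) \<in> atlas Y" "U = e' ` V" "V \<subseteq> topspace (surface_top Y)"
      using charts' unfolding same_charts_def by fast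
    have "y \<in> V"
      using U V y inv' by (metis (no_types, lifting) image_iff subsetD)
    then show ?thesis
      using V by auto
  qed
  moreover have "(\<Union>(V, \<psi>) \<in> atlas Y. V) \<subseteq> topspace (surface_top Y)"
    using pos positive_chart_subset by fast
  ultimately have "(\<Union>(V, \<psi>) \<in> atlas Y. V) = topspace (surface_top Y)"
    by blast
  moreover have "topspace (surface_top Y) \<noteq> {}"
    using X in_Y unfolding surface_def by blast
  moreover have "connected_space (surface_top Y)" "Hausdorff_space (surface_top Y)"
    "second_countable (surface_top Y)" "compact_space (surface_top Y)"
    using X homeomorphic_connected_space[OF top] homeomorphic_Hausdorff_space[OF top]
      homeomorphic_space_second_countability[OF top] homeomorphic_compact_space[OF top]
    by (auto simp: surface_def)
  ultimately show ?thesis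
    using pos by (auto simp: closed_surface_def surface_def)
qed

lemma power_map_at_target:
  assumes f: "f ` U \<subseteq> topspace (surface_top X)" and pm: "power_map_at R X f x U V d"
  shows "power_map_at R Y (e \<circ> f) x U (e ` V) d"
proof -
  obtain \<phi> \<psi> where *: "d \<ge> 1" "x \<in> U" "f ` U \<subseteq> V"
    "positive_chart R U \<phi>" "\<phi> ` U = ball 0 1" "\<phi> x = 0"
    "positive_chart X V \<psi>" "\<psi> ` V = ball 0 1" "\<psi> (f x) = 0"
    "\<And>z. z \<in> ball 0 1 \<Longrightarrow> \<psi> (f (inv_into U \<phi> z)) = z ^ d"
    using pm unfolding power_map_at_def by blast
  have inv_V: "e' (e v) = v" if "v \<in> V" for v
    using inv positive_chart_subset[OF *(7)] that by blast
  have "positive_chart Y (e ` V) (\<psi> \<circ> e')"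
    by (rule positive_chart_transfer[OF maps charts *(7)]) (simp add: inv_V)
  moreover have "(\<psi> \<circ> e') ` e ` V = ball 0 1"
    unfolding *(8)[symmetric] using inv_V by (force simp: image_image)
  moreover have "(\<psi> \<circ> e') ((e \<circ> f) x) = 0"
    using * inv_V by auto
  moreover have "(\<psi> \<circ> e') ((e \<circ> f) (inv_into U \<phi> z)) = z ^ d" if z: "z \<in> ball 0 1" for z
  proof -
    have "inv_into U \<phi> z \<in> U"
      using z *(5) by (simp add: inv_into_into)
    then have "f (inv_into U \<phi> z) \<in> V"
      using *(3) by blast
    then show ?thesis
      using *(10)[OF z] inv_V by simp
  qed
  moreover have "(e \<circ> f) ` U \<subseteq> e ` V"
    using *(3) by auto
  ultimately show ?thesis
    unfolding power_map_at_def using *(1,2,4,5,6) by blast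
qed

lemma power_map_at_source:
  assumes pm: "power_map_at X C f x U V d"
  shows "power_map_at Y C (f \<circ> e') (e x) (e ` U) V d"
proof -
  obtain \<phi> \<psi> where *: "d \<ge> 1" "x \<in> U" "f ` U \<subseteq> V"
    "positive_chart X U \<phi>" "\<phi> ` U = ball 0 1" "\<phi> x = 0"
    "positive_chart C V \<psi>" "\<psi> ` V = ball 0 1" "\<psi> (f x) = 0"
    "\<And>z. z \<in> ball 0 1 \<Longrightarrow> \<psi> (f (inv_into U \<phi> z)) = z ^ d"
    using pm unfolding power_map_at_def by blast
  have inv_U: "e' (e u) = u" if "u \<in> U" for u
    using inv positive_chart_subset[OF *(4)] that by blast
  have inj: "inj_on \<phi> U"
    using *(4) plane_chart_inj_on unfolding positive_chart_def by blast
  have c: "positive_chart Y (e ` U) (\<phi> \<circ> e')"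
    by (rule positive_chart_transfer[OF maps charts *(4)]) (simp add: inv_U)
  have inj': "inj_on (\<phi> \<circ> e') (e ` U)"
    using inj inv_U by (auto simp: inj_on_def)
  have im: "(\<phi> \<circ> e') ` e ` U = ball 0 1"
    unfolding *(5)[symmetric] using inv_U by (force simp: image_image)
  have "\<psi> ((f \<circ> e') (inv_into (e ` U) (\<phi> \<circ> e') z)) = z ^ d" if z: "z \<in> ball 0 1" for z
  proof -
    obtain u where u: "u \<in> U" "z = \<phi> u"
      using z *(5) by blast
    have "inv_into (e ` U) (\<phi> \<circ> e') ((\<phi> \<circ> e') (e u)) = e u"
      using u by (intro inv_into_f_f[OF inj']) auto
    then show ?thesis
      using u inv_U inj *(10)[OF z] by simp
  qed
  moreover have "(f \<circ> e') ` e ` U \<subseteq> V"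
    using *(3) inv_U by auto
  moreover have "(\<phi> \<circ> e') (e x) = 0" "\<psi> ((f \<circ> e') (e x)) = 0" "e x \<in> e ` U"
    using * inv_U by auto
  ultimately show ?thesis
    unfolding power_map_at_def using c im *(1,7,8)
    by (intro conjI exI[of _ "\<phi> \<circ> e'"] exI[of _ \<psi>] ballI)
qed

end

lemma oriented_iso_sym: "oriented_iso X Y e e' \<Longrightarrow> oriented_iso Y X e' e"
  unfolding oriented_iso_def by (meson homeomorphic_maps_sym)

lemma power_map_at_cong:
  assumes "\<And>u. u \<in> U \<Longrightarrow> f u = g u"
  shows "power_map_at R C f x U V d = power_map_at R C g x U V d"
proof -
  have "power_map_at R C g x U V d"
    if pm: "power_map_at R C f x U V d" and eq: "\<And>u. u \<in> U \<Longrightarrow> f u = g u" for f g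
  proof -
    obtain \<phi> \<psi> where *: "d \<ge> 1" "x \<in> U" "f ` U \<subseteq> V"
      "positive_chart R U \<phi>" "\<phi> ` U = ball 0 1" "\<phi> x = 0"
      "positive_chart C V \<psi>" "\<psi> ` V = ball 0 1" "\<psi> (f x) = 0"
      "\<And>z. z \<in> ball 0 1 \<Longrightarrow> \<psi> (f (inv_into U \<phi> z)) = z ^ d"
      using pm unfolding power_map_at_def by blast
    have "\<psi> (g (inv_into U \<phi> z)) = z ^ d" if z: "z \<in> ball 0 1" for z
      using *(10)[OF z] eq[of "inv_into U \<phi> z"] z *(5) by (simp add: inv_into_into)
    moreover have "g ` U \<subseteq> V" "\<psi> (g x) = 0"
      using * eq by auto
    ultimately show ?thesis
      unfolding power_map_at_def using *(1,2,4-8) by blast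
  qed
  from this[of f g] this[of g f] show ?thesis
    using assms by auto
qed

lemma power_map_at_subset:
  assumes "power_map_at R C f x U V d"
  shows "U \<subseteq> topspace (surface_top R)" "V \<subseteq> topspace (surface_top C)" "f ` U \<subseteq> V"
  using assms by (auto simp: power_map_at_def positive_chart_def plane_chart_def dest: openin_subset)

context oriented_iso
begin

lemma power_map_at_target_iff:
  assumes f: "f ` topspace (surface_top R) \<subseteq> topspace (surface_top X)"
  shows "(\<exists>U V. power_map_at R Y (e \<circ> f) x U V d) \<longleftrightarrow> (\<exists>U V. power_map_at R X f x U V d)"
proof
  assume "\<exists>U V. power_map_at R X f x U V d"
  then obtain U V where pm: "power_map_at R X f x U V d"
    by blast
  have "f ` U \<subseteq> topspace (surface_top X)"
    using f power_map_at_subset(1)[OF pm] by blast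
  then show "\<exists>U V. power_map_at R Y (e \<circ> f) x U V d"
    using power_map_at_target[OF _ pm] by blast
next
  assume "\<exists>U V. power_map_at R Y (e \<circ> f) x U V d"
  then obtain U V where pm: "power_map_at R Y (e \<circ> f) x U V d"
    by blast
  have U: "U \<subseteq> topspace (surface_top R)"
    by (rule power_map_at_subset(1)[OF pm])
  then have "(e \<circ> f) ` U \<subseteq> topspace (surface_top Y)"
    using f in_Y by (fastforce simp: image_subset_iff)
  then have "power_map_at R X (e' \<circ> (e \<circ> f)) x U (e' ` V) d"
    using oriented_iso.power_map_at_target[OF oriented_iso_sym[OF oriented_iso_axioms] _ pm] by blast
  moreover have "(e' \<circ> (e \<circ> f)) u = f u" if "u \<in> U" for u
    using f U that inv by auto
  ultimately show "\<exists>U V. power_map_at R X f x U V d"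
    using power_map_at_cong[of U "e' \<circ> (e \<circ> f)" f] by blast
qed

lemma local_degree_target:
  assumes "f ` topspace (surface_top R) \<subseteq> topspace (surface_top X)"
  shows "local_degree R Y (e \<circ> f) x = local_degree R X f x"
  unfolding local_degree_def power_map_at_target_iff[OF assms] ..

lemma covering_degree_target:
  assumes f: "f ` topspace (surface_top R) \<subseteq> topspace (surface_top X)"
  shows "covering_degree R Y (e \<circ> f) = covering_degree R X f"
proof -
  have fib: "{x \<in> topspace (surface_top R). (e \<circ> f) x = e y} = {x \<in> topspace (surface_top R). f x = y}"
    if "y \<in> topspace (surface_top X)" for y
    using f that inv by (auto simp: image_subset_iff) metis
  have im: "topspace (surface_top Y) = e ` topspace (surface_top X)"
    using hom homeomorphic_imp_surjective_map by blast
  show ?thesis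
    unfolding covering_degree_def im ball_simps local_degree_target[OF f]
    by (simp add: fib[unfolded comp_def] cong: ball_cong)
qed

lemma branched_covering_map_target:
  assumes f: "branched_covering_map R X f"
  shows "branched_covering_map R Y (e \<circ> f)"
  unfolding branched_covering_map_def
proof (intro conjI ballI)
  have cont: "continuous_map (surface_top R) (surface_top X) f"
    using f by (simp add: branched_covering_map_def)
  then have sub: "f x \<in> topspace (surface_top X)" if "x \<in> topspace (surface_top R)" for x
    using that by (auto simp: continuous_map_def)
  show "continuous_map (surface_top R) (surface_top Y) (e \<circ> f)"
    using cont hom continuous_map_compose homeomorphic_imp_continuous_map by blast
  fix y assume y: "y \<in> topspace (surface_top Y)"
  obtain V \<U> where *: "openin (surface_top X) V" "e' y \<in> V" "\<U> \<noteq> {}" "disjoint \<U>"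
    "\<forall>U\<in>\<U>. openin (surface_top R) U"
    "{x \<in> topspace (surface_top R). f x \<in> V} = \<Union>\<U>"
    "\<forall>U\<in>\<U>. \<exists>x d. {u \<in> U. f u = e' y} = {x} \<and> power_map_at R X f x U V d"
    using f in_X[OF y] unfolding branched_covering_map_def by blast
  have V: "V \<subseteq> topspace (surface_top X)"
    using *(1) by (rule openin_subset)
  have "openin (surface_top Y) (e ` V)"
    using hom *(1) homeomorphic_map_openness_eq by blast
  moreover have "y \<in> e ` V"
    using *(2) inv'[OF y] by force
  moreover have "{x \<in> topspace (surface_top R). (e \<circ> f) x \<in> e ` V} = \<Union>\<U>"
  proof -
    have "e (f x) \<in> e ` V \<longleftrightarrow> f x \<in> V" if "x \<in> topspace (surface_top R)" for x
    proof
      assume "e (f x) \<in> e ` V"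
      then obtain v where v: "v \<in> V" "e (f x) = e v"
        by blast
      have "f x = e' (e (f x))"
        using inv[OF sub[OF that]] by (rule sym)
      also have "\<dots> = v"
        unfolding v(2) using inv[OF subsetD[OF V v(1)]] .
      finally show "f x \<in> V"
        using v(1) by (rule ssubst)
    qed (rule imageI)
    then show ?thesis
      unfolding *(6)[symmetric] by auto
  qed
  moreover have "\<exists>x d. {u \<in> U. (e \<circ> f) u = y} = {x} \<and> power_map_at R Y (e \<circ> f) x U (e ` V) d"
    if U: "U \<in> \<U>" for U
  proof -
    obtain x d where x: "{u \<in> U. f u = e' y} = {x}" "power_map_at R X f x U V d"
      using bspec[OF *(7) U] by blast
    have "U \<subseteq> topspace (surface_top R)"
      using * U by (simp add: openin_subset)
    then have "f u \<in> topspace (surface_top X)" if "u \<in> U" for u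
      using sub that by blast
    then have "{u \<in> U. (e \<circ> f) u = y} = {u \<in> U. f u = e' y}" "f ` U \<subseteq> topspace (surface_top X)"
      using inv inv'[OF y] by auto
    then show ?thesis
      using x power_map_at_target[OF _ x(2)] by auto
  qed
  ultimately show "\<exists>V \<U>. openin (surface_top Y) V \<and> y \<in> V \<and>
        \<U> \<noteq> {} \<and> disjoint \<U> \<and> (\<forall>U\<in>\<U>. openin (surface_top R) U) \<and>
        {x \<in> topspace (surface_top R). (e \<circ> f) x \<in> V} = \<Union>\<U> \<and>
        (\<forall>U\<in>\<U>. \<exists>x d. {u \<in> U. (e \<circ> f) u = y} = {x} \<and> power_map_at R Y (e \<circ> f) x U V d)"
    using *(3-5) by blast
qed

lemma branched_covering_map_source:
  assumes f: "branched_covering_map X C f"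
  shows "branched_covering_map Y C (f \<circ> e')"
  unfolding branched_covering_map_def
proof (intro conjI ballI)
  show "continuous_map (surface_top Y) (surface_top C) (f \<circ> e')"
    using f continuous_map_compose[OF homeomorphic_imp_continuous_map[OF hom']]
    unfolding branched_covering_map_def by blast
  fix y assume y: "y \<in> topspace (surface_top C)"
  obtain V \<U> where *: "openin (surface_top C) V" "y \<in> V" "\<U> \<noteq> {}" "disjoint \<U>"
    "\<forall>U\<in>\<U>. openin (surface_top X) U"
    "{x \<in> topspace (surface_top X). f x \<in> V} = \<Union>\<U>"
    "\<forall>U\<in>\<U>. \<exists>x d. {u \<in> U. f u = y} = {x} \<and> power_map_at X C f x U V d"
    using f y unfolding branched_covering_map_def by blast
  have sub: "U \<subseteq> topspace (surface_top X)" if "U \<in> \<U>" for U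
    using * that by (simp add: openin_subset)
  have inv_U: "e' (e u) = u" if "u \<in> U" "U \<in> \<U>" for u U
    using inv sub that by blast
  let ?\<U> = "(`) e ` \<U>"
  have "disjoint ?\<U>"
  proof (rule disjointI)
    fix A B assume "A \<in> ?\<U>" "B \<in> ?\<U>" "A \<noteq> B"
    then obtain U W where UW: "U \<in> \<U>" "W \<in> \<U>" "A = e ` U" "B = e ` W" "U \<noteq> W"
      by blast
    then have "U \<inter> W = {}"
      using *(4) by (auto simp: disjoint_def)
    then show "A \<inter> B = {}"
      using UW inv_U by (metis (no_types, lifting) disjoint_iff imageE)
  qed
  moreover have "\<forall>U\<in>?\<U>. openin (surface_top Y) U"
    using * hom homeomorphic_map_openness_eq by blast
  moreover have "{x \<in> topspace (surface_top Y). (f \<circ> e') x \<in> V} = \<Union>?\<U>"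
  proof -
    have "{x \<in> topspace (surface_top Y). (f \<circ> e') x \<in> V} = e ` {x \<in> topspace (surface_top X). f x \<in> V}"
    proof (intro set_eqI iffI)
      fix x assume "x \<in> {x \<in> topspace (surface_top Y). (f \<circ> e') x \<in> V}"
      then show "x \<in> e ` {x \<in> topspace (surface_top X). f x \<in> V}"
        using in_X inv' by (intro image_eqI[of _ _ "e' x"]) auto
    qed (use in_Y inv in auto)
    then show ?thesis
      using *(6) by auto
  qed
  moreover have "\<exists>x d. {u \<in> e ` U. (f \<circ> e') u = y} = {x} \<and> power_map_at Y C (f \<circ> e') x (e ` U) V d"
    if U: "U \<in> \<U>" for U
  proof -
    obtain x d where x: "{u \<in> U. f u = y} = {x}" "power_map_at X C f x U V d"
      using bspec[OF *(7) U] by blast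
    have "{u \<in> e ` U. (f \<circ> e') u = y} = e ` {u \<in> U. f u = y}"
      using inv_U[OF _ U] by auto
    then show ?thesis
      using x power_map_at_source[OF x(2)] by auto
  qed
  ultimately show "\<exists>V \<U>. openin (surface_top C) V \<and> y \<in> V \<and>
        \<U> \<noteq> {} \<and> disjoint \<U> \<and> (\<forall>U\<in>\<U>. openin (surface_top Y) U) \<and>
        {x \<in> topspace (surface_top Y). (f \<circ> e') x \<in> V} = \<Union>\<U> \<and>
        (\<forall>U\<in>\<U>. \<exists>x d. {u \<in> U. (f \<circ> e') u = y} = {x} \<and> power_map_at Y C (f \<circ> e') x U V d)"
    using *(1-3) by (intro exI[of _ V] exI[of _ ?\<U>]) auto
qed

end

lemma branched_covering_map_surj:
  assumes "branched_covering_map R C f" "y \<in> topspace (surface_top C)"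
  shows "\<exists>x \<in> topspace (surface_top R). f x = y"
proof -
  obtain V \<U> where *: "\<U> \<noteq> {}" "\<forall>U\<in>\<U>. openin (surface_top R) U"
    "\<forall>U\<in>\<U>. \<exists>x d. {u \<in> U. f u = y} = {x} \<and> power_map_at R C f x U V d"
    using assms unfolding branched_covering_map_def by meson
  then obtain U x where "U \<in> \<U>" "{u \<in> U. f u = y} = {x}"
    by blast
  then show ?thesis
    using * openin_subset by blast
qed

lemma oriented_iso_exists:
  fixes X :: "'a oriented_space" and e :: "'a \<Rightarrow> 'b"
  assumes inj: "inj_on e (topspace (surface_top X))" and X: "surface X"
  obtains Y e' where "oriented_iso X Y e e'"
proof -
  define T where "T = topspace (surface_top X)"
  define e' where "e' = inv_into T e"
  define Y where "Y = \<lparr>surface_top = pullback_topology (e ` T) e' (surface_top X),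
      atlas = (\<lambda>(U, \<phi>). (e ` U, \<phi> \<circ> e')) ` atlas X\<rparr>"
  have inv: "e' (e x) = x" if "x \<in> T" for x
    using inj that by (simp add: e'_def T_def)
  have top: "topspace (surface_top Y) = e ` T"
    using inv by (auto simp: Y_def topspace_pullback_topology T_def)
  have "continuous_map (surface_top X) (surface_top Y) e"
    unfolding Y_def oriented_space.simps
  proof (rule continuous_map_pullback')
    show "continuous_map (surface_top X) (surface_top X) (e' \<circ> e)"
      by (rule continuous_map_eq[OF continuous_map_id]) (simp add: inv T_def)
    show "topspace (surface_top X) \<subseteq> e -` e ` T"
      by (auto simp: T_def)
  qed
  moreover have "continuous_map (surface_top Y) (surface_top X) e'"
    using continuous_map_pullback[OF continuous_map_id, of "e ` T" e' "surface_top X"]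
    by (simp add: Y_def)
  ultimately have maps: "homeomorphic_maps (surface_top X) (surface_top Y) e e'"
    using inv by (auto simp: homeomorphic_maps_def top T_def[symmetric])
  have sub: "U \<subseteq> T" if "(U, \<phi>) \<in> atlas X" for U \<phi>
    using X that unfolding surface_def T_def by blast
  have "same_charts X Y e"
    unfolding same_charts_def
  proof clarify
    fix V \<psi> assume "(V, \<psi>) \<in> atlas Y"
    then obtain U \<phi> where U: "(U, \<phi>) \<in> atlas X" "V = e ` U" "\<psi> = \<phi> \<circ> e'"
      by (auto simp: Y_def)
    have "\<psi> (e u) = \<phi> u" if "u \<in> U" for u
      using inv sub[OF U(1)] U(3) that by auto
    then show "\<exists>(U, \<phi>)\<in>atlas X. V = e ` U \<and> U \<subseteq> topspace (surface_top X) \<and> (\<forall>u\<in>U. \<psi> (e u) = \<phi> u)"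
      using U sub[OF U(1)] by (intro bexI[of _ "(U, \<phi>)"]) (auto simp: T_def)
  qed
  moreover have "same_charts Y X e'"
    unfolding same_charts_def top
  proof clarify
    fix U \<phi> assume U: "(U, \<phi>) \<in> atlas X"
    have "(e ` U, \<phi> \<circ> e') \<in> atlas Y"
      using U by (force simp: Y_def)
    moreover have "U = e' ` e ` U"
      using inv sub[OF U] by (force simp: image_image)
    ultimately show "\<exists>(V, \<psi>)\<in>atlas Y. U = e' ` V \<and> V \<subseteq> e ` T \<and> (\<forall>v\<in>V. \<phi> (e' v) = \<psi> v)"
      using sub[OF U] by (intro bexI[of _ "(e ` U, \<phi> \<circ> e')"]) auto
  qed
  ultimately show thesis
    by (intro that[of Y e'] oriented_iso.intro maps)
qed

lemma no_common_right_factorD: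
  fixes R :: "'a oriented_space" and S :: "'s oriented_space"
  assumes ncf: "no_common_right_factor R C\<^sub>1 C\<^sub>2 p q" and S: "closed_surface S"
    and w: "branched_covering_map R S w"
    and p': "branched_covering_map S C\<^sub>1 p'" and q': "branched_covering_map S C\<^sub>2 q'"
    and "\<forall>t \<in> topspace (surface_top R). p t = p' (w t)"
    and "\<forall>t \<in> topspace (surface_top R). q t = q' (w t)"
  shows "covering_degree R S w = 1"
proof -
  define e where "e s = {t \<in> topspace (surface_top R). w t = s}" for s
  have "inj_on e (topspace (surface_top S))"
  proof (rule inj_onI)
    fix s s' assume "s \<in> topspace (surface_top S)" "e s = e s'"
    moreover from this obtain t where "t \<in> e s"
      using branched_covering_map_surj[OF w] by (auto simp: e_def)
    ultimately show "s = s'"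
      by (auto simp: e_def)
  qed
  then obtain S' e' where tr: "oriented_iso S S' e e'"
    using oriented_iso_exists S closed_surface_def by metis
  have im: "w ` topspace (surface_top R) \<subseteq> topspace (surface_top S)"
    using w by (auto simp: branched_covering_map_def continuous_map_def)
  have "p' (e' (e (w t))) = p' (w t)" "q' (e' (e (w t))) = q' (w t)"
    if "t \<in> topspace (surface_top R)" for t
    using im that oriented_iso.inv[OF tr] by auto
  then have "\<forall>t \<in> topspace (surface_top R). p t = (p' \<circ> e') ((e \<circ> w) t)"
    "\<forall>t \<in> topspace (surface_top R). q t = (q' \<circ> e') ((e \<circ> w) t)"
    using assms(6,7) by simp_all
  then have "covering_degree R S' (e \<circ> w) = 1"
    using oriented_iso.closed_surface_transfer[OF tr S]
      oriented_iso.branched_covering_map_target[OF tr w]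
      oriented_iso.branched_covering_map_source[OF tr p']
      oriented_iso.branched_covering_map_source[OF tr q']
    by (intro ncf[unfolded no_common_right_factor_def, THEN spec, THEN spec, THEN spec, THEN spec,
          THEN mp, of S' "e \<circ> w" "p' \<circ> e'" "q' \<circ> e'"] conjI)
  then show ?thesis
    using oriented_iso.covering_degree_target[OF tr im] by simp
qed

end

theory Submission
  imports Defs
begin

text \<open>
  Identify two points of \<open>R\<close> if the pair \<open>(p, q)\<close> maps their neighbourhoods to the same germs of
  subsets of \<open>C1 \<times> C2\<close>; the quotient is the normalization of the image of \<open>(p, q)\<close>. Around a point
  \<open>t\<close> there is a coordinate \<open>z\<close> in which \<open>p\<close> is \<open>z ^ a\<close> and \<open>q\<close> is, up to a rotation, \<open>z ^ b\<close>, because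
  both coordinates are roots of the same power \<open>h\<close>. Hence nearby points are identified if and only
  if their values of \<open>z ^ gcd a b\<close> agree. So the quotient is a closed surface with coordinate
  \<open>z ^ gcd a b\<close>, the projection has local degree \<open>gcd a b\<close> at \<open>t\<close>, and \<open>p\<close> and \<open>q\<close> factor through it.
  If \<open>p\<close> and \<open>q\<close> have no common right factor, the projection has degree \<open>1\<close>, which gives
  \<open>gcd a b = 1\<close>; the formula with \<open>lcm\<close> follows since local degrees are multiplicative.
\<close>

section \<open>Local mapping degree in the plane\<close>

text \<open>The surfaces are only topological, so no differentiable structure decides whether a
  newly built chart is positive, and charts must be compared through non-injective maps such as
  powers. An integer degree that is multiplicative under composition settles both: for an injective
  transition map it is a unit, so positivity alone forces the value 1. Points of the quotient are
  germs and not values of \<open>(p, q)\<close>, because different branches of the image may cross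
  at a point of \<open>C1 \<times> C2\<close>; there the values agree, but the nearby values do not.
  The maps \<open>f\<close> and \<open>g\<close> are what makes \<open>p\<close> and
  \<open>q\<close> comparable: each of the four maps has normal forms in its own unrelated charts,
  and two arbitrary branched coverings of \<open>R\<close> need not be powers in a common
  coordinate. Once all normal forms are transferred to a single chart of \<open>C\<close>, the
  coordinates for \<open>p\<close> and for \<open>q\<close> are roots of the same function and
  differ by a constant root of unity on each sheet. Several sheets may share one target chart, so
  these rotations are kept as data.\<close>

text \<open>
  A logarithm \<open>L\<close> of \<open>s \<mapsto> F (z + exp s)\<close> on a half plane satisfies \<open>L (s + 2\<pi>i) - L s = 2\<pi>i k\<close> for a
  constant \<open>k\<close>, so \<open>L s - k s\<close> is a function of \<open>exp s\<close>.
\<close>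

lemma punctured_ball_factorization:
  assumes r: "r > 0" and contF: "continuous_on (ball z r - {z}) F"
    and nz: "\<And>u. u \<in> ball z r - {z} \<Longrightarrow> F u \<noteq> (0::complex)"
  obtains k :: int and g where "continuous_on (ball z r - {z}) g"
    "\<And>u. u \<in> ball z r - {z} \<Longrightarrow> F u = (u - z) powi k * exp (g u)"
proof -
  define H where "H = {s. Re s < ln r}"
  define E where "E s = z + exp s" for s
  have EH: "E s \<in> ball z r - {z}" if "s \<in> H" for s
  proof -
    have "exp (Re s) < exp (ln r)" using that by (simp add: H_def)
    then have "exp (Re s) < r" using r by simp
    then show ?thesis by (simp add: E_def dist_norm norm_minus_commute)
  qed
  have cvH: "convex H"
    unfolding H_def by (rule convex_halfspace_Re_lt)
  have "continuous_on H (F \<circ> E)"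
    by (rule continuous_on_compose) (use EH in \<open>auto simp: E_def intro!: continuous_intros
      continuous_on_subset[OF contF]\<close>)
  then obtain L where contL: "continuous_on H L" and L: "\<And>s. s \<in> H \<Longrightarrow> (F \<circ> E) s = exp (L s)"
    using continuous_logarithm_on_contractible[OF _ convex_imp_contractible[OF cvH], of "F \<circ> E"] nz EH
    by (metis comp_apply)
  define p where "p = 2 * of_real pi * \<i>"
  have p0: "p \<noteq> 0" by (simp add: p_def)
  have ep: "exp (s + p) = exp s" for s
    by (simp add: p_def exp_add mult_ac)
  have Hp: "s + p \<in> H \<longleftrightarrow> s \<in> H" for s by (simp add: H_def p_def)
  define D where "D s = (L (s + p) - L s) / p" for s
  have Dint: "\<exists>n::int. D s = of_int n" if s: "s \<in> H" for s
  proof -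
    have "exp (L (s + p)) = exp (L s)"
      using L[OF s] L[of "s + p"] Hp s by (simp add: E_def ep)
    then obtain n :: int where "L (s + p) = L s + (of_int (2 * n) * pi) * \<i>"
      using exp_eq by blast
    then have "D s = of_int n" using p0 by (simp add: D_def p_def field_simps)
    then show ?thesis by blast
  qed
  have "continuous_on H D"
    unfolding D_def using p0 Hp
    by (intro continuous_intros contL continuous_on_compose2[OF contL]) auto
  then have "D constant_on H"
  proof (rule continuous_discrete_range_constant[rotated])
    show "connected H" using cvH by (rule convex_connected)
    fix s assume s: "s \<in> H"
    have "1 \<le> cmod (D t - D s)" if t: "t \<in> H" "D t \<noteq> D s" for t
    proof -
      obtain m n :: int where mn: "D s = of_int m" "D t = of_int n"
        using Dint[OF s] Dint[OF t(1)] by blast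
      then have "1 \<le> \<bar>n - m\<bar>" using t by auto
      then have "(1::real) \<le> \<bar>of_int (n - m)\<bar>" by linarith
      then show ?thesis by (metis mn norm_of_int of_int_diff)
    qed
    then show "\<exists>e>0. \<forall>t. t \<in> H \<and> D t \<noteq> D s \<longrightarrow> e \<le> norm (D t - D s)"
      by (intro exI[of _ 1]) auto
  qed
  moreover have "H \<noteq> {}"
    by (auto simp: H_def intro!: exI[of _ "of_real (ln r - 1)"])
  ultimately obtain k :: int where k: "\<And>s. s \<in> H \<Longrightarrow> D s = of_int k"
    using Dint unfolding constant_on_def by (metis equals0I)
  define M where "M s = L s - of_int k * s" for s
  have M1: "M (s + p) = M s" if "s \<in> H" for s
    using k[OF that] p0 by (simp add: M_def D_def field_simps)
  have Mn: "s + of_nat n * p \<in> H \<and> M (s + of_nat n * p) = M s" if s: "s \<in> H" for s n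
  proof (induction n)
    case (Suc n)
    have "s + of_nat (Suc n) * p = (s + of_nat n * p) + p" by (simp add: algebra_simps)
    then show ?case using Suc M1 Hp by metis
  qed (use s in simp)
  have Meq: "M s = M t" if st: "s \<in> H" "t \<in> H" "exp s = exp t" for s t
  proof -
    obtain n :: int where n: "s = t + (of_int (2 * n) * pi) * \<i>"
      using st(3) exp_eq by blast
    then have n': "s = t + of_int n * p" by (simp add: p_def)
    show ?thesis
    proof (cases "n \<ge> 0")
      case True
      then show ?thesis using Mn[of t "nat n"] st n' by simp
    next
      case False
      then have "t = s + of_nat (nat (- n)) * p" using n' by simp
      then show ?thesis using Mn[of s "nat (- n)"] st by metis
    qed
  qed
  define g where "g u = M (Ln (u - z))" for u
  have LnH: "Ln (u - z) \<in> H" if "u \<in> ball z r - {z}" for u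
    using that r by (auto simp: H_def dist_norm norm_minus_commute intro!: ln_strict_mono)
  have F: "F u = (u - z) powi k * exp (g u)" if u: "u \<in> ball z r - {z}" for u
  proof -
    have "F u = F (E (Ln (u - z)))" using u by (simp add: E_def)
    also have "\<dots> = exp (L (Ln (u - z)))" using L[OF LnH[OF u]] by simp
    also have "\<dots> = exp (of_int k * Ln (u - z)) * exp (g u)"
      by (simp add: g_def M_def flip: exp_add)
    also have "exp (of_int k * Ln (u - z)) = (u - z) powi k"
      using u by (simp flip: exp_power_int)
    finally show ?thesis .
  qed
  have contM: "continuous_on H M"
    unfolding M_def by (intro continuous_intros contL)
  have oH: "open H" unfolding H_def by (rule open_halfspace_Re_lt)
  have contg: "continuous_on (ball z r - {z}) g"
  proof (rule continuous_at_imp_continuous_on, rule)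
    fix u0 assume u0: "u0 \<in> ball z r - {z}"
    \<comment> \<open>The principal logarithm in \<open>g\<close> jumps across its cut, so
      continuity at \<open>u0\<close> is tested with another logarithm \<open>b\<close> of
      \<open>u - z\<close>, continuous there because the quotient is near 1. Since \<open>M\<close>
      takes equal values at logarithms of the same number, both give \<open>g\<close>.\<close>
    define b where "b u = Ln ((u - z) / (u0 - z)) + Ln (u0 - z)" for u
    have b0: "b u0 = Ln (u0 - z)" using u0 by (simp add: b_def)
    have "isCont b u0"
      unfolding b_def using u0
      by (intro continuous_intros isCont_Ln') auto
    moreover have "isCont M (b u0)"
      using contM oH LnH[OF u0] by (simp add: b0 continuous_on_eq_continuous_at)
    ultimately have c: "isCont (\<lambda>u. M (b u)) u0"
      by (rule isCont_o2)
    have "\<forall>\<^sub>F u in nhds u0. u \<in> ball z r - {z}"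
      using u0 by (intro eventually_nhds_in_open) auto
    moreover have "\<forall>\<^sub>F u in nhds u0. b u \<in> H"
      using \<open>isCont b u0\<close> oH LnH[OF u0] unfolding b0[symmetric]
      by (metis (no_types, lifting) continuous_at_open eventually_nhds)
    ultimately have "\<forall>\<^sub>F u in nhds u0. M (b u) = g u"
    proof eventually_elim
      case (elim u)
      have "exp (b u) = exp (Ln (u - z))"
        using elim u0 by (simp add: b_def exp_add)
      then show ?case unfolding g_def using elim LnH by (intro Meq) auto
    qed
    from isCont_cong[OF this] c show "isCont g u0" by simp
  qed
  show thesis using that contg F by blast
qed

text \<open>
  The integer \<open>k\<close> is the winding number around \<open>h z\<close> of the image of a small circle around \<open>z\<close>. The
  factorized form turns the composition rule into the rule for exponents, also for maps such as
  powers that are not injective.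
\<close>

definition has_ldeg :: "(complex \<Rightarrow> complex) \<Rightarrow> complex \<Rightarrow> int \<Rightarrow> bool" where
  "has_ldeg h z k \<longleftrightarrow> isCont h z \<and>
     (\<exists>r>0. \<exists>g. continuous_on (ball z r - {z}) g \<and>
        (\<forall>u\<in>ball z r - {z}. h u - h z = (u - z) powi k * exp (g u)))"

text \<open>Along the circle \<open>\<sigma>\<close> is a logarithm of \<open>h - h z\<close>. Its
  increment over one turn comes from the factor \<open>u - z\<close> alone: \<open>g\<close> is
  single-valued, so its contribution cancels at the common endpoint.\<close>

lemma winding_number_factorization:
  assumes contg: "continuous_on (ball z r - {z}) g"
    and h: "\<And>u. u \<in> ball z r - {z} \<Longrightarrow> h u - h z = (u - z) powi k * exp (g u)"
    and s: "0 < s" "s < r"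
  shows "winding_number (h \<circ> circlepath z s) (h z) = of_int k"
proof -
  have circ: "circlepath z s t = z + of_real s * exp (2 * of_real pi * \<i> * of_real t)" for t
    by (simp add: circlepath_def part_circlepath_def linepath_def scaleR_conv_of_real mult_ac)
  have in_ball: "circlepath z s t \<in> ball z r - {z}" for t
  proof -
    have "cmod (exp (2 * of_real pi * \<i> * of_real t)) = 1" by simp
    then have "dist z (circlepath z s t) = s"
      unfolding circ dist_norm using s by (simp add: norm_mult)
    then show ?thesis using s by auto
  qed
  define \<sigma> where "\<sigma> t = of_int k * (of_real (ln s) + 2 * of_real pi * \<i> * of_real t) + g (circlepath z s t)" for t
  have "continuous_on {0..1} (circlepath z s)"
    using path_circlepath path_def by blast
  then have p: "path \<sigma>"
    unfolding path_def \<sigma>_def using in_ball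
    by (intro continuous_intros continuous_on_compose2[OF contg]) auto
  have "winding_number (h \<circ> circlepath z s) (h z) = winding_number (\<lambda>t. h (circlepath z s t) - h z) 0"
    by (subst winding_number_offset) simp
  also have "\<dots> = winding_number (exp \<circ> \<sigma>) 0"
  proof (rule winding_number_cong)
    fix t :: real
    have "circlepath z s t - z = exp (of_real (ln s) + 2 * of_real pi * \<i> * of_real t)"
      using s unfolding circ exp_add exp_of_real by simp
    then have "h (circlepath z s t) - h z =
      exp (of_real (ln s) + 2 * of_real pi * \<i> * of_real t) powi k * exp (g (circlepath z s t))"
      using h[OF in_ball] by simp
    also have "\<dots> = (exp \<circ> \<sigma>) t"
      unfolding \<sigma>_def exp_power_int comp_def by (subst exp_add) simp
    finally show "h (circlepath z s t) - h z = (exp \<circ> \<sigma>) t" .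
  qed
  also have "\<dots> = (\<sigma> 1 - \<sigma> 0) / (2 * of_real pi * \<i>)"
    using winding_number_compose_exp[OF p] by (simp add: pathfinish_def pathstart_def)
  also have "circlepath z s 1 = circlepath z s 0"
    by (simp add: circ)
  then have "(\<sigma> 1 - \<sigma> 0) / (2 * of_real pi * \<i>) = of_int k"
    by (simp add: \<sigma>_def field_simps)
  finally show ?thesis .
qed

lemma has_ldeg_unique:
  assumes "has_ldeg h z k" "has_ldeg h z l"
  shows "k = l"
proof -
  obtain r g where r: "r > 0" "continuous_on (ball z r - {z}) g"
    "\<And>u. u \<in> ball z r - {z} \<Longrightarrow> h u - h z = (u - z) powi k * exp (g u)"
    using assms(1) unfolding has_ldeg_def by blast
  obtain r' g' where r': "r' > 0" "continuous_on (ball z r' - {z}) g'"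
    "\<And>u. u \<in> ball z r' - {z} \<Longrightarrow> h u - h z = (u - z) powi l * exp (g' u)"
    using assms(2) unfolding has_ldeg_def by blast
  define s where "s = min r r' / 2"
  have s: "0 < s" "s < r" "s < r'" using r(1) r'(1) by (auto simp: s_def)
  have "of_int k = (of_int l :: complex)"
    using winding_number_factorization[OF r(2,3) s(1,2)]
      winding_number_factorization[OF r'(2,3) s(1,3)] by simp
  then show ?thesis by simp
qed

lemma has_ldeg_exists:
  assumes "open W" "z \<in> W" "continuous_on W h" "\<And>u. u \<in> W - {z} \<Longrightarrow> h u \<noteq> h z"
  shows "\<exists>k. has_ldeg h z k"
proof -
  obtain r where r: "r > 0" "ball z r \<subseteq> W"
    using assms openE by blast
  have "continuous_on (ball z r - {z}) (\<lambda>u. h u - h z)"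
    using r by (intro continuous_intros continuous_on_subset[OF assms(3)]) auto
  moreover have "h u - h z \<noteq> 0" if "u \<in> ball z r - {z}" for u
    using assms(4)[of u] r that by auto
  ultimately obtain k g where "continuous_on (ball z r - {z}) g"
    "\<And>u. u \<in> ball z r - {z} \<Longrightarrow> h u - h z = (u - z) powi k * exp (g u)"
    using punctured_ball_factorization[OF r(1), of z "\<lambda>u. h u - h z"] by metis
  moreover have "isCont h z"
    using assms by (simp add: continuous_on_eq_continuous_at)
  ultimately show ?thesis
    unfolding has_ldeg_def using r(1) by blast
qed

text \<open>\<open>has_ldeg\<close> speaks about small circles only, while
  \<open>orientation_preserving_on\<close> tests every closed disc in \<open>W\<close>. Such a disc
  has a slightly larger concentric ball inside \<open>W\<close> on which one factorization holds; by
  uniqueness its exponent is the local one.\<close>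

lemma has_ldeg_winding_number:
  assumes h: "has_ldeg h z k" and W: "open W" "cball z s \<subseteq> W" "0 < s" "continuous_on W h"
    and ne: "\<And>u. u \<in> W - {z} \<Longrightarrow> h u \<noteq> h z"
  shows "winding_number (h \<circ> circlepath z s) (h z) = of_int k"
proof -
  obtain e where e: "e > 0" "(\<Union>x\<in>cball z s. ball x e) \<subseteq> W"
    using compact_subset_open_imp_ball_epsilon_subset[of "cball z s" W] W by auto
  have sub: "ball z (s + e) \<subseteq> W"
  proof
    fix u assume u: "u \<in> ball z (s + e)"
    show "u \<in> W"
    proof (cases "u \<in> cball z s")
      case False
      \<comment> \<open>\<open>x\<close> is the radial projection of \<open>u\<close> to the sphere
        of radius \<open>s\<close>; it lies closer than \<open>e\<close> to
        \<open>u\<close>.\<close>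
      define x where "x = z + (s / dist z u) *\<^sub>R (u - z)"
      have d: "dist z u > s" using False by simp
      have "dist z x = s"
        using d W(3) by (cases "u = z") (auto simp: x_def dist_norm norm_minus_commute)
      have "u - x = (1 - s / dist z u) *\<^sub>R (u - z)"
        by (simp add: x_def algebra_simps)
      then have "dist x u = \<bar>1 - s / dist z u\<bar> * dist z u"
        by (simp add: dist_norm norm_minus_commute)
      moreover have "\<bar>1 - s / dist z u\<bar> = 1 - s / dist z u"
        using d W(3) by (intro abs_of_nonneg) (simp add: divide_le_eq_1)
      ultimately have "dist x u = (1 - s / dist z u) * dist z u"
        by metis
      also have "\<dots> = dist z u - s"
        using d W(3) by (auto simp: left_diff_distrib)
      finally have "dist x u = dist z u - s" .
      with \<open>dist z x = s\<close> show ?thesis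
        using u e by (intro subsetD[OF e(2)] UN_I[of x]) auto
    qed (use W in auto)
  qed
  have r: "s + e > 0" "s < s + e" using W e by auto
  have "continuous_on (ball z (s + e) - {z}) (\<lambda>u. h u - h z)"
    using sub by (intro continuous_intros continuous_on_subset[OF W(4)]) auto
  moreover have "h u - h z \<noteq> 0" if "u \<in> ball z (s + e) - {z}" for u
    using ne[of u] sub that by auto
  ultimately obtain l g where g: "continuous_on (ball z (s + e) - {z}) g"
    "\<And>u. u \<in> ball z (s + e) - {z} \<Longrightarrow> h u - h z = (u - z) powi l * exp (g u)"
    using punctured_ball_factorization[OF r(1), of z "\<lambda>u. h u - h z"] by metis
  moreover have "isCont h z"
    using W by (metis centre_in_cball continuous_on_eq_continuous_at less_eq_real_def subsetD)
  ultimately have "has_ldeg h z l"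
    unfolding has_ldeg_def using r by blast
  then show ?thesis
    using winding_number_factorization[OF g W(3) r(2)] has_ldeg_unique[OF h] by simp
qed

lemma has_ldeg_comp:
  assumes h: "has_ldeg h z k" and g: "has_ldeg g (h z) l"
  shows "has_ldeg (g \<circ> h) z (k * l)"
proof -
  obtain r a where r: "r > 0" "continuous_on (ball z r - {z}) a"
    "\<And>u. u \<in> ball z r - {z} \<Longrightarrow> h u - h z = (u - z) powi k * exp (a u)" and ch: "isCont h z"
    using h unfolding has_ldeg_def by blast
  obtain s b where s: "s > 0" "continuous_on (ball (h z) s - {h z}) b"
    "\<And>v. v \<in> ball (h z) s - {h z} \<Longrightarrow> g v - g (h z) = (v - h z) powi l * exp (b v)"
    and cg: "isCont g (h z)"
    using g unfolding has_ldeg_def by blast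
  obtain d where d: "d > 0" "\<And>u. dist u z < d \<Longrightarrow> dist (h u) (h z) < s"
    using ch s(1) unfolding continuous_at_eps_delta by blast
  define e where "e = min r d"
  have e: "e > 0" using r d by (simp add: e_def)
  have er: "ball z e - {z} \<subseteq> ball z r - {z}" by (auto simp: e_def)
  have hin: "h u \<in> ball (h z) s - {h z}" if u: "u \<in> ball z e - {z}" for u
  proof -
    have "h u - h z \<noteq> 0"
      using r(3) u er by (subst r(3)) (auto simp: power_int_eq_0_iff)
    moreover have "dist (h u) (h z) < s" using u by (intro d(2)) (auto simp: e_def dist_commute)
    ultimately show ?thesis by (auto simp: dist_commute)
  qed
  have conth: "continuous_on (ball z e - {z}) h"
  proof -
    have "continuous_on (ball z e - {z}) (\<lambda>u. h z + (u - z) powi k * exp (a u))"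
      using er by (intro continuous_intros continuous_on_subset[OF r(2)]) auto
    moreover have "h z + (u - z) powi k * exp (a u) = h u" if "u \<in> ball z e - {z}" for u
      using r(3) er that by (metis add.commute diff_add_cancel subsetD)
    ultimately show ?thesis using continuous_on_cong by (metis (no_types, lifting))
  qed
  have "continuous_on (ball z e - {z}) (\<lambda>u. of_int l * a u + b (h u))"
    using hin er by (intro continuous_intros continuous_on_subset[OF r(2)]
        continuous_on_compose2[OF s(2) conth]) auto
  moreover have "(g \<circ> h) u - (g \<circ> h) z = (u - z) powi (k * l) * exp (of_int l * a u + b (h u))"
    if u: "u \<in> ball z e - {z}" for u
  proof -
    have "(g \<circ> h) u - (g \<circ> h) z = (h u - h z) powi l * exp (b (h u))"
      using s(3)[OF hin[OF u]] by simp
    also have "h u - h z = (u - z) powi k * exp (a u)"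
      using r(3) u er by blast
    finally show ?thesis
      by (simp add: power_int_mult_distrib power_int_mult exp_power_int exp_add mult_ac)
  qed
  moreover have "isCont (g \<circ> h) z" using ch cg unfolding comp_def by (rule isCont_o2)
  ultimately show ?thesis unfolding has_ldeg_def using e by blast
qed

lemma has_ldeg_cong:
  assumes "has_ldeg h z k" "\<forall>\<^sub>F u in nhds z. h u = g u"
  shows "has_ldeg g z k"
proof -
  obtain r a where r: "r > 0" "continuous_on (ball z r - {z}) a"
    "\<And>u. u \<in> ball z r - {z} \<Longrightarrow> h u - h z = (u - z) powi k * exp (a u)" and ch: "isCont h z"
    using assms(1) unfolding has_ldeg_def by blast
  obtain d where d: "d > 0" "\<And>u. dist u z < d \<Longrightarrow> h u = g u"
    using assms(2) unfolding eventually_nhds_metric by blast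
  have cg: "isCont g z" using ch assms(2) isCont_cong by blast
  have "continuous_on (ball z (min r d) - {z}) a"
    using r(2) by (rule continuous_on_subset) auto
  moreover have "g u - g z = (u - z) powi k * exp (a u)" if "u \<in> ball z (min r d) - {z}" for u
    using r(3)[of u] d(2)[of u] d(2)[of z] d(1) that by (auto simp: dist_commute)
  ultimately show ?thesis unfolding has_ldeg_def using cg r(1) d(1)
    by (intro conjI exI[of _ "min r d"] exI[of _ a]) auto
qed

text \<open>The normalized difference quotient \<open>Q\<close> tends to 1 at \<open>z\<close> and
  therefore avoids the cut of \<open>Ln\<close> near \<open>z\<close>; its logarithm supplies the
  continuous function required for exponent 1.\<close>

lemma has_ldeg_deriv:
  assumes d: "(h has_field_derivative D) (at z)" and D: "D \<noteq> 0"
    and W: "open W" "z \<in> W" "continuous_on W h"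
  shows "has_ldeg h z 1"
proof -
  define Q where "Q u = (h u - h z) / ((u - z) * D)" for u
  have "((\<lambda>u. (h u - h z) / (u - z) / D) \<longlongrightarrow> D / D) (at z)"
    using d unfolding has_field_derivative_iff by (intro tendsto_divide) (use D in auto)
  then have "(Q \<longlongrightarrow> 1) (at z)"
    using D by (simp add: Q_def[abs_def] divide_divide_eq_left)
  then have "\<forall>\<^sub>F u in at z. dist (Q u) 1 < 1"
    by (rule tendstoD) simp
  then obtain e where e: "e > 0" "\<And>u. u \<noteq> z \<Longrightarrow> dist u z < e \<Longrightarrow> dist (Q u) 1 < 1"
    unfolding eventually_at by blast
  obtain e' where e': "e' > 0" "ball z e' \<subseteq> W" using W openE by blast
  define r where "r = min e e'"
  have r: "r > 0" using e e' by (simp add: r_def)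
  have sl: "Q u \<notin> \<real>\<^sub>\<le>\<^sub>0" if "u \<in> ball z r - {z}" for u
  proof -
    have "dist (Q u) 1 < 1" using that by (intro e) (auto simp: r_def dist_commute)
    then have "\<bar>Re (Q u) - 1\<bar> < 1"
      using abs_Re_le_cmod[of "Q u - 1"] by (simp add: dist_norm)
    then show ?thesis by (auto simp: complex_nonpos_Reals_iff)
  qed
  have "continuous_on (ball z r - {z}) (\<lambda>u. Ln (Q u) + Ln D)"
    using sl D e' unfolding Q_def
    by (intro continuous_intros continuous_on_subset[OF W(3)]) (auto simp: r_def)
  moreover have "h u - h z = (u - z) powi 1 * exp (Ln (Q u) + Ln D)" if u: "u \<in> ball z r - {z}" for u
  proof -
    have "Q u \<noteq> 0" using sl[OF u] by auto
    then have "exp (Ln (Q u) + Ln D) = Q u * D" using D by (simp add: exp_add)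
    then show ?thesis using u D by (simp add: Q_def)
  qed
  moreover have "isCont h z" using d by (rule DERIV_isCont)
  ultimately show ?thesis unfolding has_ldeg_def using r by blast
qed

lemma has_ldeg_affine:
  assumes "c \<noteq> 0"
  shows "has_ldeg (\<lambda>u. c * u + b) z 1"
  by (rule has_ldeg_deriv[of _ c _ UNIV]) (use assms in \<open>auto intro!: derivative_eq_intros continuous_intros\<close>)

text \<open>The value is \<open>d\<close> at 0 and 1 elsewhere; only its sign matters when charts
  are tested for positivity.\<close>

lemma has_ldeg_power:
  assumes "d \<ge> 1"
  shows "\<exists>k>0. has_ldeg (\<lambda>u. u ^ d) z k"
proof (cases "z = 0")
  case True
  have "has_ldeg (\<lambda>u. u ^ d) 0 (int d)"
    unfolding has_ldeg_def using assms
    by (intro conjI exI[of _ 1] exI[of _ "\<lambda>_. 0"]) (auto intro!: continuous_intros)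
  then show ?thesis using True assms by (intro exI[of _ "int d"]) auto
next
  case False
  have "((\<lambda>u. u ^ d) has_field_derivative of_nat d * z ^ (d - 1)) (at z)"
    by (auto intro!: derivative_eq_intros)
  then have "has_ldeg (\<lambda>u. u ^ d) z 1"
    by (rule has_ldeg_deriv[where W = UNIV]) (use False assms in \<open>auto intro!: continuous_intros\<close>)
  then show ?thesis by (intro exI[of _ 1]) auto
qed

text \<open>Invariance of domain makes the inverse continuous on an open set, so it has a degree
  \<open>l\<close> as well. Degrees multiply, so the integers satisfy
  \<open>k * l = 1\<close>.\<close>

lemma has_ldeg_inverse:
  assumes W: "open W" "z \<in> W" "continuous_on W h" "inj_on h W"
    and W': "\<And>u. u \<in> W \<Longrightarrow> g (h u) = u" and k: "has_ldeg h z k" "k > 0"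
  shows "k = 1" "has_ldeg g (h z) 1"
proof -
  have ho: "open (h ` W)" using W invariance_of_domain by blast
  have "continuous_on (h ` W) g"
  proof (subst continuous_on_open_vimage[OF ho], intro allI impI)
    fix B :: "complex set" assume "open B"
    have "g -` B \<inter> h ` W = h ` (W \<inter> B)" using W' by auto
    moreover have "open (h ` (W \<inter> B))"
      using W \<open>open B\<close> by (intro invariance_of_domain) (auto intro: continuous_on_subset inj_on_subset)
    ultimately show "open (g -` B \<inter> h ` W)" by simp
  qed
  then obtain l where l: "has_ldeg g (h z) l"
    using has_ldeg_exists[OF ho, of "h z" g] W W' by (metis (no_types, opaque_lifting) DiffD1 DiffD2 image_iff singletonI)
  have "has_ldeg (g \<circ> h) z (k * l)" using k l has_ldeg_comp by blast
  moreover have "has_ldeg (g \<circ> h) z 1"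
  proof (rule has_ldeg_cong[OF has_ldeg_affine[of 1 0]])
    show "\<forall>\<^sub>F u in nhds z. 1 * u + 0 = (g \<circ> h) u"
      using W W' unfolding eventually_nhds by auto
  qed simp
  ultimately have "k * l = 1" using has_ldeg_unique by blast
  then show "k = 1" "has_ldeg g (h z) 1"
    using k l by (auto simp: zmult_eq_1_iff)
qed

text \<open>Injectivity keeps \<open>h z\<close> off the image of every circle about
  \<open>z\<close>, so all admissible circles about \<open>z\<close> see the same exponent. The test
  becomes one condition per point, in a form that composes.\<close>

lemma orientation_preserving_on_iff:
  assumes "open W" "continuous_on W h" "inj_on h W"
  shows "orientation_preserving_on W h \<longleftrightarrow> (\<forall>z\<in>W. has_ldeg h z 1)"
proof
  have ne: "h u \<noteq> h z" if "z \<in> W" "u \<in> W - {z}" for u z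
    using assms(3) that by (auto simp: inj_on_def)
  {
    assume o: "orientation_preserving_on W h"
    show "\<forall>z\<in>W. has_ldeg h z 1"
    proof
      fix z assume z: "z \<in> W"
      then obtain k where k: "has_ldeg h z k"
        using has_ldeg_exists[OF assms(1) z assms(2)] ne by blast
      obtain s where s: "s > 0" "cball z s \<subseteq> W"
        using assms(1) z open_contains_cball by blast
      have "(1::complex) = of_int k"
        using has_ldeg_winding_number[OF k assms(1) s(2,1) assms(2)] ne[OF z] o z s
        unfolding orientation_preserving_on_def by metis
      then show "has_ldeg h z 1" using k by simp
    qed
  }
  assume "\<forall>z\<in>W. has_ldeg h z 1"
  then show "orientation_preserving_on W h"
    unfolding orientation_preserving_on_def
    using has_ldeg_winding_number[OF _ assms(1) _ _ assms(2)] ne by (metis of_int_1)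
qed

section \<open>Plane charts and orientation\<close>

abbreviation pts :: "('a, 'x) oriented_space_scheme \<Rightarrow> 'a set" where
  "pts X \<equiv> topspace (surface_top X)"

lemma open_mult_image_iff:
  assumes "c \<noteq> (0::complex)"
  shows "open ((\<lambda>z. c * z) ` S) \<longleftrightarrow> open S"
proof -
  have op: "open ((\<lambda>z. b * z) ` T)" if "b \<noteq> 0" "open T" for b :: complex and T
  proof -
    have "(\<lambda>z. b * z) ` T = (\<lambda>z. z / b) -` T"
      using that(1) by (auto simp: image_iff intro!: bexI[of _ "_ / b"])
    moreover have "open ((\<lambda>z. z / b) -` T)"
      using that by (intro open_vimage continuous_intros) auto
    ultimately show ?thesis by simp
  qed
  have "(\<lambda>z. inverse c * z) ` (\<lambda>z. c * z) ` S = S"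
    using assms by (simp add: image_image flip: mult.assoc)
  then show ?thesis
    using op[of c S] op[of "inverse c" "(\<lambda>z. c * z) ` S"] assms by auto
qed

text \<open>This form contains neither subtopologies nor an inverse map: a chart is an injection
  that preserves and reflects openness of subsets. New charts are verified in this form.\<close>

lemma plane_chart_iff:
  "plane_chart X U \<phi> \<longleftrightarrow> openin X U \<and> inj_on \<phi> U \<and> (\<forall>A\<subseteq>U. openin X A \<longleftrightarrow> open (\<phi> ` A))"
proof
  assume c: "plane_chart X U \<phi>"
  then have U: "openin X U" and o: "open (\<phi> ` U)"
    and hom: "homeomorphic_map (subtopology X U) (top_of_set (\<phi> ` U)) \<phi>"
    by (auto simp: plane_chart_def)
  have top: "topspace (subtopology X U) = U"
    using openin_subset[OF U] by auto
  have "openin X A \<longleftrightarrow> open (\<phi> ` A)" if A: "A \<subseteq> U" for A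
  proof -
    have "openin X A \<longleftrightarrow> openin (subtopology X U) A"
      using A U openin_open_subtopology by blast
    also have "\<dots> \<longleftrightarrow> openin (top_of_set (\<phi> ` U)) (\<phi> ` A)"
      using homeomorphic_map_openness[OF hom] top A by auto
    also have "\<dots> \<longleftrightarrow> open (\<phi> ` A)"
      using A o openin_open_eq[OF o] by blast
    finally show ?thesis .
  qed
  then show "openin X U \<and> inj_on \<phi> U \<and> (\<forall>A\<subseteq>U. openin X A \<longleftrightarrow> open (\<phi> ` A))"
    using U plane_chart_inj_on[OF c] by blast
next
  assume *: "openin X U \<and> inj_on \<phi> U \<and> (\<forall>A\<subseteq>U. openin X A \<longleftrightarrow> open (\<phi> ` A))"
  then have o: "open (\<phi> ` U)" and U: "openin X U" and inj: "inj_on \<phi> U"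
    and oiff: "\<And>A. A \<subseteq> U \<Longrightarrow> openin X A \<longleftrightarrow> open (\<phi> ` A)"
    by auto
  have top: "topspace (subtopology X U) = U"
    using openin_subset[OF U] by auto
  have "quotient_map (subtopology X U) (top_of_set (\<phi> ` U)) \<phi>"
    unfolding quotient_map_def top
  proof (intro conjI allI impI)
    fix B assume "B \<subseteq> topspace (top_of_set (\<phi> ` U))"
    then have B: "\<phi> ` {x \<in> U. \<phi> x \<in> B} = B" by auto
    have "openin (subtopology X U) {x \<in> U. \<phi> x \<in> B} \<longleftrightarrow> openin X {x \<in> U. \<phi> x \<in> B}"
      using openin_open_subtopology[OF U] by auto
    also have "\<dots> \<longleftrightarrow> open (\<phi> ` {x \<in> U. \<phi> x \<in> B})" by (intro oiff) auto
    also have "\<dots> \<longleftrightarrow> openin (top_of_set (\<phi> ` U)) B"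
      unfolding B using openin_open_eq[OF o] \<open>B \<subseteq> _\<close> by auto
    finally show "openin (subtopology X U) {x \<in> U. \<phi> x \<in> B} = openin (top_of_set (\<phi> ` U)) B" .
  qed auto
  then show "plane_chart X U \<phi>"
    unfolding plane_chart_def homeomorphic_map_def top using o U inj by blast
qed

lemma plane_chartD:
  assumes "plane_chart X U \<phi>"
  shows "openin X U" "inj_on \<phi> U" "U \<subseteq> topspace X" "open (\<phi> ` U)"
    "\<And>A. A \<subseteq> U \<Longrightarrow> openin X A \<longleftrightarrow> open (\<phi> ` A)"
    "\<And>u. u \<in> U \<Longrightarrow> inv_into U \<phi> (\<phi> u) = u"
proof -
  show U: "openin X U" and inj: "inj_on \<phi> U" and "\<And>A. A \<subseteq> U \<Longrightarrow> openin X A \<longleftrightarrow> open (\<phi> ` A)"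
    using assms unfolding plane_chart_iff by auto
  then show "open (\<phi> ` U)" "U \<subseteq> topspace X" using openin_subset by blast+
  show "inv_into U \<phi> (\<phi> u) = u" if "u \<in> U" for u using inj that by simp
qed

lemma plane_chart_preimage:
  assumes "plane_chart X U \<phi>" "open B"
  shows "openin X {u \<in> U. \<phi> u \<in> B}"
proof -
  have "\<phi> ` {u \<in> U. \<phi> u \<in> B} = \<phi> ` U \<inter> B" by auto
  then have "open (\<phi> ` {u \<in> U. \<phi> u \<in> B})" using assms plane_chartD(4)[OF assms(1)] by auto
  then show ?thesis using plane_chartD(5)[OF assms(1), of "{u \<in> U. \<phi> u \<in> B}"] by auto
qed

lemma plane_chart_transition:
  assumes U: "plane_chart X U \<phi>" and V: "plane_chart X V \<beta>"
  shows "open (\<beta> ` (U \<inter> V))" "continuous_on (\<beta> ` (U \<inter> V)) (\<phi> \<circ> inv_into V \<beta>)"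
    "inj_on (\<phi> \<circ> inv_into V \<beta>) (\<beta> ` (U \<inter> V))"
proof -
  have UV: "openin X (U \<inter> V)"
    using plane_chartD(1) U V by blast
  then show o: "open (\<beta> ` (U \<inter> V))"
    using plane_chartD(5)[OF V, of "U \<inter> V"] by auto
  show "continuous_on (\<beta> ` (U \<inter> V)) (\<phi> \<circ> inv_into V \<beta>)"
  proof (subst continuous_on_open_vimage[OF o], intro allI impI)
    fix B :: "complex set" assume B: "open B"
    have "(\<phi> \<circ> inv_into V \<beta>) -` B \<inter> \<beta> ` (U \<inter> V) = \<beta> ` ({u \<in> U. \<phi> u \<in> B} \<inter> V)"
      using plane_chartD(6)[OF V] by auto
    moreover have "openin X ({u \<in> U. \<phi> u \<in> B} \<inter> V)"
      using plane_chart_preimage[OF U B] plane_chartD(1)[OF V] by blast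
    ultimately show "open ((\<phi> \<circ> inv_into V \<beta>) -` B \<inter> \<beta> ` (U \<inter> V))"
      using plane_chartD(5)[OF V, of "{u \<in> U. \<phi> u \<in> B} \<inter> V"] by auto
  qed
  show "inj_on (\<phi> \<circ> inv_into V \<beta>) (\<beta> ` (U \<inter> V))"
    using plane_chartD(6)[OF V] plane_chartD(2)[OF U] by (auto simp: inj_on_def)
qed

lemma plane_chart_transition_inverse:
  assumes U: "plane_chart X U \<phi>" and V: "plane_chart X V \<beta>" and x: "x \<in> U \<inter> V"
    and k: "has_ldeg (\<phi> \<circ> inv_into V \<beta>) (\<beta> x) k" "k > 0"
  shows "k = 1" "has_ldeg (\<beta> \<circ> inv_into U \<phi>) (\<phi> x) 1"
proof -
  have "(\<beta> \<circ> inv_into U \<phi>) ((\<phi> \<circ> inv_into V \<beta>) u) = u" if "u \<in> \<beta> ` (U \<inter> V)" for u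
    using plane_chartD(6)[OF V] plane_chartD(6)[OF U] that by auto
  note inv = has_ldeg_inverse[OF plane_chart_transition(1)[OF U V] _ plane_chart_transition(2,3)[OF U V] this k]
  show "k = 1" using inv(1) x by auto
  show "has_ldeg (\<beta> \<circ> inv_into U \<phi>) (\<phi> x) 1"
    using inv(2) x plane_chartD(6)[OF V, of x] by (simp add: comp_def)
qed

lemma positive_chart_iff:
  "positive_chart X U \<phi> \<longleftrightarrow> plane_chart (surface_top X) U \<phi> \<and>
     (\<forall>(V, \<beta>)\<in>atlas X. orientation_preserving_on (\<phi> ` (U \<inter> V)) (\<beta> \<circ> inv_into U \<phi>))"
  unfolding positive_chart_def compatible_charts_def ..

lemma surface_atlas:
  assumes "surface X" "(V, \<beta>) \<in> atlas X"
  shows "positive_chart X V \<beta>" "plane_chart (surface_top X) V \<beta>"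
proof -
  show "positive_chart X V \<beta>" using assms unfolding surface_def by auto
  then show "plane_chart (surface_top X) V \<beta>" by (simp add: positive_chart_def)
qed

lemma surface_atlas_cover:
  assumes "surface X" "x \<in> pts X"
  obtains V \<beta> where "(V, \<beta>) \<in> atlas X" "x \<in> V"
proof -
  have "x \<in> (\<Union>(U, \<phi>) \<in> atlas X. U)" using assms unfolding surface_def by simp
  then show thesis using that by blast
qed

lemma positive_chart_ldeg:
  assumes X: "surface X" and U: "positive_chart X U \<phi>" and V: "(V, \<beta>) \<in> atlas X" and x: "x \<in> U \<inter> V"
  shows "has_ldeg (\<beta> \<circ> inv_into U \<phi>) (\<phi> x) 1" "has_ldeg (\<phi> \<circ> inv_into V \<beta>) (\<beta> x) 1"
proof -
  have pU: "plane_chart (surface_top X) U \<phi>" using U positive_chart_def by blast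
  note pV = surface_atlas(2)[OF X V]
  have "orientation_preserving_on (\<phi> ` (V \<inter> U)) (\<beta> \<circ> inv_into U \<phi>)"
    using U V unfolding positive_chart_iff by (auto simp: Int_commute)
  then show 1: "has_ldeg (\<beta> \<circ> inv_into U \<phi>) (\<phi> x) 1"
    using orientation_preserving_on_iff[OF plane_chart_transition[OF pV pU]] x by blast
  then show "has_ldeg (\<phi> \<circ> inv_into V \<beta>) (\<beta> x) 1"
    using plane_chart_transition_inverse(2)[OF pV pU _ 1] x by auto
qed

text \<open>
  The local degree of a plane-valued function in a chart of the atlas; by \<open>has_cdeg_chart\<close> below it
  does not depend on the chart.
\<close>

definition has_cdeg :: "'a oriented_space \<Rightarrow> ('a \<Rightarrow> complex) \<Rightarrow> 'a \<Rightarrow> int \<Rightarrow> bool" where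
  "has_cdeg X \<phi> x k \<longleftrightarrow> (\<exists>(V, \<beta>)\<in>atlas X. x \<in> V \<and> has_ldeg (\<phi> \<circ> inv_into V \<beta>) (\<beta> x) k)"

lemma has_cdeg_comp:
  assumes "surface X" "has_cdeg X \<phi> x k" "has_ldeg a (\<phi> x) l"
  shows "has_cdeg X (a \<circ> \<phi>) x (k * l)"
proof -
  obtain V \<beta> where V: "(V, \<beta>) \<in> atlas X" "x \<in> V" "has_ldeg (\<phi> \<circ> inv_into V \<beta>) (\<beta> x) k"
    using assms unfolding has_cdeg_def by blast
  have "(\<phi> \<circ> inv_into V \<beta>) (\<beta> x) = \<phi> x"
    using V plane_chartD(6)[OF surface_atlas(2)[OF assms(1) V(1)]] by simp
  then have "has_ldeg (a \<circ> (\<phi> \<circ> inv_into V \<beta>)) (\<beta> x) (k * l)"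
    using has_ldeg_comp[OF V(3)] assms(3) by simp
  then show ?thesis unfolding has_cdeg_def using V by (auto simp: comp_assoc)
qed

lemma eventually_chart:
  assumes V: "plane_chart X V \<beta>" and N: "openin X N" "x \<in> N \<inter> V"
  shows "\<forall>\<^sub>F v in nhds (\<beta> x). v \<in> \<beta> ` (N \<inter> V)"
proof (rule eventually_nhds_in_open)
  have "openin X (N \<inter> V)" using N plane_chartD(1)[OF V] by blast
  then show "open (\<beta> ` (N \<inter> V))" using plane_chartD(5)[OF V, of "N \<inter> V"] by auto
qed (use N in auto)

lemma has_cdeg_chart:
  assumes X: "surface X" and k: "has_cdeg X \<phi> x k" and V: "(V, \<beta>) \<in> atlas X" "x \<in> V"
  shows "has_ldeg (\<phi> \<circ> inv_into V \<beta>) (\<beta> x) k"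
proof -
  obtain A \<alpha> where A: "(A, \<alpha>) \<in> atlas X" "x \<in> A" "has_ldeg (\<phi> \<circ> inv_into A \<alpha>) (\<alpha> x) k"
    using k unfolding has_cdeg_def by blast
  note pA = surface_atlas[OF X A(1)] and pV = surface_atlas[OF X V(1)]
  have 1: "has_ldeg (\<alpha> \<circ> inv_into V \<beta>) (\<beta> x) 1"
    using positive_chart_ldeg(1)[OF X pV(1) A(1)] A V by blast
  have "has_ldeg ((\<phi> \<circ> inv_into A \<alpha>) \<circ> (\<alpha> \<circ> inv_into V \<beta>)) (\<beta> x) (1 * k)"
    by (rule has_ldeg_comp[OF 1]) (use A V plane_chartD(6)[OF pV(2)] in simp)
  then have "has_ldeg ((\<phi> \<circ> inv_into A \<alpha>) \<circ> (\<alpha> \<circ> inv_into V \<beta>)) (\<beta> x) k" by simp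
  then show ?thesis
  proof (rule has_ldeg_cong)
    have "\<forall>\<^sub>F v in nhds (\<beta> x). v \<in> \<beta> ` (A \<inter> V)"
      using eventually_chart[OF pV(2) plane_chartD(1)[OF pA(2)]] A V by blast
    then show "\<forall>\<^sub>F u in nhds (\<beta> x). ((\<phi> \<circ> inv_into A \<alpha>) \<circ> (\<alpha> \<circ> inv_into V \<beta>)) u = (\<phi> \<circ> inv_into V \<beta>) u"
      by eventually_elim (use plane_chartD(6)[OF pV(2)] plane_chartD(6)[OF pA(2)] in auto)
  qed
qed

lemma has_cdeg_unique:
  assumes "surface X" "has_cdeg X \<phi> x k" "has_cdeg X \<phi> x l"
  shows "k = l"
proof -
  obtain V \<beta> where V: "(V, \<beta>) \<in> atlas X" "x \<in> V"
    using assms(2) unfolding has_cdeg_def by blast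
  show ?thesis
    using has_ldeg_unique has_cdeg_chart[OF assms(1,2) V] has_cdeg_chart[OF assms(1,3) V] by blast
qed

lemma has_cdeg_cong:
  assumes X: "surface X" and k: "has_cdeg X \<phi> x k" and N: "openin (surface_top X) N" "x \<in> N"
    and eq: "\<And>u. u \<in> N \<Longrightarrow> \<phi> u = \<psi> u"
  shows "has_cdeg X \<psi> x k"
proof -
  obtain V \<beta> where V: "(V, \<beta>) \<in> atlas X" "x \<in> V" "has_ldeg (\<phi> \<circ> inv_into V \<beta>) (\<beta> x) k"
    using k unfolding has_cdeg_def by blast
  note pV = surface_atlas(2)[OF X V(1)]
  have "\<forall>\<^sub>F v in nhds (\<beta> x). v \<in> \<beta> ` (N \<inter> V)"
    using eventually_chart[OF pV N(1)] N V by blast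
  then have "\<forall>\<^sub>F v in nhds (\<beta> x). (\<phi> \<circ> inv_into V \<beta>) v = (\<psi> \<circ> inv_into V \<beta>) v"
    by eventually_elim (use plane_chartD(6)[OF pV] eq in auto)
  then show ?thesis using V has_ldeg_cong unfolding has_cdeg_def by fast
qed

lemma plane_chart_has_cdeg:
  assumes X: "surface X" and U: "plane_chart (surface_top X) U \<phi>" and x: "x \<in> U"
  shows "\<exists>k. has_cdeg X \<phi> x k"
proof -
  obtain V \<beta> where V: "(V, \<beta>) \<in> atlas X" "x \<in> V"
    using surface_atlas_cover[OF X] plane_chartD(3)[OF U] x by blast
  note t = plane_chart_transition[OF U surface_atlas(2)[OF X V(1)]]
  have "\<exists>k. has_ldeg (\<phi> \<circ> inv_into V \<beta>) (\<beta> x) k"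
  proof (rule has_ldeg_exists[OF t(1) _ t(2)])
    show 1: "\<beta> x \<in> \<beta> ` (U \<inter> V)" using V x by blast
    show "(\<phi> \<circ> inv_into V \<beta>) v \<noteq> (\<phi> \<circ> inv_into V \<beta>) (\<beta> x)" if "v \<in> \<beta> ` (U \<inter> V) - {\<beta> x}" for v
      using inj_onD[OF t(3) _ _ 1, of v] that by blast
  qed
  then show ?thesis using V unfolding has_cdeg_def by blast
qed

lemma positive_chart_has_cdeg:
  assumes X: "surface X" and U: "positive_chart X U \<phi>" and x: "x \<in> U"
  shows "has_cdeg X \<phi> x 1"
proof -
  have "plane_chart (surface_top X) U \<phi>" using U positive_chart_def by blast
  then obtain V \<beta> where V: "(V, \<beta>) \<in> atlas X" "x \<in> V"
    using surface_atlas_cover[OF X] plane_chartD(3) x by blast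
  then show ?thesis
    using positive_chart_ldeg(2)[OF X U V(1)] x unfolding has_cdeg_def by fast
qed

text \<open>Positive degrees suffice: transition maps are injective, so their degrees are units in
  the integers, and a positive unit is 1.\<close>

lemma positive_chartI:
  assumes X: "surface X" and U: "plane_chart (surface_top X) U \<phi>"
    and k: "\<And>x. x \<in> U \<Longrightarrow> \<exists>k>0. has_cdeg X \<phi> x k"
  shows "positive_chart X U \<phi>"
  unfolding positive_chart_iff
proof (intro conjI U ballI, clarify)
  fix V \<beta> assume V: "(V, \<beta>) \<in> atlas X"
  note pV = surface_atlas(2)[OF X V]
  have "has_ldeg (\<beta> \<circ> inv_into U \<phi>) (\<phi> x) 1" if x: "x \<in> U \<inter> V" for x
  proof -
    obtain k where "k > 0" "has_cdeg X \<phi> x k" using k x by blast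
    then show ?thesis
      using plane_chart_transition_inverse(2)[OF U pV x has_cdeg_chart[OF X _ V]] x by blast
  qed
  then show "orientation_preserving_on (\<phi> ` (U \<inter> V)) (\<beta> \<circ> inv_into U \<phi>)"
    using orientation_preserving_on_iff[OF plane_chart_transition[OF pV U]] by (auto simp: Int_commute)
qed

text \<open>Positivity compares a chart with the charts of the atlas only, so the transition is
  routed through an atlas chart around \<open>x\<close>.\<close>

lemma positive_charts_transition:
  assumes X: "surface X" and U: "positive_chart X U \<phi>" and V: "positive_chart X V \<psi>" and x: "x \<in> U \<inter> V"
  shows "has_ldeg (\<psi> \<circ> inv_into U \<phi>) (\<phi> x) 1"
proof -
  have pU: "plane_chart (surface_top X) U \<phi>" and pV: "plane_chart (surface_top X) V \<psi>"
    using U V positive_chart_def by blast+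
  obtain A \<alpha> where A: "(A, \<alpha>) \<in> atlas X" "x \<in> A"
    using surface_atlas_cover[OF X] plane_chartD(3)[OF pU] x by blast
  note pA = surface_atlas(2)[OF X A(1)]
  have 1: "has_ldeg (\<alpha> \<circ> inv_into U \<phi>) (\<phi> x) 1" and 2: "has_ldeg (\<psi> \<circ> inv_into A \<alpha>) (\<alpha> x) 1"
    using positive_chart_ldeg[OF X U A(1)] positive_chart_ldeg[OF X V A(1)] A x by blast+
  have "has_ldeg ((\<psi> \<circ> inv_into A \<alpha>) \<circ> (\<alpha> \<circ> inv_into U \<phi>)) (\<phi> x) (1 * 1)"
    by (rule has_ldeg_comp[OF 1]) (use 2 x plane_chartD(6)[OF pU] in simp)
  then have "has_ldeg ((\<psi> \<circ> inv_into A \<alpha>) \<circ> (\<alpha> \<circ> inv_into U \<phi>)) (\<phi> x) 1" by simp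
  then show ?thesis
  proof (rule has_ldeg_cong)
    have "\<forall>\<^sub>F v in nhds (\<phi> x). v \<in> \<phi> ` (A \<inter> U)"
      using eventually_chart[OF pU plane_chartD(1)[OF pA]] A x by blast
    then show "\<forall>\<^sub>F u in nhds (\<phi> x). ((\<psi> \<circ> inv_into A \<alpha>) \<circ> (\<alpha> \<circ> inv_into U \<phi>)) u = (\<psi> \<circ> inv_into U \<phi>) u"
      by eventually_elim (use plane_chartD(6)[OF pU] plane_chartD(6)[OF pA] in auto)
  qed
qed

section \<open>Charts onto the unit disc\<close>

definition disc_chart :: "'a oriented_space \<Rightarrow> 'a \<Rightarrow> 'a set \<Rightarrow> ('a \<Rightarrow> complex) \<Rightarrow> bool" where
  "disc_chart X x U \<phi> \<longleftrightarrow> positive_chart X U \<phi> \<and> x \<in> U \<and> \<phi> ` U = ball 0 1 \<and> \<phi> x = 0"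

lemma disc_chartD:
  assumes "disc_chart X x U \<phi>"
  shows "plane_chart (surface_top X) U \<phi>" "positive_chart X U \<phi>" "x \<in> U" "\<phi> ` U = ball 0 1" "\<phi> x = 0"
    "openin (surface_top X) U" "inj_on \<phi> U" "U \<subseteq> pts X"
    "\<And>u. u \<in> U \<Longrightarrow> cmod (\<phi> u) < 1" "\<And>u. u \<in> U \<Longrightarrow> \<phi> u = 0 \<longleftrightarrow> u = x"
    "\<And>u. u \<in> U \<Longrightarrow> inv_into U \<phi> (\<phi> u) = u"
    "\<And>z. cmod z < 1 \<Longrightarrow> inv_into U \<phi> z \<in> U" "\<And>z. cmod z < 1 \<Longrightarrow> \<phi> (inv_into U \<phi> z) = z"
proof -
  show pc: "plane_chart (surface_top X) U \<phi>" "positive_chart X U \<phi>" "x \<in> U" "\<phi> ` U = ball 0 1" "\<phi> x = 0"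
    using assms by (auto simp: disc_chart_def positive_chart_def)
  show "openin (surface_top X) U" "inj_on \<phi> U" "U \<subseteq> pts X"
    "\<And>u. u \<in> U \<Longrightarrow> inv_into U \<phi> (\<phi> u) = u"
    using plane_chartD[OF pc(1)] by auto
  then show "\<phi> u = 0 \<longleftrightarrow> u = x" if "u \<in> U" for u
    using pc(3,5) that \<open>inj_on \<phi> U\<close> by (metis inj_onD)
  show "cmod (\<phi> u) < 1" if "u \<in> U" for u
    using imageI[OF that, of \<phi>] pc(4) by simp
  fix z :: complex assume "cmod z < 1"
  then have "z \<in> \<phi> ` U" using pc(4) by simp
  then show "inv_into U \<phi> z \<in> U" "\<phi> (inv_into U \<phi> z) = z"
    by (simp_all add: inv_into_into f_inv_into_f)
qed

text \<open>A complex \<open>c\<close> serves two purposes: a real \<open>c\<close> cuts a small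
  disc out of a chart, and a \<open>c\<close> of modulus 1 rotates a disc chart. Affine maps have
  degree 1, so positivity survives.\<close>

lemma disc_chart_scale:
  assumes X: "surface X" and U: "positive_chart X U \<phi>" and x: "x \<in> U" and c: "c \<noteq> 0"
    and b: "ball (\<phi> x) (cmod c) \<subseteq> \<phi> ` U"
  shows "disc_chart X x {u \<in> U. \<phi> u \<in> ball (\<phi> x) (cmod c)} (\<lambda>u. (\<phi> u - \<phi> x) / c)"
proof -
  define U' where "U' = {u \<in> U. \<phi> u \<in> ball (\<phi> x) (cmod c)}"
  define \<phi>' where "\<phi>' = (\<lambda>u. (\<phi> u - \<phi> x) / c)"
  have pU: "plane_chart (surface_top X) U \<phi>" using U positive_chart_def by blast
  have o: "openin (surface_top X) U'"
    unfolding U'_def by (rule plane_chart_preimage[OF pU]) simp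
  have \<phi>': "\<phi>' u = inverse c * \<phi> u + (- \<phi> x / c)" for u
    using c by (simp add: \<phi>'_def divide_inverse mult.commute right_diff_distrib)
  have "openin (surface_top X) A \<longleftrightarrow> open (\<phi>' ` A)" if A: "A \<subseteq> U'" for A
  proof -
    have "\<phi>' ` A = (\<lambda>z. (- \<phi> x / c) + z) ` (\<lambda>z. inverse c * z) ` \<phi> ` A"
      by (auto simp: \<phi>' image_image add.commute)
    moreover have "open ((\<lambda>z. inverse c * z) ` \<phi> ` A) \<longleftrightarrow> open (\<phi> ` A)"
      using c by (intro open_mult_image_iff) simp
    ultimately have "open (\<phi>' ` A) \<longleftrightarrow> open (\<phi> ` A)"
      using open_translation[of "(\<lambda>z. inverse c * z) ` \<phi> ` A" "- \<phi> x / c"]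
        open_translation[of "(\<lambda>z. (- \<phi> x / c) + z) ` (\<lambda>z. inverse c * z) ` \<phi> ` A" "\<phi> x / c"]
      by (auto simp: image_image)
    moreover have "A \<subseteq> U" using A U'_def by auto
    ultimately show ?thesis using plane_chartD(5)[OF pU] by auto
  qed
  moreover have "inj_on \<phi>' U'"
    using c plane_chartD(2)[OF pU] by (auto simp: inj_on_def \<phi>'_def U'_def)
  ultimately have pc: "plane_chart (surface_top X) U' \<phi>'"
    unfolding plane_chart_iff using o by blast
  have "positive_chart X U' \<phi>'"
  proof (rule positive_chartI[OF X pc])
    fix u assume "u \<in> U'"
    then have "has_cdeg X \<phi> u 1"
      using positive_chart_has_cdeg[OF X U] by (auto simp: U'_def)
    then have "has_cdeg X ((\<lambda>z. inverse c * z + (- \<phi> x / c)) \<circ> \<phi>) u (1 * 1)"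
      using c by (intro has_cdeg_comp[OF X] has_ldeg_affine) auto
    moreover have "(\<lambda>z. inverse c * z + (- \<phi> x / c)) \<circ> \<phi> = \<phi>'"
      using \<phi>' by auto
    ultimately show "\<exists>k>0. has_cdeg X \<phi>' u k" by (intro exI[of _ 1]) auto
  qed
  moreover have "\<phi>' ` U' = ball 0 1"
  proof
    show "\<phi>' ` U' \<subseteq> ball 0 1"
      using c by (auto simp: \<phi>'_def U'_def dist_norm norm_minus_commute norm_divide divide_less_eq_1)
    show "ball 0 1 \<subseteq> \<phi>' ` U'"
    proof
      fix z :: complex assume "z \<in> ball 0 1"
      then have "\<phi> x + c * z \<in> ball (\<phi> x) (cmod c)"
        using c by (simp add: dist_norm norm_mult)
      then obtain u where "u \<in> U" "\<phi> u = \<phi> x + c * z" using b by force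
      then show "z \<in> \<phi>' ` U'"
        using c \<open>\<phi> x + c * z \<in> ball (\<phi> x) (cmod c)\<close>
        by (intro image_eqI[of _ _ u]) (auto simp: \<phi>'_def U'_def)
    qed
  qed
  ultimately show ?thesis
    unfolding disc_chart_def using x c by (auto simp: \<phi>'_def U'_def)
qed

lemma disc_chart_exists:
  assumes X: "surface X" and N: "openin (surface_top X) N" "x \<in> N"
  obtains U \<phi> where "disc_chart X x U \<phi>" "U \<subseteq> N"
proof -
  obtain V \<beta> where V: "(V, \<beta>) \<in> atlas X" "x \<in> V"
    using surface_atlas_cover[OF X] openin_subset[OF N(1)] N(2) by blast
  note pV = surface_atlas[OF X V(1)]
  have "openin (surface_top X) (N \<inter> V)" using N plane_chartD(1)[OF pV(2)] by blast
  then have "open (\<beta> ` (N \<inter> V))" using plane_chartD(5)[OF pV(2), of "N \<inter> V"] by auto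
  moreover have "\<beta> x \<in> \<beta> ` (N \<inter> V)" using N V by auto
  ultimately obtain r where r: "r > 0" "ball (\<beta> x) r \<subseteq> \<beta> ` (N \<inter> V)"
    using openE by blast
  have "disc_chart X x {u \<in> V. \<beta> u \<in> ball (\<beta> x) (cmod (of_real r))} (\<lambda>u. (\<beta> u - \<beta> x) / of_real r)"
    using r by (intro disc_chart_scale[OF X pV(1) V(2)]) auto
  moreover have "{u \<in> V. \<beta> u \<in> ball (\<beta> x) (cmod (of_real r))} \<subseteq> N"
  proof
    fix u assume u: "u \<in> {u \<in> V. \<beta> u \<in> ball (\<beta> x) (cmod (of_real r))}"
    then have "\<beta> u \<in> \<beta> ` (N \<inter> V)" using r by auto
    then show "u \<in> N" using u plane_chartD(2)[OF pV(2)] by (auto dest: inj_onD)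
  qed
  ultimately show thesis using that by blast
qed

lemma disc_chart_rotate:
  assumes X: "surface X" and U: "disc_chart X x U \<phi>" and c: "cmod c = 1"
  shows "disc_chart X x U (\<lambda>u. c * \<phi> u)"
proof -
  have "c \<noteq> 0" using c by auto
  have "{u \<in> U. \<phi> u \<in> ball (\<phi> x) (cmod (inverse c))} = U"
    using disc_chartD(5,9)[OF U] c by (auto simp: norm_inverse)
  moreover have "(\<lambda>u. (\<phi> u - \<phi> x) / inverse c) = (\<lambda>u. c * \<phi> u)"
    using disc_chartD(5)[OF U] \<open>c \<noteq> 0\<close> by (auto simp: field_simps)
  ultimately show ?thesis
    using disc_chart_scale[OF X disc_chartD(2,3)[OF U], of "inverse c"] disc_chartD(4,5)[OF U] c \<open>c \<noteq> 0\<close>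
    by (simp add: norm_inverse)
qed

section \<open>Normal forms of branched coverings\<close>

text \<open>
  The transition \<open>\<theta>\<close> from \<open>\<psi>'\<close> to \<open>\<psi>\<close> fixes \<open>0\<close> and has degree \<open>1\<close> there because both charts are
  positive. Hence \<open>\<theta> v = v * exp (g v)\<close>, and \<open>\<kappa> z = z * exp (g (z ^ d) / d)\<close> satisfies
  \<open>\<kappa> z ^ d = \<theta> (z ^ d)\<close>; the new chart is \<open>\<phi>\<close> followed by the inverse of \<open>\<kappa>\<close>.
\<close>

lemma power_chart_lift:
  assumes R: "surface R" and C: "surface C" and U: "disc_chart R x U \<phi>" and V: "disc_chart C y V \<psi>"
    and d: "d \<ge> 1" and f: "\<And>u. u \<in> U \<Longrightarrow> f u \<in> V" "\<And>u. u \<in> U \<Longrightarrow> \<psi> (f u) = \<phi> u ^ d"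
    and V': "disc_chart C y V' \<psi>'" "V' \<subseteq> V"
  shows "\<exists>\<phi>'. disc_chart R x {u \<in> U. f u \<in> V'} \<phi>' \<and> (\<forall>u\<in>{u \<in> U. f u \<in> V'}. \<psi>' (f u) = \<phi>' u ^ d)"
proof -
  note U' = disc_chartD[OF U] and pV = disc_chartD[OF V] and pV' = disc_chartD[OF V'(1)]
  define D where "D = ball (0::complex) 1"
  define \<theta> where "\<theta> = \<psi> \<circ> inv_into V' \<psi>'"
  have im: "\<psi>' ` (V \<inter> V') = D" using V' pV'(4) by (auto simp: D_def Int_absorb1)
  have cont\<theta>: "continuous_on D \<theta>" and inj\<theta>: "inj_on \<theta> D"
    using plane_chart_transition[OF pV(1) pV'(1)] im by (simp_all add: \<theta>_def)
  have "has_ldeg \<theta> (\<psi>' y) 1"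
    using positive_charts_transition[OF C pV'(2) pV(2), of y] pV(3) pV'(3) by (simp add: \<theta>_def)
  then have ldeg\<theta>: "has_ldeg \<theta> 0 1" using pV'(5) by simp
  have \<theta>0: "\<theta> 0 = 0"
    using pV'(11)[OF pV'(3)] pV'(5) pV(5) by (simp add: \<theta>_def)
  have \<theta>D: "cmod (\<theta> v) < 1" if "v \<in> D" for v
    using that pV'(12)[of v] V'(2) pV(9) by (auto simp: \<theta>_def D_def)
  have \<theta>nz: "\<theta> v \<noteq> 0" if "v \<in> D - {0}" for v
    using that \<theta>0 inj\<theta> by (auto simp: inj_on_def D_def)
  obtain k g where g: "continuous_on (D - {0}) g"
    "\<And>v. v \<in> D - {0} \<Longrightarrow> \<theta> v = (v - 0) powi k * exp (g v)"
    unfolding D_def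
    by (rule punctured_ball_factorization[of 1 0 \<theta>])
      (use \<theta>nz in \<open>auto intro: continuous_on_subset[OF cont\<theta>] simp: D_def\<close>)
  have "isCont \<theta> 0" using ldeg\<theta> by (simp add: has_ldeg_def)
  then have "has_ldeg \<theta> 0 k"
    unfolding has_ldeg_def using g \<theta>0 unfolding D_def
    by (intro conjI exI[of _ 1] exI[of _ g]) simp_all
  then have k: "k = 1" using has_ldeg_unique ldeg\<theta> by blast
  define \<kappa> where "\<kappa> z = (if z = 0 then 0 else z * exp (g (z ^ d) / of_nat d))" for z
  have powD: "z ^ d \<in> D - {0}" if "z \<in> D - {0}" for z
    using that d by (auto simp: D_def norm_power power_less_one_iff)
  have powD': "z ^ d \<in> D" if "z \<in> D" for z
    using powD[of z] that d by (cases "z = 0") (auto simp: D_def power_0_left)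
  have \<kappa>pow: "\<kappa> z ^ d = \<theta> (z ^ d)" if "z \<in> D" for z
  proof (cases "z = 0")
    case False
    have "\<kappa> z ^ d = z ^ d * exp (g (z ^ d))"
      using False d by (simp add: \<kappa>_def power_mult_distrib exp_divide_power_eq)
    then show ?thesis using g(2)[of "z ^ d"] powD[of z] k False that by simp
  qed (use d \<theta>0 in \<open>auto simp: \<kappa>_def power_0_left\<close>)
  have \<kappa>rot: "\<kappa> (w * z) = w * \<kappa> z" if "w ^ d = 1" for w z
    using that d by (cases "w = 0") (auto simp: \<kappa>_def power_mult_distrib)
  have oD: "open D" by (simp add: D_def)
  have cont\<kappa>: "continuous_on D \<kappa>"
  proof (rule continuous_at_imp_continuous_on, rule)
    fix z assume z: "z \<in> D"
    show "isCont \<kappa> z"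
    proof (cases "z = 0")
      case True
      \<comment> \<open>Nothing is known about \<open>g\<close> near 0. Continuity of
        \<open>\<kappa>\<close> there comes from the \<open>d\<close>-th power of its modulus, which
        is the modulus of \<open>\<theta> (u ^ d)\<close>.\<close>
      show ?thesis unfolding True continuous_at_eps_delta
      proof (intro allI impI)
        fix e :: real assume e: "e > 0"
        then obtain s where s: "s > 0" "\<And>v. dist v 0 < s \<Longrightarrow> dist (\<theta> v) (\<theta> 0) < e ^ d"
          using \<open>isCont \<theta> 0\<close> unfolding continuous_at_eps_delta by (meson zero_less_power)
        have "dist (\<kappa> u) (\<kappa> 0) < e" if u: "dist u 0 < min s 1" for u
        proof -
          have "cmod (u ^ d) \<le> cmod u"
            using u d by (simp add: norm_power power_le_one_iff power_decreasing[of 1 d "cmod u", simplified])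
          then have "cmod (\<theta> (u ^ d)) < e ^ d"
            using s(2)[of "u ^ d"] u \<theta>0 by simp
          then have "cmod (\<kappa> u) ^ d < e ^ d"
            using \<kappa>pow[of u] u by (simp add: D_def flip: norm_power)
          then show ?thesis using e by (simp add: \<kappa>_def[of 0] power_less_imp_less_base)
        qed
        then show "\<exists>s>0. \<forall>u. dist u 0 < s \<longrightarrow> dist (\<kappa> u) (\<kappa> 0) < e"
          using s(1) by (intro exI[of _ "min s 1"]) auto
      qed
    next
      case False
      have "continuous_on (D - {0}) (\<lambda>z. z * exp (g (z ^ d) / of_nat d))"
        using powD d by (intro continuous_intros continuous_on_compose2[OF g(1)]) auto
      then have "continuous_on (D - {0}) \<kappa>"
        by (rule continuous_on_cong[THEN iffD1, rotated 2]) (auto simp: \<kappa>_def)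
      then show ?thesis
        using False z oD by (metis DiffI continuous_on_eq_continuous_at open_delete singletonD)
    qed
  qed
  have inj\<kappa>: "inj_on \<kappa> D"
  proof (rule inj_onI)
    fix z w assume zw: "z \<in> D" "w \<in> D" "\<kappa> z = \<kappa> w"
    then have "\<theta> (z ^ d) = \<theta> (w ^ d)" using \<kappa>pow by metis
    then have "z ^ d = w ^ d" using inj\<theta> powD' zw by (auto dest: inj_onD)
    \<comment> \<open>Equal \<open>d\<close>-th powers give equal exponential factors in
      \<open>\<kappa> z\<close> and \<open>\<kappa> w\<close>, and these cancel.\<close>
    then show "z = w" using zw(3) by (auto simp: \<kappa>_def split: if_splits)
  qed
  have \<kappa>U: "inv_into U \<phi> (\<kappa> z) \<in> U" "f (inv_into U \<phi> (\<kappa> z)) \<in> V'"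
    "\<psi>' (f (inv_into U \<phi> (\<kappa> z))) = z ^ d" "\<phi> (inv_into U \<phi> (\<kappa> z)) = \<kappa> z" if z: "z \<in> D" for z
  proof -
    have "cmod (\<kappa> z) ^ d < 1 ^ d"
      using \<kappa>pow[OF z] \<theta>D[OF powD'[OF z]] by (simp flip: norm_power)
    then have k1: "cmod (\<kappa> z) < 1" by (rule power_less_imp_less_base) simp
    show u: "inv_into U \<phi> (\<kappa> z) \<in> U" and eq: "\<phi> (inv_into U \<phi> (\<kappa> z)) = \<kappa> z"
      using U'(12,13) k1 by auto
    have v: "inv_into V' \<psi>' (z ^ d) \<in> V'" "\<psi>' (inv_into V' \<psi>' (z ^ d)) = z ^ d"
      using pV'(12,13) powD'[OF z] by (auto simp: D_def)
    have "\<psi> (f (inv_into U \<phi> (\<kappa> z))) = \<psi> (inv_into V' \<psi>' (z ^ d))"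
      using f(2)[OF u] eq \<kappa>pow[OF z] by (simp add: \<theta>_def)
    then have "f (inv_into U \<phi> (\<kappa> z)) = inv_into V' \<psi>' (z ^ d)"
      using pV(7) f(1)[OF u] v V'(2) by (auto dest: inj_onD)
    then show "f (inv_into U \<phi> (\<kappa> z)) \<in> V'" "\<psi>' (f (inv_into U \<phi> (\<kappa> z))) = z ^ d"
      using v by auto
  qed
  define W where "W = {u \<in> U. f u \<in> V'}"
  have \<kappa>im: "\<kappa> ` D = \<phi> ` W"
  proof
    show "\<kappa> ` D \<subseteq> \<phi> ` W"
    proof clarify
      fix z assume "z \<in> D"
      then show "\<kappa> z \<in> \<phi> ` W"
        using \<kappa>U[of z] unfolding W_def by (metis (mono_tags, lifting) image_eqI mem_Collect_eq)
    qed
    show "\<phi> ` W \<subseteq> \<kappa> ` D"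
    proof clarify
      fix u assume u: "u \<in> W"
      then have uU: "u \<in> U" "f u \<in> V'" by (auto simp: W_def)
      define v where "v = \<psi>' (f u)"
      obtain z where z: "z ^ d = v"
        using d exists_complex_root[of d v] by auto
      have v1: "cmod v < 1" using pV'(9) uU by (simp add: v_def)
      then have "cmod z ^ d < 1 ^ d" using z by (simp flip: norm_power)
      then have "cmod z < 1" by (rule power_less_imp_less_base) simp
      then have zD: "z \<in> D" by (simp add: D_def)
      have pw: "\<kappa> z ^ d = \<phi> u ^ d"
        using \<kappa>pow[OF zD] z f(2)[OF uU(1)] pV'(11)[OF uU(2)] by (simp add: \<theta>_def v_def)
      show "\<phi> u \<in> \<kappa> ` D"
      proof (cases "\<kappa> z = 0")
        case True
        then have "\<phi> u = 0" using pw d by (simp add: power_0_left)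
        then show ?thesis using True zD by (metis imageI)
      next
        case False
        \<comment> \<open>The root \<open>z\<close> of \<open>v\<close> was arbitrary, so
          \<open>\<kappa> z\<close> agrees with \<open>\<phi> u\<close> only up to a
          \<open>d\<close>-th root of unity \<open>w\<close>. As \<open>\<kappa>\<close> commutes
          with such rotations, \<open>w * z\<close> is the right root.\<close>
        define w where "w = \<phi> u / \<kappa> z"
        have w: "w ^ d = 1" using False by (simp add: w_def power_divide flip: pw)
        then have "cmod w ^ d = 1" by (metis norm_one norm_power)
        then have "cmod w = 1" using power_eq_imp_eq_base[of "cmod w" d 1] d by simp
        then have "w * z \<in> D" using zD by (simp add: D_def norm_mult)
        moreover have "\<kappa> (w * z) = \<phi> u" using \<kappa>rot[OF w] False by (simp add: w_def)
        ultimately show ?thesis by (metis imageI)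
      qed
    qed
  qed
  define \<phi>' where "\<phi>' u = inv_into D \<kappa> (\<phi> u)" for u
  have \<phi>'D: "\<phi>' u \<in> D" "\<kappa> (\<phi>' u) = \<phi> u" if "u \<in> W" for u
    using \<kappa>im that by (auto simp: \<phi>'_def inv_into_into f_inv_into_f)
  have \<phi>'pow: "\<psi>' (f u) = \<phi>' u ^ d" if "u \<in> W" for u
    using \<kappa>U(3)[OF \<phi>'D(1)[OF that]] \<phi>'D(2)[OF that] U'(11) that by (simp add: W_def)
  have WU: "W \<subseteq> U" by (auto simp: W_def)
  have open_iff: "openin (surface_top R) A \<longleftrightarrow> open (\<phi>' ` A)" if A: "A \<subseteq> W" for A
  proof -
    have sub: "\<phi>' ` A \<subseteq> D" using \<phi>'D A by blast
    have eq: "\<phi> ` A = \<kappa> ` \<phi>' ` A"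
      using \<phi>'D(2) A by (force simp: image_image)
    have "open (\<phi> ` A) \<longleftrightarrow> open (\<phi>' ` A)"
    proof
      assume "open (\<phi> ` A)"
      then have "open (\<kappa> -` (\<phi> ` A) \<inter> D)"
        using cont\<kappa> oD continuous_on_open_vimage by blast
      moreover have "\<kappa> -` (\<phi> ` A) \<inter> D = \<phi>' ` A"
        unfolding eq using sub inj\<kappa> by (auto dest: inj_onD)
      ultimately show "open (\<phi>' ` A)" by simp
    next
      assume "open (\<phi>' ` A)"
      then show "open (\<phi> ` A)"
        unfolding eq using sub cont\<kappa> inj\<kappa>
        by (intro invariance_of_domain) (auto intro: continuous_on_subset inj_on_subset)
    qed
    moreover have "A \<subseteq> U" using A WU by blast
    ultimately show ?thesis using plane_chartD(5)[OF U'(1)] by simp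
  qed
  have \<phi>'im: "\<phi>' ` W = D"
  proof
    show "D \<subseteq> \<phi>' ` W"
    proof
      fix z assume z: "z \<in> D"
      then have "inv_into U \<phi> (\<kappa> z) \<in> W" "\<phi>' (inv_into U \<phi> (\<kappa> z)) = z"
        using \<kappa>U[OF z] inj\<kappa> by (auto simp: W_def \<phi>'_def)
      then show "z \<in> \<phi>' ` W" by (metis imageI)
    qed
  qed (use \<phi>'D in auto)
  have "inj_on \<phi>' W"
    using \<phi>'D(2) U'(7) WU by (metis (no_types, lifting) inj_on_def subsetD)
  then have pc: "plane_chart (surface_top R) W \<phi>'"
    unfolding plane_chart_iff using open_iff \<phi>'im oD by blast
  have "positive_chart R W \<phi>'"
  proof (rule positive_chartI[OF R pc])
    fix u assume u: "u \<in> W"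
    then have uU: "u \<in> U" "f u \<in> V'" by (auto simp: W_def)
    \<comment> \<open>The degree of \<open>\<psi>' \<circ> f\<close> at \<open>u\<close> is computed
      twice: it is \<open>n\<close> through the old charts and \<open>k * m\<close> through the new
      ones. Since \<open>m\<close> and \<open>n\<close> are positive, so is
      \<open>k\<close>.\<close>
    obtain k where k: "has_cdeg R \<phi>' u k"
      using plane_chart_has_cdeg[OF R pc u] by blast
    obtain m where m: "m > 0" "has_ldeg (\<lambda>z. z ^ d) (\<phi>' u) m"
      using has_ldeg_power[OF d] by blast
    obtain n where n: "n > 0" "has_ldeg (\<lambda>z. z ^ d) (\<phi> u) n"
      using has_ldeg_power[OF d] by blast
    have 1: "has_cdeg R ((\<lambda>z. z ^ d) \<circ> \<phi>) u (1 * n)"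
      by (rule has_cdeg_comp[OF R positive_chart_has_cdeg[OF R U'(2) uU(1)] n(2)])
    have 2: "has_ldeg (\<psi>' \<circ> inv_into V \<psi>) (\<psi> (f u)) 1"
      by (rule positive_charts_transition[OF C pV(2) pV'(2)]) (use uU V' in auto)
    have "has_cdeg R ((\<psi>' \<circ> inv_into V \<psi>) \<circ> ((\<lambda>z. z ^ d) \<circ> \<phi>)) u (1 * n * 1)"
      by (rule has_cdeg_comp[OF R 1]) (use 2 f(2)[OF uU(1)] in simp)
    then have "has_cdeg R ((\<lambda>z. z ^ d) \<circ> \<phi>') u (1 * n * 1)"
    proof (rule has_cdeg_cong[OF R])
      show "openin (surface_top R) W" using plane_chartD(1)[OF pc] .
      fix v assume v: "v \<in> W"
      then have "v \<in> U" "f v \<in> V" using V' by (auto simp: W_def)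
      then show "((\<psi>' \<circ> inv_into V \<psi>) \<circ> ((\<lambda>z. z ^ d) \<circ> \<phi>)) v = ((\<lambda>z. z ^ d) \<circ> \<phi>') v"
        using f(2)[of v, symmetric] \<phi>'pow[OF v] pV(11) by simp
    qed (use u in auto)
    moreover have "has_cdeg R ((\<lambda>z. z ^ d) \<circ> \<phi>') u (k * m)"
      by (rule has_cdeg_comp[OF R k m(2)])
    ultimately have "k * m = n" using has_cdeg_unique[OF R] by fastforce
    then have "k > 0" using m n by (metis zero_less_mult_pos2)
    then show "\<exists>k>0. has_cdeg R \<phi>' u k" using k by blast
  qed
  moreover have "x \<in> W"
    using U'(3) f(1)[OF U'(3)] f(2)[OF U'(3)] U'(5) d pV(10) pV'(3) by (auto simp: W_def power_0_left)
  moreover have "\<phi>' x = 0"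
    using U'(5) inj\<kappa> inv_into_f_f[OF inj\<kappa>, of 0] by (simp add: \<phi>'_def D_def \<kappa>_def)
  ultimately have "disc_chart R x W \<phi>'"
    using \<phi>'im by (auto simp: disc_chart_def D_def)
  then show ?thesis using \<phi>'pow unfolding W_def by blast
qed

lemma power_map_at_iff:
  "power_map_at R C f x U V d \<longleftrightarrow> d \<ge> 1 \<and> (\<exists>\<phi> \<psi>. disc_chart R x U \<phi> \<and> disc_chart C (f x) V \<psi> \<and>
     (\<forall>u\<in>U. f u \<in> V \<and> \<psi> (f u) = \<phi> u ^ d))" (is "?L \<longleftrightarrow> ?R")
proof
  assume ?L
  then obtain \<phi> \<psi> where *: "d \<ge> 1" "x \<in> U" "f ` U \<subseteq> V" "positive_chart R U \<phi>" "\<phi> ` U = ball 0 1" "\<phi> x = 0"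
    "positive_chart C V \<psi>" "\<psi> ` V = ball 0 1" "\<psi> (f x) = 0"
    "\<forall>z \<in> ball 0 1. \<psi> (f (inv_into U \<phi> z)) = z ^ d"
    unfolding power_map_at_def by blast
  have U: "disc_chart R x U \<phi>" using * by (simp add: disc_chart_def)
  have "\<psi> (f u) = \<phi> u ^ d" if "u \<in> U" for u
    using *(10) disc_chartD(9,11)[OF U that] by force
  then show ?R using * U unfolding disc_chart_def by (intro conjI exI[of _ \<phi>] exI[of _ \<psi>]) auto
next
  assume ?R
  then obtain \<phi> \<psi> where *: "d \<ge> 1" "disc_chart R x U \<phi>" "disc_chart C (f x) V \<psi>"
    "\<forall>u\<in>U. f u \<in> V \<and> \<psi> (f u) = \<phi> u ^ d"
    by blast
  then show ?L unfolding power_map_at_def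
    using disc_chartD[OF *(2)] disc_chartD[OF *(3)]
    by (intro conjI exI[of _ \<phi>] exI[of _ \<psi>]) auto
qed

definition fibre :: "'a oriented_space \<Rightarrow> ('a \<Rightarrow> 'b) \<Rightarrow> 'b \<Rightarrow> 'a set" where
  "fibre R f y = {x \<in> pts R. f x = y}"

text \<open>
  The sheets \<open>U t\<close> and their charts \<open>\<phi> t\<close> are indexed by the points \<open>t\<close> of the fibre, and all of them
  refer to the same chart \<open>\<psi>\<close> of the target. Values at other indices are irrelevant.
\<close>

definition cover_over where
  "cover_over R f y V \<psi> U \<phi> d \<longleftrightarrow>
     (\<forall>t\<in>fibre R f y. disc_chart R t (U t) (\<phi> t) \<and> d t \<ge> (1::nat) \<and>
        (\<forall>u\<in>U t. f u \<in> V \<and> \<psi> (f u) = \<phi> t u ^ d t)) \<and>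
     disjoint_family_on U (fibre R f y) \<and>
     {x \<in> pts R. f x \<in> V} = (\<Union>t\<in>fibre R f y. U t)"

lemma cover_overD:
  assumes "cover_over R f y V \<psi> U \<phi> d"
  shows "\<And>t. t \<in> fibre R f y \<Longrightarrow> disc_chart R t (U t) (\<phi> t)"
    "\<And>t. t \<in> fibre R f y \<Longrightarrow> d t \<ge> 1"
    "\<And>t u. t \<in> fibre R f y \<Longrightarrow> u \<in> U t \<Longrightarrow> f u \<in> V"
    "\<And>t u. t \<in> fibre R f y \<Longrightarrow> u \<in> U t \<Longrightarrow> \<psi> (f u) = \<phi> t u ^ d t"
    "\<And>s t u. s \<in> fibre R f y \<Longrightarrow> t \<in> fibre R f y \<Longrightarrow> u \<in> U s \<Longrightarrow> u \<in> U t \<Longrightarrow> s = t"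
    "\<And>u. u \<in> pts R \<Longrightarrow> f u \<in> V \<Longrightarrow> \<exists>t\<in>fibre R f y. u \<in> U t"
  using assms unfolding cover_over_def disjoint_family_on_def by blast+

lemma cover_over_cong:
  assumes "cover_over R f y V \<psi> U \<phi> d"
    "\<And>t. t \<in> fibre R f y \<Longrightarrow> U t = U' t \<and> \<phi> t = \<phi>' t \<and> d t = d' t"
  shows "cover_over R f y V \<psi> U' \<phi>' d'"
  using assms unfolding cover_over_def disjoint_family_on_def by simp

text \<open>The definition of a branched covering allows each sheet its own chart of the common
  neighbourhood. Lifting a prescribed disc chart through every sheet replaces all of them by one.
  Leaving this chart free within \<open>N\<close> lets two maps into the same surface share
  it.\<close>

lemma branched_cover_over:
  assumes R: "surface R" and C: "surface C" and f: "branched_covering_map R C f"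
    and y: "y \<in> pts C"
  shows "\<exists>N. openin (surface_top C) N \<and> y \<in> N \<and>
    (\<forall>V \<psi>. disc_chart C y V \<psi> \<and> V \<subseteq> N \<longrightarrow> (\<exists>U \<phi> d. cover_over R f y V \<psi> U \<phi> d))"
proof -
  obtain N \<U> where N: "openin (surface_top C) N" "y \<in> N" and
    dis: "disjoint \<U>" and cov: "{x \<in> pts R. f x \<in> N} = \<Union>\<U>"
    and pow: "\<And>U. U \<in> \<U> \<Longrightarrow> \<exists>x d. {u \<in> U. f u = y} = {x} \<and> power_map_at R C f x U N d"
    using f y unfolding branched_covering_map_def by meson
  have "\<forall>t\<in>fibre R f y. \<exists>W d. W \<in> \<U> \<and> {u \<in> W. f u = y} = {t} \<and> power_map_at R C f t W N d"
  proof
    fix t assume t: "t \<in> fibre R f y"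
    have "t \<in> \<Union>\<U>" using t N unfolding cov[symmetric] by (auto simp: fibre_def)
    then obtain W where W: "W \<in> \<U>" "t \<in> W" by blast
    obtain x d where x: "{u \<in> W. f u = y} = {x}" "power_map_at R C f x W N d"
      using pow[OF W(1)] by blast
    have "t \<in> {u \<in> W. f u = y}" using W t by (simp add: fibre_def)
    then have "x = t" using x(1) by auto
    then show "\<exists>W d. W \<in> \<U> \<and> {u \<in> W. f u = y} = {t} \<and> power_map_at R C f t W N d"
      using W x by blast
  qed
  from bchoice[OF this] obtain W where
    "\<forall>t\<in>fibre R f y. \<exists>d. W t \<in> \<U> \<and> {u \<in> W t. f u = y} = {t} \<and> power_map_at R C f t (W t) N d"
    by blast
  from bchoice[OF this] obtain d where "\<forall>t\<in>fibre R f y.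
      W t \<in> \<U> \<and> {u \<in> W t. f u = y} = {t} \<and> power_map_at R C f t (W t) N (d t)"
    by blast
  then have W: "\<And>t. t \<in> fibre R f y \<Longrightarrow> W t \<in> \<U>"
    "\<And>t. t \<in> fibre R f y \<Longrightarrow> {u \<in> W t. f u = y} = {t}"
    "\<And>t. t \<in> fibre R f y \<Longrightarrow> power_map_at R C f t (W t) N (d t)"
    by simp_all
  show ?thesis
  proof (intro exI[of _ N] conjI N allI impI)
    fix V \<psi> assume "disc_chart C y V \<psi> \<and> V \<subseteq> N"
    then have V: "disc_chart C y V \<psi>" "V \<subseteq> N" by auto
    have "\<forall>t\<in>fibre R f y. \<exists>\<phi>. disc_chart R t {u \<in> W t. f u \<in> V} \<phi> \<and>
        (\<forall>u\<in>{u \<in> W t. f u \<in> V}. \<psi> (f u) = \<phi> u ^ d t)"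
    proof
      fix t assume t: "t \<in> fibre R f y"
      obtain \<alpha> \<beta> where *: "disc_chart R t (W t) \<alpha>" "disc_chart C (f t) N \<beta>" "d t \<ge> 1"
        "\<And>u. u \<in> W t \<Longrightarrow> f u \<in> N" "\<And>u. u \<in> W t \<Longrightarrow> \<beta> (f u) = \<alpha> u ^ d t"
        using W(3)[OF t] unfolding power_map_at_iff by blast
      have "f t = y" using t by (simp add: fibre_def)
      then show "\<exists>\<phi>. disc_chart R t {u \<in> W t. f u \<in> V} \<phi> \<and>
          (\<forall>u\<in>{u \<in> W t. f u \<in> V}. \<psi> (f u) = \<phi> u ^ d t)"
        using power_chart_lift[OF R C *(1) _ *(3,4,5) V] *(2) by simp
    qed
    from bchoice[OF this] obtain \<phi> where \<phi>: "\<forall>t\<in>fibre R f y. disc_chart R t {u \<in> W t. f u \<in> V} (\<phi> t) \<and>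
        (\<forall>u\<in>{u \<in> W t. f u \<in> V}. \<psi> (f u) = \<phi> t u ^ d t)"
      by blast
    have "cover_over R f y V \<psi> (\<lambda>t. {u \<in> W t. f u \<in> V}) \<phi> d"
      unfolding cover_over_def
    proof (intro conjI ballI)
      show "d t \<ge> 1" if "t \<in> fibre R f y" for t
        using W(3)[OF that] by (simp add: power_map_at_iff)
      show "disjoint_family_on (\<lambda>t. {u \<in> W t. f u \<in> V}) (fibre R f y)"
        unfolding disjoint_family_on_def
      proof (intro ballI impI)
        fix s t assume st: "s \<in> fibre R f y" "t \<in> fibre R f y" "s \<noteq> t"
        then have "W s \<noteq> W t" using W(2) by (metis singleton_inject)
        then have "W s \<inter> W t = {}" using dis W(1) st by (simp add: disjoint_def)
        then show "{u \<in> W s. f u \<in> V} \<inter> {u \<in> W t. f u \<in> V} = {}" by blast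
      qed
      show "{x \<in> pts R. f x \<in> V} = (\<Union>t\<in>fibre R f y. {u \<in> W t. f u \<in> V})"
      proof (intro equalityI subsetI)
        fix u assume u: "u \<in> {x \<in> pts R. f x \<in> V}"
        then have "u \<in> \<Union>\<U>" using V(2) unfolding cov[symmetric] by auto
        then obtain A where A: "A \<in> \<U>" "u \<in> A" by blast
        obtain x e where x: "{u \<in> A. f u = y} = {x}" "power_map_at R C f x A N e"
          using pow[OF A(1)] by blast
        have "x \<in> A" "f x = y" using x(1) by auto
        moreover have "A \<subseteq> pts R" using A(1) cov by blast
        ultimately have xf: "x \<in> fibre R f y" by (auto simp: fibre_def)
        then have "W x = A"
          using dis W(1,2)[OF xf] A(1) \<open>x \<in> A\<close> unfolding disjoint_def by blast
        then show "u \<in> (\<Union>t\<in>fibre R f y. {u \<in> W t. f u \<in> V})" using xf A u by blast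
      next
        fix u assume "u \<in> (\<Union>t\<in>fibre R f y. {u \<in> W t. f u \<in> V})"
        then obtain t where "t \<in> fibre R f y" "u \<in> W t" "f u \<in> V" by blast
        then show "u \<in> {x \<in> pts R. f x \<in> V}" using W(1) cov by blast
      qed
    qed (use \<phi> in auto)
    then show "\<exists>U \<phi> d. cover_over R f y V \<psi> U \<phi> d" by blast
  qed
qed

lemma fibre_self: "t \<in> pts R \<Longrightarrow> t \<in> fibre R f (f t)"
  by (simp add: fibre_def)

lemma branched_covering_mapI_power_map:
  assumes f: "continuous_map (surface_top R) (surface_top C) f"
    and y: "\<And>y. y \<in> pts C \<Longrightarrow> fibre R f y \<noteq> {} \<and>
      (\<exists>V U. openin (surface_top C) V \<and> y \<in> V \<and> disjoint_family_on U (fibre R f y) \<and>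
        {x \<in> pts R. f x \<in> V} = (\<Union>t\<in>fibre R f y. U t) \<and>
        (\<forall>t\<in>fibre R f y. \<exists>d. power_map_at R C f t (U t) V d))"
  shows "branched_covering_map R C f"
  unfolding branched_covering_map_def
proof (intro conjI f ballI)
  fix y assume yC: "y \<in> pts C"
  have ne: "fibre R f y \<noteq> {}" using y[OF yC] by (rule conjunct1)
  obtain V U where "openin (surface_top C) V \<and> y \<in> V \<and> disjoint_family_on U (fibre R f y) \<and>
        {x \<in> pts R. f x \<in> V} = (\<Union>t\<in>fibre R f y. U t) \<and>
        (\<forall>t\<in>fibre R f y. \<exists>d. power_map_at R C f t (U t) V d)"
    using conjunct2[OF y[OF yC]] by (elim exE) (rule that)
  then have V: "openin (surface_top C) V" "y \<in> V" and dis: "disjoint_family_on U (fibre R f y)"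
    and cov: "{x \<in> pts R. f x \<in> V} = (\<Union>t\<in>fibre R f y. U t)"
    and pow: "\<forall>t\<in>fibre R f y. \<exists>d. power_map_at R C f t (U t) V d"
    by simp_all
  have 1: "\<exists>d. openin (surface_top R) (U t) \<and> {u \<in> U t. f u = y} = {t} \<and> power_map_at R C f t (U t) V d"
    if t: "t \<in> fibre R f y" for t
  proof -
    obtain d where d: "power_map_at R C f t (U t) V d"
      using pow t by blast
    then have d1: "d \<ge> 1" and "\<exists>\<phi> \<psi>. disc_chart R t (U t) \<phi> \<and> disc_chart C (f t) V \<psi> \<and>
        (\<forall>u\<in>U t. f u \<in> V \<and> \<psi> (f u) = \<phi> u ^ d)"
      unfolding power_map_at_iff by simp_all
    then obtain \<phi> \<psi> where p: "disc_chart R t (U t) \<phi>" "disc_chart C (f t) V \<psi>"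
      "\<forall>u\<in>U t. f u \<in> V \<and> \<psi> (f u) = \<phi> u ^ d"
      by (elim exE conjE) (rule that)
    note dt = disc_chartD[OF p(1)] and dV = disc_chartD[OF p(2)]
    have ft: "f t = y" using t by (simp add: fibre_def)
    have "f u = y \<longleftrightarrow> u = t" if u: "u \<in> U t" for u
    proof -
      have "f u = y \<longleftrightarrow> \<psi> (f u) = 0" using bspec[OF p(3) u] dV(10)[of "f u"] ft by simp
      also have "\<dots> \<longleftrightarrow> \<phi> u = 0" using bspec[OF p(3) u] d1 by simp
      finally show ?thesis using dt(10)[OF u] by simp
    qed
    then have "{u \<in> U t. f u = y} = {t}" using dt(3) by auto
    then show ?thesis using d dt(6) by blast
  qed
  have "disjoint (U ` fibre R f y)"
  proof (rule disjointI)
    fix A B assume "A \<in> U ` fibre R f y" "B \<in> U ` fibre R f y" "A \<noteq> B"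
    then obtain s t where "s \<in> fibre R f y" "t \<in> fibre R f y" "A = U s" "B = U t" "s \<noteq> t" by blast
    then show "A \<inter> B = {}" using dis unfolding disjoint_family_on_def by simp
  qed
  moreover have "\<forall>A\<in>U ` fibre R f y. openin (surface_top R) A"
    using 1 by blast
  moreover have "\<forall>A\<in>U ` fibre R f y. \<exists>x d. {u \<in> A. f u = y} = {x} \<and> power_map_at R C f x A V d"
    using 1 by blast
  ultimately show "\<exists>V \<U>. openin (surface_top C) V \<and> y \<in> V \<and>
        \<U> \<noteq> {} \<and> disjoint \<U> \<and> (\<forall>U\<in>\<U>. openin (surface_top R) U) \<and>
        {x \<in> pts R. f x \<in> V} = \<Union>\<U> \<and>
        (\<forall>U\<in>\<U>. \<exists>x d. {u \<in> U. f u = y} = {x} \<and> power_map_at R C f x U V d)"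
    using V ne cov by (intro exI[of _ V] exI[of _ "U ` fibre R f y"]) simp
qed

lemma cover_over_power_map_at:
  assumes V: "disc_chart C y V \<psi>" and c: "cover_over R f y V \<psi> U \<phi> d" and t: "t \<in> fibre R f y"
  shows "power_map_at R C f t (U t) V (d t)"
proof -
  have "f t = y" using t by (simp add: fibre_def)
  then show ?thesis
    unfolding power_map_at_iff using cover_overD(1-4)[OF c t] V by blast
qed

lemma branched_covering_mapI:
  assumes f: "continuous_map (surface_top R) (surface_top C) f"
    and y: "\<And>y. y \<in> pts C \<Longrightarrow> fibre R f y \<noteq> {} \<and>
      (\<exists>V \<psi> U \<phi> d. disc_chart C y V \<psi> \<and> cover_over R f y V \<psi> U \<phi> d)"
  shows "branched_covering_map R C f"
proof (rule branched_covering_mapI_power_map[OF f])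
  fix y assume "y \<in> pts C"
  then obtain V \<psi> U \<phi> d where V: "disc_chart C y V \<psi>" and c: "cover_over R f y V \<psi> U \<phi> d"
    and ne: "fibre R f y \<noteq> {}"
    using y by blast
  have "openin (surface_top C) V \<and> y \<in> V \<and> disjoint_family_on U (fibre R f y) \<and>
      {x \<in> pts R. f x \<in> V} = (\<Union>t\<in>fibre R f y. U t) \<and>
      (\<forall>t\<in>fibre R f y. \<exists>d. power_map_at R C f t (U t) V d)"
    using disc_chartD(3,6)[OF V] c cover_over_power_map_at[OF V c] unfolding cover_over_def by blast
  then show "fibre R f y \<noteq> {} \<and> (\<exists>V U. openin (surface_top C) V \<and> y \<in> V \<and>
      disjoint_family_on U (fibre R f y) \<and>
      {x \<in> pts R. f x \<in> V} = (\<Union>t\<in>fibre R f y. U t) \<and>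
      (\<forall>t\<in>fibre R f y. \<exists>d. power_map_at R C f t (U t) V d))"
    using ne by blast
qed

section \<open>The local degree as an invariant of the map\<close>

text \<open>\<open>K\<close> consists of the points whose coordinates are the \<open>d\<close> roots
  of a small nonzero number. It makes the exponent visible in the fibres of \<open>f\<close>,
  independently of the charts.\<close>

lemma power_map_nearby_fibre:
  assumes U: "disc_chart R x U \<phi>" and \<psi>: "inj_on \<psi> V" and d: "d \<ge> 1"
    and f: "\<And>u. u \<in> U \<Longrightarrow> f u \<in> V \<and> \<psi> (f u) = \<phi> u ^ d"
    and N: "openin (surface_top R) N" "x \<in> N"
  obtains K where "K \<subseteq> N \<inter> U" "finite K" "card K = d" "x \<notin> K" "\<And>u v. u \<in> K \<Longrightarrow> v \<in> K \<Longrightarrow> f u = f v"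
proof -
  note dU = disc_chartD[OF U]
  have "openin (surface_top R) (N \<inter> U)" using N dU(6) by blast
  then have "open (\<phi> ` (N \<inter> U))" using plane_chartD(5)[OF dU(1), of "N \<inter> U"] by auto
  moreover have "0 \<in> \<phi> ` (N \<inter> U)" using N dU(3,5) by (intro image_eqI[of _ _ x]) auto
  ultimately obtain e where e: "e > 0" "ball 0 e \<subseteq> \<phi> ` (N \<inter> U)" using openE by blast
  \<comment> \<open>All \<open>d\<close>-th roots of this \<open>c\<close> have modulus
    \<open>e / 2\<close>, so they lie in the ball of radius \<open>e\<close>.\<close>
  define c where "c = (of_real (e / 2) :: complex) ^ d"
  define Z where "Z = {z. z ^ d = c}"
  have c: "c \<noteq> 0" using e by (simp add: c_def)
  have cZ: "card Z = d" unfolding Z_def using c d by (intro card_nth_roots) auto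
  then have fZ: "finite Z" using d card.infinite by fastforce
  have Z: "z \<in> \<phi> ` (N \<inter> U)" if "z \<in> Z" for z
  proof -
    have "cmod z ^ d = (e / 2) ^ d"
      using that e unfolding Z_def c_def by (metis (mono_tags) mem_Collect_eq norm_of_real norm_power abs_of_pos half_gt_zero)
    then have "cmod z = e / 2" using power_eq_imp_eq_base[of "cmod z" d "e / 2"] d e(1) by simp
    then show ?thesis using e by (intro subsetD[OF e(2)]) auto
  qed
  define K where "K = inv_into U \<phi> ` Z"
  have inv: "inv_into U \<phi> z \<in> N \<inter> U" "\<phi> (inv_into U \<phi> z) = z" if "z \<in> Z" for z
    using Z[OF that] dU(11) by auto
  have cK: "card K = d"
    unfolding K_def using cZ inv(2) by (subst card_image) (auto intro!: inj_onI, metis)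
  have "f u = f v" if "u \<in> K" "v \<in> K" for u v
  proof -
    have "\<psi> (f w) = c \<and> f w \<in> V" if "w \<in> K" for w
      using that inv f unfolding K_def Z_def by auto
    then show ?thesis using \<psi> that by (metis inj_onD)
  qed
  moreover have "x \<notin> K"
  proof
    assume "x \<in> K"
    then have "\<phi> x \<in> Z" using inv unfolding K_def by auto
    then show False using dU(5) c d by (simp add: Z_def power_0_left)
  qed
  moreover have "K \<subseteq> N \<inter> U" using inv(1) by (auto simp: K_def)
  moreover have "finite K" using fZ by (simp add: K_def)
  ultimately show thesis using that cK by blast
qed

text \<open>This gives \<open>THE\<close> in \<open>local_degree\<close> its meaning. Given normal
  forms with exponents \<open>d\<close> and \<open>e\<close>, the first provides \<open>d\<close>
  points of one fibre near \<open>x\<close>; in the second their coordinates are distinct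
  \<open>e\<close>-th roots of one nonzero number, so \<open>d \<le> e\<close>, and the roles can be
  exchanged.\<close>

lemma power_map_at_local_degree:
  assumes "power_map_at R C f x U V d"
  shows "local_degree R C f x = d"
proof -
  have le: "d \<le> e" if p: "power_map_at R C f x U V d" "power_map_at R C f x A B e" for U V d A B e
  proof -
    obtain \<phi> \<psi> where U: "d \<ge> 1" "disc_chart R x U \<phi>" "disc_chart C (f x) V \<psi>"
      "\<And>u. u \<in> U \<Longrightarrow> f u \<in> V \<and> \<psi> (f u) = \<phi> u ^ d"
      using p(1) unfolding power_map_at_iff by blast
    obtain \<alpha> \<beta> where A: "e \<ge> 1" "disc_chart R x A \<alpha>" "disc_chart C (f x) B \<beta>"
      "\<And>u. u \<in> A \<Longrightarrow> f u \<in> B \<and> \<beta> (f u) = \<alpha> u ^ e"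
      using p(2) unfolding power_map_at_iff by blast
    note dA = disc_chartD[OF A(2)]
    obtain K where K: "K \<subseteq> A \<inter> U" "finite K" "card K = d" "x \<notin> K" "\<And>u v. u \<in> K \<Longrightarrow> v \<in> K \<Longrightarrow> f u = f v"
      by (rule power_map_nearby_fibre[OF U(2) disc_chartD(7)[OF U(3)] U(1,4) dA(6,3)]) (blast+)
    obtain u where u: "u \<in> K" using K(3) U(1) by fastforce
    have "\<alpha> u \<noteq> 0" using dA(10) K(1,4) u by blast
    then have c: "\<alpha> u ^ e \<noteq> 0" by simp
    have card: "card {z. z ^ e = \<alpha> u ^ e} = e"
      using A(1) c by (intro card_nth_roots) auto
    have "\<alpha> ` K \<subseteq> {z. z ^ e = \<alpha> u ^ e}"
      using A(4) K(1,5) u by (auto, metis Int_iff subsetD)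
    moreover have "finite {z. z ^ e = \<alpha> u ^ e}" using card A(1) card.infinite by fastforce
    ultimately have "card (\<alpha> ` K) \<le> e" using card card_mono by metis
    moreover have "inj_on \<alpha> K" using dA(7) K(1) by (auto intro: inj_on_subset)
    ultimately show ?thesis using K(3) by (simp add: card_image)
  qed
  show ?thesis
    unfolding local_degree_def
  proof (rule the_equality)
    show "\<exists>U V. power_map_at R C f x U V d" using assms by blast
    fix e assume "\<exists>U V. power_map_at R C f x U V e"
    then show "e = d" using le assms by (metis le_antisym)
  qed
qed

lemma cover_over_local_degree:
  assumes "disc_chart C y V \<psi>" "cover_over R f y V \<psi> U \<phi> d" "t \<in> fibre R f y"
  shows "local_degree R C f t = d t"
  using power_map_at_local_degree[OF cover_over_power_map_at[OF assms]] .

section \<open>Compositions and covering degree\<close>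

text \<open>\<open>U\<close> corresponds to the unit disc, which is connected and so cannot be
  divided among disjoint open sets.\<close>

lemma disc_chart_subset_component:
  assumes U: "disc_chart X x U \<phi>" and W: "\<And>i. i \<in> I \<Longrightarrow> openin (surface_top X) (W i)"
    and dis: "disjoint_family_on W I" and sub: "U \<subseteq> (\<Union>i\<in>I. W i)" and i: "i \<in> I" "x \<in> W i"
  shows "U \<subseteq> W i"
proof -
  note dU = disc_chartD[OF U]
  define A where "A = U \<inter> W i"
  define B where "B = U \<inter> \<Union>(W ` (I - {i}))"
  have "openin (surface_top X) A" "openin (surface_top X) B"
    unfolding A_def B_def using W dU(6) i by (auto intro!: openin_Int openin_Union)
  then have o: "open (\<phi> ` A)" "open (\<phi> ` B)"
    using plane_chartD(5)[OF dU(1), of A] plane_chartD(5)[OF dU(1), of B] by (auto simp: A_def B_def)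
  have "W i \<inter> W j = {}" if "j \<in> I - {i}" for j
    using dis i that by (auto simp: disjoint_family_on_def)
  then have "A \<inter> B = {}" by (auto simp: A_def B_def)
  then have "\<phi> ` A \<inter> \<phi> ` B = {}"
    using dU(7) by (auto simp: A_def B_def inj_on_def)
  moreover have "A \<union> B = U" using sub i by (auto simp: A_def B_def)
  then have "\<phi> ` A \<union> \<phi> ` B = ball 0 1" using dU(4) by (metis image_Un)
  moreover have "A \<noteq> {}" using i dU(3) by (auto simp: A_def)
  ultimately have "\<phi> ` B = {}"
    using o connected_ball[of "0::complex" 1] unfolding connected_def
    by (metis (no_types, lifting) Int_commute Int_absorb1 image_is_empty inf_bot_right sup.cobounded1 sup.cobounded2 order_refl)
  then have "B = {}" by simp
  then show ?thesis using \<open>A \<union> B = U\<close> by (auto simp: A_def)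
qed

lemma fibre_comp:
  assumes "\<And>u. u \<in> pts R \<Longrightarrow> p u \<in> pts C"
    and "\<And>u. u \<in> pts R \<Longrightarrow> h u = f (p u)"
  shows "t \<in> fibre R h y \<longleftrightarrow> p t \<in> fibre C f y \<and> t \<in> fibre R p (p t)"
  using assms by (auto simp: fibre_def)

text \<open>The chart \<open>\<phi>1 x\<close> is at once the source chart of \<open>f\<close> and
  the target chart of \<open>p\<close>, so no coordinate change intervenes and the exponents
  multiply.\<close>

lemma cover_over_comp:
  assumes c1: "cover_over C f y V \<psi> U1 \<phi>1 m"
    and c2: "\<And>x. x \<in> fibre C f y \<Longrightarrow> cover_over R p x (U1 x) (\<phi>1 x) U \<phi> a"
    and p: "\<And>u. u \<in> pts R \<Longrightarrow> p u \<in> pts C"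
    and h: "\<And>u. u \<in> pts R \<Longrightarrow> h u = f (p u)"
  shows "cover_over R h y V \<psi> U \<phi> (\<lambda>t. m (p t) * a t)"
  unfolding cover_over_def
proof (intro conjI ballI)
  note fc = fibre_comp[of R p C h f _ y, OF p h]
  have t': "p t \<in> fibre C f y" "t \<in> fibre R p (p t)" if "t \<in> fibre R h y" for t
    using that fc by blast+
  fix t assume t: "t \<in> fibre R h y"
  note c = cover_overD[OF c2[OF t'(1)[OF t]]]
  show dt: "disc_chart R t (U t) (\<phi> t)" using c(1) t' t by blast
  show "m (p t) * a t \<ge> 1"
    using c(2)[OF t'(2)[OF t]] cover_overD(2)[OF c1 t'(1)[OF t]] by simp
  fix u assume u: "u \<in> U t"
  have uR: "u \<in> pts R" using disc_chartD(8)[OF dt] u by blast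
  have pu: "p u \<in> U1 (p t)" "\<phi>1 (p t) (p u) = \<phi> t u ^ a t"
    using c(3,4)[OF t'(2)[OF t] u] by auto
  then show "h u \<in> V" "\<psi> (h u) = \<phi> t u ^ (m (p t) * a t)"
    using cover_overD(3,4)[OF c1 t'(1)[OF t] pu(1)] h[OF uR] by (simp_all add: mult.commute power_mult)
next
  note fc = fibre_comp[of R p C h f _ y, OF p h]
  have t': "p t \<in> fibre C f y" "t \<in> fibre R p (p t)" if "t \<in> fibre R h y" for t
    using that fc by blast+
  show "disjoint_family_on U (fibre R h y)"
    unfolding disjoint_family_on_def
  proof (intro ballI impI, rule ccontr)
    fix s t assume st: "s \<in> fibre R h y" "t \<in> fibre R h y" "s \<noteq> t" "U s \<inter> U t \<noteq> {}"
    then obtain u where u: "u \<in> U s" "u \<in> U t" by blast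
    have "p u \<in> U1 (p s)" "p u \<in> U1 (p t)"
      using u cover_overD(3)[OF c2] t' st by blast+
    then have pst: "p s = p t" using cover_overD(5)[OF c1] t' st by blast
    then have "s \<in> fibre R p (p t)" using t'(2)[OF st(1)] by simp
    then show False using cover_overD(5)[OF c2[OF t'(1)[OF st(2)]] _ t'(2)[OF st(2)] u] st(3) by blast
  qed
  show "{x \<in> pts R. h x \<in> V} = (\<Union>t\<in>fibre R h y. U t)"
  proof (intro equalityI subsetI)
    fix u assume u: "u \<in> {x \<in> pts R. h x \<in> V}"
    then obtain x where x: "x \<in> fibre C f y" "p u \<in> U1 x"
      using cover_overD(6)[OF c1, of "p u"] p h by auto
    then obtain t where "t \<in> fibre R p x" "u \<in> U t"
      using cover_overD(6)[OF c2[OF x(1)]] u by auto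
    then show "u \<in> (\<Union>t\<in>fibre R h y. U t)" using fc x by (auto simp: fibre_def)
  next
    fix u assume "u \<in> (\<Union>t\<in>fibre R h y. U t)"
    then obtain t where t: "t \<in> fibre R h y" "u \<in> U t" by blast
    note c = cover_overD[OF c2[OF t'(1)[OF t(1)]]]
    have uR: "u \<in> pts R"
      using disc_chartD(8)[OF c(1)[OF t'(2)[OF t(1)]]] t(2) by blast
    have "f (p u) \<in> V"
      using cover_overD(3)[OF c1 t'(1)[OF t(1)] c(3)[OF t'(2)[OF t(1)] t(2)]] .
    then show "u \<in> {x \<in> pts R. h x \<in> V}" using uR h by simp
  qed
qed

lemma closed_surfaceD:
  assumes "closed_surface X"
  shows "surface X" "compact_space (surface_top X)" "Hausdorff_space (surface_top X)"
    "connected_space (surface_top X)" "pts X \<noteq> {}" "second_countable (surface_top X)"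
  using assms by (auto simp: closed_surface_def surface_def)

lemma branched_covering_mapD:
  assumes "branched_covering_map R C f"
  shows "continuous_map (surface_top R) (surface_top C) f"
    "u \<in> pts R \<Longrightarrow> f u \<in> pts C"
    "y \<in> pts C \<Longrightarrow> fibre R f y \<noteq> {}"
proof -
  show c: "continuous_map (surface_top R) (surface_top C) f"
    using assms by (simp add: branched_covering_map_def)
  then show "u \<in> pts R \<Longrightarrow> f u \<in> pts C"
    by (auto simp: continuous_map_def)
  show "y \<in> pts C \<Longrightarrow> fibre R f y \<noteq> {}"
    using branched_covering_map_surj[OF assms] by (auto simp: fibre_def)
qed

text \<open>
  Since \<open>f\<close> is closed, the sheets of \<open>f\<close> over a small neighbourhood of \<open>y\<close> lie in prescribed
  neighbourhoods of the points of the fibre, where \<open>p\<close> is in normal form.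
\<close>

lemma branched_tower:
  assumes R: "closed_surface R" and B: "closed_surface B" and C: "closed_surface C"
    and p: "branched_covering_map R B p" and f: "branched_covering_map B C f"
    and y: "y \<in> pts C"
  shows "\<exists>N. openin (surface_top C) N \<and> y \<in> N \<and>
    (\<forall>V \<psi>. disc_chart C y V \<psi> \<and> V \<subseteq> N \<longrightarrow> (\<exists>U1 \<phi>1 m U \<phi> a. cover_over B f y V \<psi> U1 \<phi>1 m \<and>
      (\<forall>x\<in>fibre B f y. cover_over R p x (U1 x) (\<phi>1 x) U \<phi> a)))"
proof -
  note sR = closed_surfaceD[OF R] and sB = closed_surfaceD[OF B] and sC = closed_surfaceD[OF C]
  obtain N0 where N0: "openin (surface_top C) N0" "y \<in> N0"
    "\<forall>V \<psi>. disc_chart C y V \<psi> \<and> V \<subseteq> N0 \<longrightarrow> (\<exists>U \<phi> d. cover_over B f y V \<psi> U \<phi> d)"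
    using branched_cover_over[OF sB(1) sC(1) f y] by blast
  obtain V0 \<psi>0 where V0: "disc_chart C y V0 \<psi>0" "V0 \<subseteq> N0"
    using disc_chart_exists[OF sC(1) N0(1,2)] by blast
  obtain U0 \<phi>0 d0 where c0: "cover_over B f y V0 \<psi>0 U0 \<phi>0 d0" using N0(3) V0 by blast
  have "\<forall>x\<in>fibre B f y. \<exists>N. openin (surface_top B) N \<and> x \<in> N \<and>
    (\<forall>V \<psi>. disc_chart B x V \<psi> \<and> V \<subseteq> N \<longrightarrow> (\<exists>U \<phi> d. cover_over R p x V \<psi> U \<phi> d))"
    using branched_cover_over[OF sR(1) sB(1) p] by (simp add: fibre_def)
  from bchoice[OF this] obtain M where M0: "\<forall>x\<in>fibre B f y. openin (surface_top B) (M x) \<and> x \<in> M x \<and>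
    (\<forall>V \<psi>. disc_chart B x V \<psi> \<and> V \<subseteq> M x \<longrightarrow> (\<exists>U \<phi> d. cover_over R p x V \<psi> U \<phi> d))"
    by blast
  then have M: "\<And>x. x \<in> fibre B f y \<Longrightarrow> openin (surface_top B) (M x) \<and> x \<in> M x"
    "\<And>x V \<psi>. x \<in> fibre B f y \<Longrightarrow> disc_chart B x V \<psi> \<Longrightarrow> V \<subseteq> M x \<Longrightarrow> \<exists>U \<phi> d. cover_over R p x V \<psi> U \<phi> d"
    by simp_all
  define W where "W x = U0 x \<inter> M x" for x
  have W: "openin (surface_top B) (W x)" "x \<in> W x" if "x \<in> fibre B f y" for x
    using M(1)[OF that] disc_chartD(3,6)[OF cover_overD(1)[OF c0 that]] by (auto simp: W_def)
  have disW: "disjoint_family_on W (fibre B f y)"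
    using c0 unfolding cover_over_def disjoint_family_on_def W_def by blast
  define K where "K = pts B - (\<Union>x\<in>fibre B f y. W x)"
  have "closedin (surface_top B) K"
    unfolding K_def using W by (intro closedin_diff openin_Union) auto
  moreover have "closed_map (surface_top B) (surface_top C) f"
    using continuous_imp_closed_map_gen[OF sB(2) Hausdorff_imp_kc_space[OF sC(3)]]
      branched_covering_mapD(1)[OF f] .
  ultimately have clK: "closedin (surface_top C) (f ` K)"
    by (simp add: closed_map_def)
  have yK: "y \<notin> f ` K"
    using W(2) by (auto simp: K_def fibre_def)
  define N where "N = N0 \<inter> (pts C - f ` K)"
  show ?thesis
  proof (intro exI[of _ N] conjI allI impI)
    show "openin (surface_top C) N" unfolding N_def using N0(1) clK by blast
    show "y \<in> N" using N0(2) yK y by (simp add: N_def)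
    fix V \<psi> assume "disc_chart C y V \<psi> \<and> V \<subseteq> N"
    then have V: "disc_chart C y V \<psi>" "V \<subseteq> N" by auto
    from V obtain U1 \<phi>1 m where c1: "cover_over B f y V \<psi> U1 \<phi>1 m"
      using N0(3) unfolding N_def by blast
    have "U1 x \<subseteq> M x" if x: "x \<in> fibre B f y" for x
    proof -
      have "U1 x \<subseteq> (\<Union>x\<in>fibre B f y. W x)"
      proof
        fix u assume u: "u \<in> U1 x"
        then have "f u \<notin> f ` K" using cover_overD(3)[OF c1 x u] V(2) by (auto simp: N_def)
        moreover have "u \<in> pts B"
          using disc_chartD(8)[OF cover_overD(1)[OF c1 x]] u by blast
        ultimately show "u \<in> (\<Union>x\<in>fibre B f y. W x)" unfolding K_def by blast
      qed
      then have "U1 x \<subseteq> W x"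
        using disc_chart_subset_component[OF cover_overD(1)[OF c1 x] W(1) disW _ x W(2)[OF x]] by blast
      then show ?thesis by (auto simp: W_def)
    qed
    then have "\<exists>U \<phi> d. cover_over R p x (U1 x) (\<phi>1 x) U \<phi> d" if "x \<in> fibre B f y" for x
      using M(2)[OF that cover_overD(1)[OF c1 that]] that by blast
    then obtain U \<phi> a where c2: "\<And>x. x \<in> fibre B f y \<Longrightarrow> cover_over R p x (U1 x) (\<phi>1 x) (U x) (\<phi> x) (a x)"
      by metis
    \<comment> \<open>The families obtained for the different \<open>x\<close> are merged into one:
      a point \<open>t\<close> belongs to the fibre over \<open>p t\<close> only.\<close>
    have "cover_over R p x (U1 x) (\<phi>1 x) (\<lambda>t. U (p t) t) (\<lambda>t. \<phi> (p t) t) (\<lambda>t. a (p t) t)"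
      if "x \<in> fibre B f y" for x
      by (rule cover_over_cong[OF c2[OF that]]) (auto simp: fibre_def)
    then show "\<exists>U1 \<phi>1 m U \<phi> a. cover_over B f y V \<psi> U1 \<phi>1 m \<and>
      (\<forall>x\<in>fibre B f y. cover_over R p x (U1 x) (\<phi>1 x) U \<phi> a)"
      using c1 by blast
  qed
qed

lemma branched_covering_map_comp:
  assumes R: "closed_surface R" and B: "closed_surface B" and C: "closed_surface C"
    and p: "branched_covering_map R B p" and f: "branched_covering_map B C f"
    and h: "\<And>u. u \<in> pts R \<Longrightarrow> h u = f (p u)"
  shows "branched_covering_map R C h"
    "t \<in> pts R \<Longrightarrow> local_degree R C h t = local_degree B C f (p t) * local_degree R B p t"
proof -
  have pB: "p u \<in> pts B" if "u \<in> pts R" for u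
    using branched_covering_mapD(2)[OF p that] .
  have tower: "\<exists>V \<psi> U1 \<phi>1 m U \<phi> a. disc_chart C y V \<psi> \<and> cover_over B f y V \<psi> U1 \<phi>1 m \<and>
      (\<forall>x\<in>fibre B f y. cover_over R p x (U1 x) (\<phi>1 x) U \<phi> a)" if y: "y \<in> pts C" for y
  proof -
    obtain N where N: "openin (surface_top C) N" "y \<in> N"
      "\<forall>V \<psi>. disc_chart C y V \<psi> \<and> V \<subseteq> N \<longrightarrow> (\<exists>U1 \<phi>1 m U \<phi> a. cover_over B f y V \<psi> U1 \<phi>1 m \<and>
        (\<forall>x\<in>fibre B f y. cover_over R p x (U1 x) (\<phi>1 x) U \<phi> a))"
      using branched_tower[OF R B C p f y] by blast
    obtain V \<psi> where "disc_chart C y V \<psi>" "V \<subseteq> N"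
      using disc_chart_exists[OF closed_surfaceD(1)[OF C] N(1,2)] by blast
    then show ?thesis using N(3) by blast
  qed
  show "branched_covering_map R C h"
  proof (rule branched_covering_mapI)
    have "continuous_map (surface_top R) (surface_top C) (f \<circ> p)"
      using branched_covering_mapD(1)[OF p] branched_covering_mapD(1)[OF f] continuous_map_compose by blast
    then show "continuous_map (surface_top R) (surface_top C) h"
      by (rule continuous_map_eq) (simp add: h)
    fix y assume y: "y \<in> pts C"
    obtain x where "x \<in> fibre B f y" using branched_covering_mapD(3)[OF f y] by blast
    moreover from this obtain t where "t \<in> fibre R p x"
      using branched_covering_mapD(3)[OF p, of x] by (auto simp: fibre_def)
    ultimately have "t \<in> fibre R h y" using h by (auto simp: fibre_def)
    then show "fibre R h y \<noteq> {} \<and> (\<exists>V \<psi> U \<phi> d. disc_chart C y V \<psi> \<and> cover_over R h y V \<psi> U \<phi> d)"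
      using tower[OF y] cover_over_comp[where h=h and p=p and f=f and C=B, OF _ _ pB h] by blast
  qed
  show "local_degree R C h t = local_degree B C f (p t) * local_degree R B p t"
    if t: "t \<in> pts R"
  proof -
    have "h t \<in> pts C"
      using branched_covering_mapD(2)[OF f] pB t h by simp
    then obtain V \<psi> U1 \<phi>1 m U \<phi> a where *: "disc_chart C (h t) V \<psi>" "cover_over B f (h t) V \<psi> U1 \<phi>1 m"
      "\<forall>x\<in>fibre B f (h t). cover_over R p x (U1 x) (\<phi>1 x) U \<phi> a"
      using tower by blast
    have th: "t \<in> fibre R h (h t)" using t by (simp add: fibre_def)
    then have pt: "p t \<in> fibre B f (h t)" "t \<in> fibre R p (p t)"
      using fibre_comp[of R p B h f, OF pB h] by blast+
    have "cover_over R h (h t) V \<psi> U \<phi> (\<lambda>t. m (p t) * a t)"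
      using cover_over_comp[where h=h and p=p and f=f and C=B, OF *(2) bspec[OF *(3)] pB h] by blast
    then have "local_degree R C h t = m (p t) * a t"
      using cover_over_local_degree[OF *(1) _ th] by blast
    moreover have "local_degree B C f (p t) = m (p t)"
      using cover_over_local_degree[OF *(1,2) pt(1)] .
    moreover have "local_degree R B p t = a t"
      using cover_over_local_degree[OF cover_overD(1)[OF *(2) pt(1)] bspec[OF *(3) pt(1)] pt(2)] .
    ultimately show ?thesis by simp
  qed
qed

lemma branched_local_cover:
  assumes R: "surface R" and C: "surface C" and f: "branched_covering_map R C f"
    and y: "y \<in> pts C"
  obtains V \<psi> U \<phi> d where "disc_chart C y V \<psi>" "cover_over R f y V \<psi> U \<phi> d"
    "\<And>t. t \<in> fibre R f y \<Longrightarrow> local_degree R C f t = d t"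
proof -
  obtain N where N: "openin (surface_top C) N" "y \<in> N"
    "\<forall>V \<psi>. disc_chart C y V \<psi> \<and> V \<subseteq> N \<longrightarrow> (\<exists>U \<phi> d. cover_over R f y V \<psi> U \<phi> d)"
    using branched_cover_over[OF R C f y] by blast
  obtain V \<psi> where V: "disc_chart C y V \<psi>" "V \<subseteq> N"
    using disc_chart_exists[OF C N(1,2)] by blast
  obtain U \<phi> d where c: "cover_over R f y V \<psi> U \<phi> d" using N(3) V by blast
  show thesis by (rule that[OF V(1) c cover_over_local_degree[OF V(1) c]])
qed

lemma local_degree_ge_1:
  assumes R: "surface R" and C: "surface C" and f: "branched_covering_map R C f"
    and u: "u \<in> pts R"
  shows "local_degree R C f u \<ge> 1"
proof -
  obtain V \<psi> U \<phi> d where "cover_over R f (f u) V \<psi> U \<phi> d" "local_degree R C f u = d u"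
    using branched_local_cover[OF R C f branched_covering_mapD(2)[OF f u]] fibre_self[OF u, of f] by metis
  then show ?thesis using cover_overD(2) fibre_self[OF u, of f] by metis
qed

text \<open>Local degree \<open>d\<close> produces \<open>d\<close> points of one fibre inside every
  neighbourhood, and injectivity leaves room for only one.\<close>

lemma local_degree_eq_1:
  assumes R: "surface R" and C: "surface C" and f: "branched_covering_map R C f"
    and N: "openin (surface_top R) N" "u \<in> N" "inj_on f N"
  shows "local_degree R C f u = 1"
proof -
  have u: "u \<in> pts R" using N openin_subset by blast
  obtain V \<psi> U \<phi> d where V: "disc_chart C (f u) V \<psi>" and c: "cover_over R f (f u) V \<psi> U \<phi> d"
    and ld: "local_degree R C f u = d u"
    using branched_local_cover[OF R C f branched_covering_mapD(2)[OF f u]] fibre_self[OF u, of f] by metis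
  note c' = cover_overD(1-4)[OF c fibre_self[OF u, of f]]
  obtain K where K: "K \<subseteq> N \<inter> U u" "finite K" "card K = d u" "\<And>v w. v \<in> K \<Longrightarrow> w \<in> K \<Longrightarrow> f v = f w"
    by (rule power_map_nearby_fibre[OF c'(1) disc_chartD(7)[OF V] c'(2) _ N(1,2)]) (use c'(3,4) in blast)+
  have "card K \<le> 1"
  proof (rule ccontr)
    assume "\<not> card K \<le> 1"
    then obtain v w where vw: "v \<in> K" "w \<in> K" "v \<noteq> w"
      using card_le_Suc0_iff_eq[OF K(2)] by auto
    then show False using K(1,4) N(3) by (metis Int_iff inj_onD subsetD)
  qed
  then show ?thesis using K(3) ld c'(2) by simp
qed

lemma power_locally_inj:
  assumes "z \<noteq> (0::complex)" "d \<ge> 1"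
  obtains r where "r > 0" "inj_on (\<lambda>w. w ^ d) (ball z r)"
proof (rule has_complex_derivative_locally_injective[of "\<lambda>w. w ^ d" UNIV z])
  show "(\<lambda>w. w ^ d) holomorphic_on UNIV" by (intro holomorphic_intros)
  have "((\<lambda>w. w ^ d) has_field_derivative of_nat d * z ^ (d - 1)) (at z)"
    by (auto intro!: derivative_eq_intros)
  then show "deriv (\<lambda>w. w ^ d) z \<noteq> 0" using assms by (simp add: DERIV_imp_deriv)
qed (use that in auto)

section \<open>Finite fibres and constancy of the covering degree\<close>

text \<open>The fibre is closed in a compact space, hence covered by finitely many sheets, and each
  sheet contains just one of its points.\<close>

lemma finite_fibre:
  assumes R: "closed_surface R" and C: "closed_surface C"
    and f: "branched_covering_map R C f" and y: "y \<in> pts C"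
  shows "finite (fibre R f y)"
proof -
  note sR = closed_surfaceD[OF R] and sC = closed_surfaceD[OF C]
  obtain V \<psi> U \<phi> d where c: "cover_over R f y V \<psi> U \<phi> d"
    using branched_local_cover[OF sR(1) sC(1) f y] by metis
  have "closedin (surface_top R) {x \<in> pts R. f x \<in> {y}}"
    by (rule closedin_continuous_map_preimage[OF branched_covering_mapD(1)[OF f]])
      (use closedin_Hausdorff_singleton[OF sC(3) y] in simp)
  then have "compactin (surface_top R) (fibre R f y)"
    using closedin_compact_space[OF sR(2)] by (simp add: fibre_def)
  moreover have "openin (surface_top R) A" if "A \<in> U ` fibre R f y" for A
    using that by (auto intro!: disc_chartD(6)[OF cover_overD(1)[OF c]])
  moreover have "fibre R f y \<subseteq> \<Union>(U ` fibre R f y)"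
    using disc_chartD(3)[OF cover_overD(1)[OF c]] by blast
  ultimately obtain \<F> where \<F>: "finite \<F>" "\<F> \<subseteq> U ` fibre R f y" "fibre R f y \<subseteq> \<Union>\<F>"
    using compactinD by meson
  then obtain T where T: "T \<subseteq> fibre R f y" "finite T" "\<F> = U ` T"
    by (meson finite_subset_image)
  have "fibre R f y \<subseteq> T"
  proof
    fix s assume s: "s \<in> fibre R f y"
    then obtain t where t: "t \<in> T" "s \<in> U t" using \<F>(3) T(3) by blast
    then have "s = t"
      using cover_overD(5)[OF c s _ disc_chartD(3)[OF cover_overD(1)[OF c s]]] T(1) by blast
    then show "s \<in> T" using t by simp
  qed
  then show ?thesis using T(2) finite_subset by blast
qed

text \<open>A sheet of exponent \<open>d\<close> contributes \<open>d\<close> to the sum over every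
  nearby point: as its centre, of local degree \<open>d\<close>, or as \<open>d\<close> points of
  local degree 1. So the sum is locally constant, hence constant on the connected \<open>C\<close>,
  which gives \<open>THE\<close> in \<open>covering_degree\<close> its meaning.\<close>

lemma covering_degree_eq:
  assumes R: "closed_surface R" and C: "closed_surface C"
    and f: "branched_covering_map R C f" and y: "y \<in> pts C"
  shows "covering_degree R C f = (\<Sum>x\<in>fibre R f y. local_degree R C f x)"
proof -
  note sR = closed_surfaceD[OF R] and sC = closed_surfaceD[OF C]
  define n where "n y = (\<Sum>x\<in>fibre R f y. local_degree R C f x)" for y
  have loc: "\<exists>V. openin (surface_top C) V \<and> y \<in> V \<and> (\<forall>y'\<in>V. n y' = n y)"
    if y: "y \<in> pts C" for y
  proof -
    obtain V \<psi> U \<phi> d where V: "disc_chart C y V \<psi>" and c: "cover_over R f y V \<psi> U \<phi> d"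
      and ld: "\<And>t. t \<in> fibre R f y \<Longrightarrow> local_degree R C f t = d t"
      using branched_local_cover[OF sR(1) sC(1) f y] by metis
    note c' = cover_overD[OF c] and dV = disc_chartD[OF V]
    have sum1: "(\<Sum>u\<in>{u \<in> U t. f u = y'}. local_degree R C f u) = d t"
      if t: "t \<in> fibre R f y" and y': "y' \<in> V" for t y'
    proof -
      note dt = disc_chartD[OF c'(1)[OF t]]
      have eq: "f u = y' \<longleftrightarrow> \<phi> t u ^ d t = \<psi> y'" if "u \<in> U t" for u
        using c'(3,4)[OF t that] y' dV(7) by (metis inj_onD)
      show ?thesis
      proof (cases "y' = y")
        case True
        have "{u \<in> U t. f u = y'} = {t}"
          using eq dt(3,5,10) True dV(5) c'(2)[OF t] by (auto simp: power_0_left)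
        then show ?thesis using ld[OF t] by simp
      next
        case False
        then have nz: "\<psi> y' \<noteq> 0" using dV(10)[OF y'] by simp
        \<comment> \<open>Away from the centre the power has nonzero derivative, so \<open>f\<close>
          is injective near \<open>u\<close>.\<close>
        have 1: "local_degree R C f u = 1" if u: "u \<in> {u \<in> U t. f u = y'}" for u
        proof -
          have uU: "u \<in> U t" "\<phi> t u \<noteq> 0" using u eq[of u] nz c'(2)[OF t] by (auto simp: power_0_left)
          obtain r where r: "r > 0" "inj_on (\<lambda>w. w ^ d t) (ball (\<phi> t u) r)"
            using power_locally_inj[OF uU(2) c'(2)[OF t]] by blast
          define M where "M = {v \<in> U t. \<phi> t v \<in> ball (\<phi> t u) r}"
          have "inj_on f M"
          proof (rule inj_onI)
            fix v w assume vw: "v \<in> M" "w \<in> M" "f v = f w"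
            then have "\<phi> t v ^ d t = \<phi> t w ^ d t" using c'(4)[OF t, of v] c'(4)[OF t, of w] by (simp add: M_def)
            then have "\<phi> t v = \<phi> t w" using r(2) vw by (auto simp: M_def dest: inj_onD)
            then show "v = w" using dt(7) vw by (auto simp: M_def dest: inj_onD)
          qed
          moreover have "openin (surface_top R) M"
            unfolding M_def by (rule plane_chart_preimage[OF dt(1)]) simp
          moreover have "u \<in> M" using uU r by (simp add: M_def)
          ultimately show ?thesis using local_degree_eq_1[OF sR(1) sC(1) f] by blast
        qed
        have "\<phi> t ` {u \<in> U t. f u = y'} = {z. z ^ d t = \<psi> y'}"
        proof
          show "\<phi> t ` {u \<in> U t. f u = y'} \<subseteq> {z. z ^ d t = \<psi> y'}" using eq by auto
          show "{z. z ^ d t = \<psi> y'} \<subseteq> \<phi> t ` {u \<in> U t. f u = y'}"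
          proof
            fix z assume "z \<in> {z. z ^ d t = \<psi> y'}"
            then have z: "z ^ d t = \<psi> y'" by simp
            have "cmod z ^ d t < 1 ^ d t" using dV(9)[OF y'] z by (simp flip: norm_power)
            then have "cmod z < 1" by (rule power_less_imp_less_base) simp
            then show "z \<in> \<phi> t ` {u \<in> U t. f u = y'}"
              using dt(12,13)[of z] eq z by (intro image_eqI[of _ _ "inv_into (U t) (\<phi> t) z"]) auto
          qed
        qed
        moreover have "inj_on (\<phi> t) {u \<in> U t. f u = y'}"
          using dt(7) by (rule inj_on_subset) auto
        ultimately have "card {u \<in> U t. f u = y'} = d t"
          using card_image[of "\<phi> t" "{u \<in> U t. f u = y'}"] card_nth_roots[OF nz, of "d t"] c'(2)[OF t]
          by simp
        then show ?thesis using 1 by simp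
      qed
    qed
    have fin: "finite (fibre R f y)" using finite_fibre[OF R C f y] .
    have "n y' = (\<Sum>t\<in>fibre R f y. d t)" if y': "y' \<in> V" for y'
    proof -
      have fin': "finite (fibre R f y')"
        using finite_fibre[OF R C f] dV(8) y' by blast
      have fib: "fibre R f y' = (\<Union>t\<in>fibre R f y. {u \<in> U t. f u = y'})"
        using c'(1,6) y' disc_chartD(8) by (fastforce simp: fibre_def)
      have "n y' = (\<Sum>t\<in>fibre R f y. \<Sum>u\<in>{u \<in> U t. f u = y'}. local_degree R C f u)"
        unfolding n_def fib
      proof (rule sum.UNION_disjoint[OF fin])
        show "\<forall>i\<in>fibre R f y. finite {u \<in> U i. f u = y'}"
          using fin' unfolding fib by (metis (no_types, lifting) UN_upper finite_subset)
      qed (use c'(5) in blast)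
      then show ?thesis using sum1 y' by simp
    qed
    then have "\<forall>y'\<in>V. n y' = n y" using dV(3) by simp
    then show ?thesis using dV(3,6) by blast
  qed
  have const: "n y' = n y" if y': "y' \<in> pts C" for y'
  proof -
    define A where "A = {z \<in> pts C. n z = n y}"
    have "openin (surface_top C) A"
      unfolding openin_subopen[of _ A]
    proof
      fix z assume z: "z \<in> A"
      then obtain V where V: "openin (surface_top C) V" "z \<in> V" "\<forall>y'\<in>V. n y' = n z"
        using loc[of z] by (auto simp: A_def)
      have "V \<subseteq> A" using openin_subset[OF V(1)] V(3) z by (auto simp: A_def)
      then show "\<exists>T. openin (surface_top C) T \<and> z \<in> T \<and> T \<subseteq> A"
        using V by blast
    qed
    moreover have "openin (surface_top C) (pts C - A)"
      unfolding openin_subopen[of _ "pts C - A"]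
    proof
      fix z assume z: "z \<in> pts C - A"
      then obtain V where V: "openin (surface_top C) V" "z \<in> V" "\<forall>y'\<in>V. n y' = n z"
        using loc[of z] by auto
      have "V \<subseteq> pts C - A" using openin_subset[OF V(1)] V(3) z by (auto simp: A_def)
      then show "\<exists>T. openin (surface_top C) T \<and> z \<in> T \<and> T \<subseteq> pts C - A"
        using V by blast
    qed
    then have "closedin (surface_top C) A" unfolding closedin_def by (auto simp: A_def)
    ultimately have "A = {} \<or> A = pts C"
      using sC(4) unfolding connected_space_clopen_in by blast
    moreover have "y \<in> A" using y by (simp add: A_def)
    ultimately show ?thesis using y' by (auto simp: A_def)
  qed
  have "covering_degree R C f = (THE k. \<forall>y \<in> pts C. n y = k)"
    unfolding covering_degree_def n_def fibre_def ..
  also have "\<dots> = n y"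
  proof (rule the_equality)
    show "\<forall>z\<in>pts C. n z = n y" using const by blast
    show "k = n y" if "\<forall>z\<in>pts C. n z = k" for k using bspec[OF that y] by simp
  qed
  finally show ?thesis by (simp add: n_def)
qed

section \<open>Germs of the pair of maps\<close>

text \<open>
  The quotient of the two charts takes values in the \<open>n\<close>-th roots of unity on a connected set.
\<close>

lemma disc_chart_same_power:
  assumes U: "disc_chart X x U \<phi>" and U': "disc_chart X x U \<phi>'" and n: "n \<ge> 1"
    and eq: "\<And>u. u \<in> U \<Longrightarrow> \<phi> u ^ n = \<phi>' u ^ n"
  obtains c where "cmod c = 1" "\<And>u. u \<in> U \<Longrightarrow> \<phi>' u = c * \<phi> u"
proof -
  note dU = disc_chartD[OF U] and dU' = disc_chartD[OF U']
  define r where "r z = \<phi>' (inv_into U \<phi> z) / z" for z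
  have D: "connected (ball (0::complex) 1 - {0})"
    by (rule connected_punctured_ball) simp
  have "continuous_on (\<phi> ` (U \<inter> U)) (\<phi>' \<circ> inv_into U \<phi>)"
    by (rule plane_chart_transition(2)[OF dU'(1) dU(1)])
  then have "continuous_on (ball 0 1) (\<lambda>z. \<phi>' (inv_into U \<phi> z))"
    using dU(4) by (simp add: comp_def)
  then have cont: "continuous_on (ball 0 1 - {0}) r"
    unfolding r_def by (intro continuous_intros) (auto intro: continuous_on_subset)
  have r1: "r z ^ n = 1" if "z \<in> ball 0 1 - {0}" for z
  proof -
    have "inv_into U \<phi> z \<in> U" "\<phi> (inv_into U \<phi> z) = z" using dU(12,13) that by auto
    then have "\<phi>' (inv_into U \<phi> z) ^ n = z ^ n" using eq by metis
    then show ?thesis using that by (simp add: r_def power_divide)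
  qed
  have "finite {z::complex. z ^ n = 1}" using n by (intro finite_roots_unity) auto
  then have "finite (r ` (ball 0 1 - {0}))"
    by (rule finite_subset[rotated]) (use r1 in blast)
  then have "r constant_on (ball 0 1 - {0})"
    by (rule continuous_finite_range_constant[OF D cont])
  then obtain c where c: "\<And>z. z \<in> ball 0 1 - {0} \<Longrightarrow> r z = c"
    unfolding constant_on_def by blast
  have "(1/2::complex) \<in> ball 0 1 - {0}" by simp
  then have "c ^ n = 1" using c r1 by metis
  then have "cmod c ^ n = 1" by (metis norm_one norm_power)
  then have c1: "cmod c = 1" using power_eq_imp_eq_base[of "cmod c" n 1] n by simp
  have "\<phi>' u = c * \<phi> u" if u: "u \<in> U" for u
  proof (cases "u = x")
    case True
    then show ?thesis using dU(5) dU'(5) by simp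
  next
    case False
    then have "\<phi> u \<in> ball 0 1 - {0}" using dU(9,10)[OF u] by simp
    from c[OF this] show ?thesis
      using dU(11)[OF u] \<open>\<phi> u \<in> ball 0 1 - {0}\<close> by (simp add: r_def field_simps)
  qed
  then show thesis using that c1 by blast
qed

lemma open_power_image:
  assumes "open S" "d \<ge> 1"
  shows "open ((\<lambda>z::complex. z ^ d) ` S)"
proof (rule open_mapping_thm[of "\<lambda>z. z ^ d" UNIV])
  show "\<not> (\<lambda>z::complex. z ^ d) constant_on UNIV"
  proof
    assume "(\<lambda>z::complex. z ^ d) constant_on UNIV"
    then have "(0::complex) ^ d = 1 ^ d" unfolding constant_on_def by (metis UNIV_I)
    then show False using assms(2) by (simp add: power_0_left)
  qed
qed (use assms in \<open>auto intro!: holomorphic_intros\<close>)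

lemma roots_of_unity_coprime:
  assumes "x ^ m = (1::complex)" "x ^ n = 1" "coprime m n" "m \<ge> 1"
  shows "x = 1"
proof -
  obtain i j where "m * i = n * j + 1"
    using bezout_nat[of m n] assms(3,4) by (auto simp: coprime_iff_gcd_eq_1)
  then have "(x ^ m) ^ i = (x ^ n) ^ j * x" by (simp flip: power_mult)
  then show ?thesis using assms(1,2) by simp
qed

text \<open>The two fractions \<open>a / b\<close> and \<open>a' / b'\<close> are equal, and a
  fraction has only one reduced form.\<close>

lemma div_gcd_unique:
  fixes a b a' b' :: nat
  assumes "a \<ge> 1" "b \<ge> 1" "a' \<ge> 1" "b' \<ge> 1" "a * b' = a' * b"
  shows "a div gcd a b = a' div gcd a' b'" "b div gcd a b = b' div gcd a' b'"
proof -
  define e where "e = gcd a b"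
  define e' where "e' = gcd a' b'"
  have e: "e > 0" "e' > 0" using assms by (auto simp: e_def e'_def)
  have dv: "a = a div e * e" "b = b div e * e" "a' = a' div e' * e'" "b' = b' div e' * e'"
    by (simp_all add: e_def e'_def)
  have "coprime (a div e) (b div e)" "coprime (a' div e') (b' div e')"
    using assms by (auto simp: e_def e'_def intro!: div_gcd_coprime)
  moreover have "(a div e) * (b' div e') * (e * e') = (a' div e') * (b div e) * (e * e')"
    using assms(5) dv by (metis mult.assoc mult.left_commute mult.commute)
  then have "(a div e) * (b' div e') = (a' div e') * (b div e)"
    using e by simp
  ultimately have "a div e = a' div e' \<and> b' div e' = b div e"
    using coprime_crossproduct_nat by blast
  then show "a div gcd a b = a' div gcd a' b'" "b div gcd a b = b' div gcd a' b'"
    by (simp_all add: e_def e'_def)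
qed

locale branched_square =
  fixes R :: "'r oriented_space" and C1 :: "'a oriented_space" and C2 :: "'b oriented_space"
    and C :: "'c oriented_space"
    and p :: "'r \<Rightarrow> 'a" and q :: "'r \<Rightarrow> 'b" and f :: "'a \<Rightarrow> 'c" and g :: "'b \<Rightarrow> 'c" and h :: "'r \<Rightarrow> 'c"
  assumes R: "closed_surface R" and C1: "closed_surface C1" and C2: "closed_surface C2"
    and C: "closed_surface C"
    and p: "branched_covering_map R C1 p" and q: "branched_covering_map R C2 q"
    and f: "branched_covering_map C1 C f" and g: "branched_covering_map C2 C g"
    and hp: "\<And>u. u \<in> pts R \<Longrightarrow> h u = f (p u)"
    and hq: "\<And>u. u \<in> pts R \<Longrightarrow> h u = g (q u)"
begin

lemmas sR = closed_surfaceD[OF R] and sC1 = closed_surfaceD[OF C1] and sC2 = closed_surfaceD[OF C2]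
  and sC = closed_surfaceD[OF C]

lemmas p_in = branched_covering_mapD(2)[OF p] and q_in = branched_covering_mapD(2)[OF q]

lemma h_branched: "branched_covering_map R C h"
  by (rule branched_covering_map_comp(1)[OF R C1 C p f]) (rule hp)

lemma h_local_degree:
  assumes t: "t \<in> pts R"
  shows "local_degree R C h t = local_degree C1 C f (p t) * local_degree R C1 p t"
    and "local_degree R C h t = local_degree C2 C g (q t) * local_degree R C2 q t"
proof -
  show "local_degree R C h t = local_degree C1 C f (p t) * local_degree R C1 p t"
    by (rule branched_covering_map_comp(2)[OF R C1 C p f _ t]) (rule hp)
  show "local_degree R C h t = local_degree C2 C g (q t) * local_degree R C2 q t"
    by (rule branched_covering_map_comp(2)[OF R C2 C q g _ t]) (rule hq)
qed

definition \<Gamma> :: "'r \<Rightarrow> 'a \<times> 'b" where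
  "\<Gamma> u = (p u, q u)"

text \<open>
  The filter generated by the images of the neighbourhoods of \<open>u\<close>, as a set of sets.
\<close>

definition germ :: "'r \<Rightarrow> ('a \<times> 'b) set set" where
  "germ u = {B. \<exists>N. openin (surface_top R) N \<and> u \<in> N \<and> \<Gamma> ` N \<subseteq> B}"

text \<open>If the values differed, a neighbourhood of \<open>u\<close> whose values under
  \<open>r\<close> avoid \<open>r v\<close> would give a member of \<open>germ u\<close> that does
  not contain \<open>\<Gamma> v\<close> and so is not in \<open>germ v\<close>. Writing
  \<open>r\<close> as a function of \<open>\<Gamma>\<close> lets one proof serve both
  \<open>p\<close> and \<open>q\<close>.\<close>

lemma germ_eq_imp:
  assumes u: "u \<in> pts R" "v \<in> pts R" and eq: "germ u = germ v"
    and r: "continuous_map (surface_top R) (surface_top X) r" and X: "Hausdorff_space (surface_top X)"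
    and rG: "\<And>u. r u = pr (\<Gamma> u)"
  shows "r u = r v"
proof (rule ccontr)
  assume ne: "r u \<noteq> r v"
  have "r u \<in> pts X" "r v \<in> pts X"
    using r u by (auto simp: continuous_map_def)
  then obtain A B where A: "openin (surface_top X) A" "r u \<in> A" "r v \<in> B" "disjnt A B"
    using X ne unfolding Hausdorff_space_def by meson
  define N where "N = {x \<in> pts R. r x \<in> A}"
  have "openin (surface_top R) N" unfolding N_def by (rule openin_continuous_map_preimage[OF r A(1)])
  moreover have "u \<in> N" using A(2) u by (simp add: N_def)
  ultimately have "\<Gamma> ` N \<in> germ u" unfolding germ_def by blast
  then have "\<Gamma> ` N \<in> germ v" using eq by simp
  then obtain M where M: "v \<in> M" "\<Gamma> ` M \<subseteq> \<Gamma> ` N" unfolding germ_def by blast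
  then obtain x where "x \<in> N" "\<Gamma> v = \<Gamma> x" by blast
  then have "r v \<in> A" using rG[of v] rG[of x] by (simp add: N_def)
  then show False using A(3,4) by (auto simp: disjnt_iff)
qed

lemma germ_eq_imp_pq:
  assumes "u \<in> pts R" "v \<in> pts R" "germ u = germ v"
  shows "p u = p v" "q u = q v"
  using germ_eq_imp[OF assms branched_covering_mapD(1)[OF p] sC1(3), of fst]
    germ_eq_imp[OF assms branched_covering_mapD(1)[OF q] sC2(3), of snd]
  by (simp_all add: \<Gamma>_def)

end

text \<open>
  Simultaneous normal forms of \<open>p\<close> and \<open>q\<close> over the chart \<open>V\<close>, in the same charts \<open>\<phi> t\<close> of \<open>R\<close>. The
  charts obtained from \<open>p\<close> and from \<open>q\<close> differ by a rotation, which accounts for the factors \<open>\<zeta> t\<close>.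
\<close>

locale local_square = branched_square +
  fixes y V \<psi> U1 \<phi>1 m1 U2 \<phi>2 m2 U \<phi> a b \<zeta>
  assumes y: "y \<in> pts C"
    and V: "disc_chart C y V \<psi>"
    and cf: "cover_over C1 f y V \<psi> U1 \<phi>1 m1" and cg: "cover_over C2 g y V \<psi> U2 \<phi>2 m2"
    and cp: "\<And>x. x \<in> fibre C1 f y \<Longrightarrow> cover_over R p x (U1 x) (\<phi>1 x) U \<phi> a"
    and b1: "\<And>t. t \<in> fibre R h y \<Longrightarrow> b t \<ge> 1"
    and \<zeta>1: "\<And>t. t \<in> fibre R h y \<Longrightarrow> cmod (\<zeta> t) = 1"
    and bq: "\<And>t. t \<in> fibre R h y \<Longrightarrow> m1 (p t) * a t = m2 (q t) * b t"
    and Uq: "\<And>t u. t \<in> fibre R h y \<Longrightarrow> u \<in> U t \<Longrightarrow> q u \<in> U2 (q t)"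
    and \<phi>2q: "\<And>t u. t \<in> fibre R h y \<Longrightarrow> u \<in> U t \<Longrightarrow> \<phi>2 (q t) (q u) = \<zeta> t * \<phi> t u ^ b t"
    and ldb: "\<And>t. t \<in> fibre R h y \<Longrightarrow> local_degree R C2 q t = b t"

context branched_square begin

text \<open>A disc chart small enough for both towers carries two covers by \<open>h\<close>. Their
  sheets agree because discs are connected, their exponents because both are the local degree of
  \<open>h\<close>. On the sheet at \<open>t\<close> the charts differ by a constant
  \<open>c t\<close>, and the normal form of \<open>q\<close> turns it into
  \<open>\<zeta> t = c t ^ b t\<close>.\<close>

lemma local_square_exists:
  assumes y: "y \<in> pts C"
  obtains V \<psi> U1 \<phi>1 m1 U2 \<phi>2 m2 U \<phi> a b \<zeta> where
    "local_square R C1 C2 C p q f g h y V \<psi> U1 \<phi>1 m1 U2 \<phi>2 m2 U \<phi> a b \<zeta>"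
proof -
  obtain N1 where N1: "openin (surface_top C) N1" "y \<in> N1"
    "\<forall>V \<psi>. disc_chart C y V \<psi> \<and> V \<subseteq> N1 \<longrightarrow> (\<exists>U1 \<phi>1 m U \<phi> a. cover_over C1 f y V \<psi> U1 \<phi>1 m \<and>
        (\<forall>x\<in>fibre C1 f y. cover_over R p x (U1 x) (\<phi>1 x) U \<phi> a))"
    using branched_tower[OF R C1 C p f y] by blast
  obtain N2 where N2: "openin (surface_top C) N2" "y \<in> N2"
    "\<forall>V \<psi>. disc_chart C y V \<psi> \<and> V \<subseteq> N2 \<longrightarrow> (\<exists>U1 \<phi>1 m U \<phi> a. cover_over C2 g y V \<psi> U1 \<phi>1 m \<and>
        (\<forall>x\<in>fibre C2 g y. cover_over R q x (U1 x) (\<phi>1 x) U \<phi> a))"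
    using branched_tower[OF R C2 C q g y] by blast
  have "openin (surface_top C) (N1 \<inter> N2)" "y \<in> N1 \<inter> N2" using N1 N2 by auto
  then obtain V \<psi> where V: "disc_chart C y V \<psi>" "V \<subseteq> N1 \<inter> N2"
    using disc_chart_exists[OF sC(1)] by blast
  obtain U1 \<phi>1 m1 U \<phi> a where 1: "cover_over C1 f y V \<psi> U1 \<phi>1 m1"
    "\<forall>x\<in>fibre C1 f y. cover_over R p x (U1 x) (\<phi>1 x) U \<phi> a"
    using N1(3) V by blast
  obtain U2 \<phi>2 m2 U' \<phi>' b where 2: "cover_over C2 g y V \<psi> U2 \<phi>2 m2"
    "\<forall>x\<in>fibre C2 g y. cover_over R q x (U2 x) (\<phi>2 x) U' \<phi>' b"
    using N2(3) V by blast
  have h1: "cover_over R h y V \<psi> U \<phi> (\<lambda>t. m1 (p t) * a t)"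
    by (rule cover_over_comp[of C1 f y V \<psi> U1 \<phi>1 m1 R p U \<phi> a h, OF 1(1) bspec[OF 1(2)] p_in hp])
  have h2: "cover_over R h y V \<psi> U' \<phi>' (\<lambda>t. m2 (q t) * b t)"
    by (rule cover_over_comp[of C2 g y V \<psi> U2 \<phi>2 m2 R q U' \<phi>' b h, OF 2(1) bspec[OF 2(2)] q_in hq])
  note c1 = cover_overD[OF h1] and c2 = cover_overD[OF h2]
  have U: "(\<Union>t\<in>fibre R h y. U t) = (\<Union>t\<in>fibre R h y. U' t)"
    using h1 h2 by (simp add: cover_over_def)
  have dis: "disjoint_family_on U (fibre R h y)" "disjoint_family_on U' (fibre R h y)"
    using h1 h2 by (simp_all add: cover_over_def)
  have UU: "U' t = U t" if t: "t \<in> fibre R h y" for t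
  proof
    show "U' t \<subseteq> U t"
      by (rule disc_chart_subset_component[OF c2(1)[OF t] disc_chartD(6)[OF c1(1)] dis(1) _ t disc_chartD(3)[OF c1(1)[OF t]]])
        (use U t in blast)+
    show "U t \<subseteq> U' t"
      by (rule disc_chart_subset_component[OF c1(1)[OF t] disc_chartD(6)[OF c2(1)] dis(2) _ t disc_chartD(3)[OF c2(1)[OF t]]])
        (use U t in blast)+
  qed
  have n: "m1 (p t) * a t = m2 (q t) * b t" if t: "t \<in> fibre R h y" for t
    using cover_over_local_degree[OF V(1) h1 t] cover_over_local_degree[OF V(1) h2 t] by simp
  have "\<exists>c. cmod c = 1 \<and> (\<forall>u\<in>U t. \<phi>' t u = c * \<phi> t u)" if t: "t \<in> fibre R h y" for t
  proof -
    have "disc_chart R t (U t) (\<phi>' t)" using c2(1)[OF t] UU[OF t] by simp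
    moreover have "\<phi> t u ^ (m1 (p t) * a t) = \<phi>' t u ^ (m1 (p t) * a t)" if "u \<in> U t" for u
      using c1(4)[OF t that] c2(4)[OF t, of u] that UU[OF t] n[OF t] by simp
    ultimately show ?thesis
      using disc_chart_same_power[OF c1(1)[OF t] _ c1(2)[OF t]] by metis
  qed
  then have "\<forall>t\<in>fibre R h y. \<exists>c. cmod c = 1 \<and> (\<forall>u\<in>U t. \<phi>' t u = c * \<phi> t u)" by blast
  from bchoice[OF this] obtain c where c: "\<forall>t\<in>fibre R h y. cmod (c t) = 1 \<and> (\<forall>u\<in>U t. \<phi>' t u = c t * \<phi> t u)"
    by blast
  have qf: "q t \<in> fibre C2 g y" "t \<in> fibre R q (q t)" if "t \<in> fibre R h y" for t
    using that q_in hq by (auto simp: fibre_def)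
  have "local_square R C1 C2 C p q f g h y V \<psi> U1 \<phi>1 m1 U2 \<phi>2 m2 U \<phi> a b (\<lambda>t. c t ^ b t)"
  proof unfold_locales
    fix t assume t: "t \<in> fibre R h y"
    note cq = cover_overD[OF bspec[OF 2(2) qf(1)[OF t]]]
    show "b t \<ge> 1" using cq(2)[OF qf(2)[OF t]] .
    show "cmod (c t ^ b t) = 1" using c t by (simp add: norm_power)
    show "m1 (p t) * a t = m2 (q t) * b t" using n[OF t] .
    show "local_degree R C2 q t = b t"
      by (rule cover_over_local_degree[OF cover_overD(1)[OF 2(1) qf(1)[OF t]] bspec[OF 2(2) qf(1)[OF t]] qf(2)[OF t]])
    fix u assume u: "u \<in> U t"
    then have u': "u \<in> U' t" using UU[OF t] by simp
    show "q u \<in> U2 (q t)" using cq(3)[OF qf(2)[OF t] u'] .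
    show "\<phi>2 (q t) (q u) = c t ^ b t * \<phi> t u ^ b t"
      using cq(4)[OF qf(2)[OF t] u'] c t u by (simp add: power_mult_distrib)
  qed (use y V(1) 1 2 in auto)
  then show thesis using that by blast
qed

end

section \<open>Equality of germs in the power coordinates\<close>

context local_square begin

abbreviation F where "F \<equiv> fibre R h y"

definition e where "e t = gcd (a t) (b t)"

text \<open>
  The rotation by \<open>\<eta>\<close> carries the expression of \<open>(p, q)\<close> in the coordinate \<open>\<phi> t ^ e t\<close> to its
  expression in the coordinate \<open>\<phi> t' ^ e t'\<close>.
\<close>

definition linked where
  "linked t t' \<eta> \<longleftrightarrow> p t = p t' \<and> q t = q t' \<and> cmod \<eta> = 1 \<and>
     \<eta> ^ (a t div e t) = 1 \<and> \<zeta> t = \<zeta> t' * \<eta> ^ (b t div e t)"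

lemma ch: "cover_over R h y V \<psi> U \<phi> (\<lambda>t. m1 (p t) * a t)"
  by (rule cover_over_comp[of C1 f y V \<psi> U1 \<phi>1 m1 R p U \<phi> a h, OF cf cp p_in hp])

lemmas c = cover_overD[OF ch]
lemmas dU = disc_chartD[OF c(1)]

lemma pF: "p t \<in> fibre C1 f y" "t \<in> fibre R p (p t)" if "t \<in> F"
  using that p_in hp by (auto simp: fibre_def)

lemma qF: "q t \<in> fibre C2 g y" if "t \<in> F"
  using that q_in hq by (auto simp: fibre_def)

lemma UR: "t \<in> F \<Longrightarrow> u \<in> U t \<Longrightarrow> u \<in> pts R"
  using dU(8) by blast

lemma Up: "t \<in> F \<Longrightarrow> u \<in> U t \<Longrightarrow> p u \<in> U1 (p t)"
  and \<phi>1p: "t \<in> F \<Longrightarrow> u \<in> U t \<Longrightarrow> \<phi>1 (p t) (p u) = \<phi> t u ^ a t"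
  using cover_overD(3,4)[OF cp[OF pF(1)] pF(2)] by blast+

lemma a1: "t \<in> F \<Longrightarrow> a t \<ge> 1"
  using cover_overD(2)[OF cp[OF pF(1)] pF(2)] by blast

lemma e1: "t \<in> F \<Longrightarrow> e t \<ge> 1"
  using a1[of t] by (simp add: e_def Suc_le_eq)

lemma ae: "a t div e t * e t = a t" and be: "b t div e t * e t = b t"
  by (simp_all add: e_def)

lemma ae1: "t \<in> F \<Longrightarrow> a t div e t \<ge> 1" and be1: "t \<in> F \<Longrightarrow> b t div e t \<ge> 1"
  using a1[of t] b1[of t] ae[of t] be[of t] by (metis One_nat_def Suc_leI bot_nat_0.not_eq_extremum less_one mult_0 not_le)+

lemma coprime_ab: "t \<in> F \<Longrightarrow> coprime (a t div e t) (b t div e t)"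
  using a1[of t] unfolding e_def by (intro div_gcd_coprime) auto

text \<open>By \<open>bq\<close> the ratio of \<open>a t\<close> to \<open>b t\<close> is that of
  \<open>m2 (q t)\<close> to \<open>m1 (p t)\<close>, which depends on \<open>p t\<close> and
  \<open>q t\<close> only; the reduced exponents are its lowest terms.\<close>

lemma exps_eq:
  assumes "t \<in> F" "t' \<in> F" "p t = p t'" "q t = q t'"
  shows "a t div e t = a t' div e t'" "b t div e t = b t' div e t'"
proof -
  have m: "m1 (p t') \<ge> 1" "m2 (q t') \<ge> 1"
    using cover_overD(2)[OF cf pF(1)] cover_overD(2)[OF cg qF] assms by blast+
  have "m1 (p t') * a t = m2 (q t') * b t" "m1 (p t') * a t' = m2 (q t') * b t'"
    using bq[OF assms(1)] bq[OF assms(2)] assms(3,4) by auto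
  then have "m1 (p t') * a t * (m2 (q t') * b t') = m2 (q t') * b t * (m1 (p t') * a t')" by simp
  then have "(m1 (p t') * m2 (q t')) * (a t * b t') = (m1 (p t') * m2 (q t')) * (a t' * b t)"
    by (simp add: mult_ac)
  then have "a t * b t' = a t' * b t" using m by simp
  then show "a t div e t = a t' div e t'" "b t div e t = b t' div e t'"
    unfolding e_def
    using div_gcd_unique[OF a1[OF assms(1)] b1[OF assms(1)] a1[OF assms(2)] b1[OF assms(2)]] by simp_all
qed

lemma h_center: "t \<in> F \<Longrightarrow> u \<in> U t \<Longrightarrow> h u = y \<longleftrightarrow> u = t"
proof -
  assume t: "t \<in> F" and u: "u \<in> U t"
  have "h u = y \<longleftrightarrow> \<psi> (h u) = 0" using disc_chartD(10)[OF V] c(3)[OF t u] by simp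
  also have "\<dots> \<longleftrightarrow> \<phi> t u = 0" using c(2)[OF t] c(4)[OF t u] by auto
  also have "\<dots> \<longleftrightarrow> u = t" using dU(10)[OF t u] .
  finally show ?thesis .
qed

lemma linked_refl: "t \<in> F \<Longrightarrow> linked t t 1"
  by (simp add: linked_def)

lemma linked_nz: "linked t t' \<eta> \<Longrightarrow> \<eta> \<noteq> 0"
  by (auto simp: linked_def)

lemma linked_sym:
  assumes "t \<in> F" "t' \<in> F" "linked t t' \<eta>"
  shows "linked t' t (inverse \<eta>)"
proof -
  have pt: "p t = p t'" "q t = q t'" using assms(3) by (auto simp: linked_def)
  note ex = exps_eq[OF assms(1,2) pt]
  have "\<zeta> t' = \<zeta> t * inverse \<eta> ^ (b t' div e t')"
    using assms(3) ex(2) linked_nz[OF assms(3)] by (simp add: linked_def power_inverse)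
  then show ?thesis
    using assms(3) ex(1) unfolding linked_def by (simp add: norm_inverse power_inverse)
qed

text \<open>The quotient of two such rotations is a root of unity for the coprime exponents
  \<open>a t div e t\<close> and \<open>b t div e t\<close>, hence 1. In the coordinate
  \<open>\<phi> t\<close> itself, before passing to \<open>\<phi> t ^ e t\<close>, a rotation would
  be determined only up to \<open>e t\<close>-th roots of unity.\<close>

lemma linked_unique:
  assumes "t \<in> F" "t' \<in> F" "linked t t' \<eta>" "linked t t' \<theta>"
  shows "\<eta> = \<theta>"
proof -
  have nz: "\<theta> \<noteq> 0" "\<zeta> t' \<noteq> 0" using linked_nz[OF assms(4)] \<zeta>1[OF assms(2)] by auto
  have "\<zeta> t' * \<eta> ^ (b t div e t) = \<zeta> t' * \<theta> ^ (b t div e t)"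
    using assms(3,4) by (simp add: linked_def)
  then have "\<eta> ^ (b t div e t) = \<theta> ^ (b t div e t)" using nz by simp
  then have "(\<eta> / \<theta>) ^ (b t div e t) = 1" using nz by (simp add: power_divide)
  moreover have "(\<eta> / \<theta>) ^ (a t div e t) = 1"
    using assms(3,4) by (simp add: linked_def power_divide)
  ultimately have "\<eta> / \<theta> = 1"
    using roots_of_unity_coprime coprime_ab ae1 assms(1) by blast
  then show ?thesis using nz by simp
qed

text \<open>Raising the relation to the powers \<open>a t div e t\<close> and
  \<open>b t div e t\<close> yields the coordinates of \<open>p\<close> and \<open>q\<close>; the
  conditions in \<open>linked\<close> cancel the resulting powers of \<open>\<eta>\<close> and the
  factors \<open>\<zeta>\<close>.\<close>

lemma linked_pq:
  assumes t: "t \<in> F" "t' \<in> F" and l: "linked t t' \<eta>" and u: "u \<in> U t" "u' \<in> U t'"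
    and eq: "\<phi> t' u' ^ e t' = \<eta> * \<phi> t u ^ e t"
  shows "p u = p u'" "q u = q u'"
proof -
  have pt: "p t = p t'" "q t = q t'" using l by (auto simp: linked_def)
  note ex = exps_eq[OF t pt]
  have pw: "\<phi> t' u' ^ (k * e t') = \<eta> ^ k * \<phi> t u ^ (k * e t)" for k
  proof -
    have "(\<phi> t' u' ^ e t') ^ k = \<eta> ^ k * (\<phi> t u ^ e t) ^ k" by (simp add: eq power_mult_distrib)
    then show ?thesis by (simp add: mult.commute flip: power_mult)
  qed
  have "\<phi> t' u' ^ a t' = \<phi> t u ^ a t"
    using pw[of "a t div e t"] ae[of t] ae[of t'] ex(1) l by (simp add: linked_def)
  then have "\<phi>1 (p t) (p u) = \<phi>1 (p t) (p u')"
    using \<phi>1p[OF t(1) u(1)] \<phi>1p[OF t(2) u(2)] pt by simp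
  then show "p u = p u'"
    using disc_chartD(7)[OF cover_overD(1)[OF cf pF(1)[OF t(1)]]] Up[OF t(1) u(1)] Up[OF t(2) u(2)] pt
    by (auto dest: inj_onD)
  have "\<zeta> t' * \<phi> t' u' ^ b t' = \<zeta> t * \<phi> t u ^ b t"
    using pw[of "b t div e t"] be[of t] be[of t'] ex(2) l by (simp add: linked_def)
  then have "\<phi>2 (q t) (q u) = \<phi>2 (q t) (q u')"
    using \<phi>2q[OF t(1) u(1)] \<phi>2q[OF t(2) u(2)] pt by simp
  then show "q u = q u'"
    using disc_chartD(7)[OF cover_overD(1)[OF cg qF[OF t(1)]]] Uq[OF t(1) u(1)] Uq[OF t(2) u(2)] pt
    by (auto dest: inj_onD)
qed

text \<open>The relation between the coordinates is many-valued, but powers and rotations are open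
  and powers are continuous, so it carries neighbourhoods of \<open>u\<close> to neighbourhoods of
  \<open>u'\<close>. Both the comparison of germs and the openness of \<open>germ\<close> rest on
  this.\<close>

lemma linked_nhd:
  assumes t: "t \<in> F" "t' \<in> F" and l: "linked t t' \<eta>" and u: "u \<in> U t" "u' \<in> U t'"
    and eq: "\<phi> t' u' ^ e t' = \<eta> * \<phi> t u ^ e t"
    and N: "openin (surface_top R) N" "u \<in> N"
  obtains M where "openin (surface_top R) M" "u' \<in> M" "M \<subseteq> U t'"
    "\<And>v'. v' \<in> M \<Longrightarrow> \<exists>v\<in>N \<inter> U t. \<phi> t' v' ^ e t' = \<eta> * \<phi> t v ^ e t"
proof -
  define A where "A = (\<lambda>z. z ^ e t') -` (\<lambda>z. \<eta> * z) ` (\<lambda>z. z ^ e t) ` \<phi> t ` (N \<inter> U t)"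
  define M where "M = {v \<in> U t'. \<phi> t' v \<in> A}"
  have "openin (surface_top R) (N \<inter> U t)" using N(1) dU(6)[OF t(1)] by blast
  then have "open (\<phi> t ` (N \<inter> U t))" using plane_chartD(5)[OF dU(1)[OF t(1)], of "N \<inter> U t"] by auto
  then have "open ((\<lambda>z. \<eta> * z) ` (\<lambda>z. z ^ e t) ` \<phi> t ` (N \<inter> U t))"
    using open_power_image[OF _ e1[OF t(1)]] open_mult_image_iff[OF linked_nz[OF l]] by blast
  then have "open A" unfolding A_def by (intro open_vimage) (auto intro!: continuous_intros)
  then have "openin (surface_top R) M"
    unfolding M_def by (rule plane_chart_preimage[OF dU(1)[OF t(2)]])
  moreover have "u' \<in> M"
    using u N(2) eq by (auto simp: A_def M_def)
  moreover have "\<exists>v\<in>N \<inter> U t. \<phi> t' v' ^ e t' = \<eta> * \<phi> t v ^ e t" if "v' \<in> M" for v'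
    using that unfolding M_def A_def by blast
  moreover have "M \<subseteq> U t'" by (auto simp: M_def)
  ultimately show thesis using that by blast
qed

lemma linked_germ_subset:
  assumes t: "t \<in> F" "t' \<in> F" and l: "linked t t' \<eta>" and u: "u \<in> U t" "u' \<in> U t'"
    and eq: "\<phi> t' u' ^ e t' = \<eta> * \<phi> t u ^ e t"
  shows "germ u \<subseteq> germ u'"
proof
  fix B assume "B \<in> germ u"
  then obtain N where N: "openin (surface_top R) N" "u \<in> N" "\<Gamma> ` N \<subseteq> B" unfolding germ_def by blast
  obtain M where M: "openin (surface_top R) M" "u' \<in> M" "M \<subseteq> U t'"
    "\<And>v'. v' \<in> M \<Longrightarrow> \<exists>v\<in>N \<inter> U t. \<phi> t' v' ^ e t' = \<eta> * \<phi> t v ^ e t"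
    using linked_nhd[OF assms N(1,2)] by metis
  have "\<Gamma> ` M \<subseteq> B"
  proof (rule image_subsetI)
    fix v' assume v': "v' \<in> M"
    then obtain v where v: "v \<in> N" "v \<in> U t" "\<phi> t' v' ^ e t' = \<eta> * \<phi> t v ^ e t"
      using M(4) by blast
    have "\<Gamma> v' = \<Gamma> v" using linked_pq[OF t l v(2) subsetD[OF M(3) v'] v(3)] by (simp add: \<Gamma>_def)
    then show "\<Gamma> v' \<in> B" using N(3) v(1) by auto
  qed
  then show "B \<in> germ u'" using M(1,2) unfolding germ_def by blast
qed

lemma linked_germ_eq:
  assumes t: "t \<in> F" "t' \<in> F" and l: "linked t t' \<eta>" and u: "u \<in> U t" "u' \<in> U t'"
    and eq: "\<phi> t' u' ^ e t' = \<eta> * \<phi> t u ^ e t"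
  shows "germ u = germ u'"
proof
  show "germ u \<subseteq> germ u'" by (rule linked_germ_subset[OF assms])
  have "\<phi> t u ^ e t = inverse \<eta> * \<phi> t' u' ^ e t'"
    using eq linked_nz[OF l] by simp
  then show "germ u' \<subseteq> germ u"
    using linked_germ_subset[OF t(2,1) linked_sym[OF t l] u(2,1)] by blast
qed

text \<open>A single pair of points with equal values of \<open>p\<close> and \<open>q\<close>
  determines the rotation as the quotient \<open>z' / z\<close>, provided that it lies off the
  centre, where \<open>z\<close> is nonzero.\<close>

lemma linked_exists:
  assumes t: "t \<in> F" "t' \<in> F" and u: "u \<in> U t" "u' \<in> U t'" and ne: "u \<noteq> t"
    and eq: "p u = p u'" "q u = q u'"
  shows "\<exists>\<eta>. linked t t' \<eta> \<and> \<phi> t' u' ^ e t' = \<eta> * \<phi> t u ^ e t"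
proof -
  have pt: "p t = p t'"
    using cover_overD(5)[OF cf pF(1)[OF t(1)] pF(1)[OF t(2)]] Up[OF t(1) u(1)] Up[OF t(2) u(2)] eq by simp
  have qt: "q t = q t'"
    using cover_overD(5)[OF cg qF[OF t(1)] qF[OF t(2)]] Uq[OF t(1) u(1)] Uq[OF t(2) u(2)] eq by simp
  note ex = exps_eq[OF t pt qt]
  define z z' where "z = \<phi> t u ^ e t" and "z' = \<phi> t' u' ^ e t'"
  have z: "z \<noteq> 0" using dU(10)[OF t(1) u(1)] ne by (simp add: z_def)
  have pz: "\<phi> t u ^ a t = z ^ (a t div e t)" "\<phi> t' u' ^ a t' = z' ^ (a t div e t)"
    "\<phi> t u ^ b t = z ^ (b t div e t)" "\<phi> t' u' ^ b t' = z' ^ (b t div e t)"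
    using ae[of t] ae[of t'] be[of t] be[of t'] ex by (simp_all add: z_def z'_def mult.commute flip: power_mult)
  define \<eta> where "\<eta> = z' / z"
  have "z' ^ (a t div e t) = z ^ (a t div e t)"
    using \<phi>1p[OF t(1) u(1)] \<phi>1p[OF t(2) u(2)] pt eq pz by simp
  then have \<eta>a: "\<eta> ^ (a t div e t) = 1" using z by (simp add: \<eta>_def power_divide)
  then have "cmod \<eta> ^ (a t div e t) = 1" by (metis norm_one norm_power)
  then have \<eta>1: "cmod \<eta> = 1"
    using power_eq_imp_eq_base[of "cmod \<eta>" "a t div e t" 1] ae1[OF t(1)] by simp
  have "\<zeta> t * z ^ (b t div e t) = \<zeta> t' * z' ^ (b t div e t)"
    using \<phi>2q[OF t(1) u(1)] \<phi>2q[OF t(2) u(2)] qt eq pz by simp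
  then have "\<zeta> t = \<zeta> t' * \<eta> ^ (b t div e t)"
    using z by (simp add: \<eta>_def power_divide field_simps)
  then have "linked t t' \<eta>" using pt qt \<eta>a \<eta>1 by (simp add: linked_def)
  moreover have "z' = \<eta> * z" using z by (simp add: \<eta>_def)
  ultimately show ?thesis unfolding z_def z'_def by blast
qed

lemma germ_eq_linked:
  assumes t: "t \<in> F" "t' \<in> F" and u: "u \<in> U t" "u' \<in> U t'" and eq: "germ u = germ u'"
  shows "\<exists>\<eta>. linked t t' \<eta> \<and> \<phi> t' u' ^ e t' = \<eta> * \<phi> t u ^ e t"
proof (cases "u = t")
  case False
  then show ?thesis
    using linked_exists[OF t u] germ_eq_imp_pq[OF UR[OF t(1) u(1)] UR[OF t(2) u(2)] eq] by blast
next
  \<comment> \<open>At the centre both coordinates vanish and determine no rotation. Equality of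
    germs provides, for a non-central \<open>v'\<close> near \<open>t'\<close>, a point
    \<open>v\<close> of \<open>U t\<close> with the same values of \<open>p\<close> and
    \<open>q\<close>; the rotation read off from this pair serves the centres as well.\<close>
  case True
  have "h u' = h u"
    using germ_eq_imp_pq(1)[OF UR[OF t(1) u(1)] UR[OF t(2) u(2)] eq]
      hp[OF UR[OF t(1) u(1)]] hp[OF UR[OF t(2) u(2)]] by simp
  then have "u' = t'" using h_center t u True by metis
  have "\<Gamma> ` U t \<in> germ u" unfolding germ_def using dU(6)[OF t(1)] u(1) by blast
  then have "\<Gamma> ` U t \<in> germ u'" using eq by simp
  then obtain N where N: "openin (surface_top R) N" "u' \<in> N" "\<Gamma> ` N \<subseteq> \<Gamma> ` U t"
    unfolding germ_def by blast
  have "openin (surface_top R) (N \<inter> U t')" using N(1) dU(6)[OF t(2)] by blast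
  then have "open (\<phi> t' ` (N \<inter> U t'))" using plane_chartD(5)[OF dU(1)[OF t(2)], of "N \<inter> U t'"] by auto
  moreover have "0 \<in> \<phi> t' ` (N \<inter> U t')"
    using N(2) u(2) dU(5)[OF t(2)] \<open>u' = t'\<close> by (intro image_eqI[of _ _ t']) auto
  ultimately obtain r where r: "r > 0" "ball 0 r \<subseteq> \<phi> t' ` (N \<inter> U t')" using openE by blast
  have "of_real (r / 2) \<in> \<phi> t' ` (N \<inter> U t')" by (rule subsetD[OF r(2)]) (use r(1) in simp)
  then obtain v' where v': "v' \<in> N" "v' \<in> U t'" "\<phi> t' v' = of_real (r / 2)" by (smt (verit) IntD1 IntD2 imageE)
  then have "v' \<noteq> t'" using dU(5)[OF t(2)] r(1) by auto
  obtain v where v: "v \<in> U t" "\<Gamma> v' = \<Gamma> v" using N(3) v'(1) by blast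
  then have pq: "p v = p v'" "q v = q v'" by (auto simp: \<Gamma>_def)
  then have "h v = h v'" using hp[OF UR[OF t(1) v(1)]] hp[OF UR[OF t(2) v'(2)]] by simp
  then have "v \<noteq> t" using h_center t v(1) v'(2) \<open>v' \<noteq> t'\<close> by metis
  then obtain \<eta> where "linked t t' \<eta>" using linked_exists[OF t v(1) v'(2) _ pq] by blast
  moreover have "\<phi> t' u' ^ e t' = \<eta> * \<phi> t u ^ e t"
    using True \<open>u' = t'\<close> dU(5)[OF t(1)] dU(5)[OF t(2)] e1[OF t(1)] e1[OF t(2)] by (simp add: power_0_left)
  ultimately show ?thesis by blast
qed

text \<open>By \<open>linked_unique\<close> one rotation serves all pairs of points in the two
  sheets, so a single coincidence of germs determines all others.\<close>

lemma germ_rotation: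
  assumes t: "t \<in> F" "t' \<in> F" and u: "u \<in> U t" "u' \<in> U t'" and eq: "germ u = germ u'"
  obtains \<eta> where "cmod \<eta> = 1"
    "\<And>v v'. v \<in> U t \<Longrightarrow> v' \<in> U t' \<Longrightarrow> germ v = germ v' \<longleftrightarrow> \<phi> t' v' ^ e t' = \<eta> * \<phi> t v ^ e t"
proof -
  obtain \<eta> where \<eta>: "linked t t' \<eta>" using germ_eq_linked[OF t u eq] by blast
  have "germ v = germ v' \<longleftrightarrow> \<phi> t' v' ^ e t' = \<eta> * \<phi> t v ^ e t" if v: "v \<in> U t" "v' \<in> U t'" for v v'
    using linked_germ_eq[OF t \<eta> v] germ_eq_linked[OF t v] linked_unique[OF t \<eta>] by blast
  moreover have "cmod \<eta> = 1" using \<eta> by (simp add: linked_def)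
  ultimately show thesis using that by blast
qed

lemma germ_eq_iff:
  assumes t: "t \<in> F" and u: "u \<in> U t" "u' \<in> U t"
  shows "germ u = germ u' \<longleftrightarrow> \<phi> t u ^ e t = \<phi> t u' ^ e t"
  using linked_germ_eq[OF t t linked_refl[OF t] u] germ_eq_linked[OF t t u]
    linked_unique[OF t t linked_refl[OF t]] by auto

end

section \<open>The quotient surface\<close>

context local_square begin

text \<open>The rotated coordinate of \<open>v'\<close> stays in the unit disc, and its
  \<open>e t\<close>-th roots also lie there, hence in the image of \<open>U t\<close>.\<close>

lemma germ_linked_exists:
  assumes t: "t \<in> F" "t' \<in> F" and u: "u \<in> U t" "u' \<in> U t'" and eq: "germ u = germ u'"
    and v': "v' \<in> U t'"
  shows "\<exists>v\<in>U t. germ v = germ v'"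
proof -
  obtain \<eta> where \<eta>: "cmod \<eta> = 1"
    "\<And>v v'. v \<in> U t \<Longrightarrow> v' \<in> U t' \<Longrightarrow> germ v = germ v' \<longleftrightarrow> \<phi> t' v' ^ e t' = \<eta> * \<phi> t v ^ e t"
    using germ_rotation[OF t u eq] by metis
  have \<eta>0: "\<eta> \<noteq> 0" using \<eta>(1) by auto
  define c where "c = \<phi> t' v' ^ e t' / \<eta>"
  obtain z where z: "z ^ e t = c" using exists_complex_root[of "e t" c] e1[OF t(1)] by auto
  have "cmod c < 1"
    using \<eta>(1) dU(9)[OF t(2) v'] e1[OF t(2)]
    by (simp add: c_def norm_divide norm_power power_less_one_iff)
  then have "cmod z ^ e t < 1 ^ e t" using z by (simp flip: norm_power)
  then have "cmod z < 1" by (rule power_less_imp_less_base) simp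
  then have v: "inv_into (U t) (\<phi> t) z \<in> U t" "\<phi> t (inv_into (U t) (\<phi> t) z) = z"
    using dU(12,13)[OF t(1)] by auto
  then have "\<phi> t' v' ^ e t' = \<eta> * \<phi> t (inv_into (U t) (\<phi> t) z) ^ e t"
    using z \<eta>0 by (simp add: c_def)
  then show ?thesis using \<eta>(2)[OF v(1) v'] v(1) by blast
qed

lemma germ_image_eq:
  assumes t: "t \<in> F" "t' \<in> F" and u: "u \<in> U t" "u' \<in> U t'" and eq: "germ u = germ u'"
  shows "germ ` U t = germ ` U t'"
proof
  show "germ ` U t' \<subseteq> germ ` U t"
    using germ_linked_exists[OF t u eq] by (metis image_subsetI image_eqI)
  show "germ ` U t \<subseteq> germ ` U t'"
    using germ_linked_exists[OF t(2,1) u(2,1) eq[symmetric]] by (metis image_subsetI image_eqI)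
qed

text \<open>The representative chosen by \<open>inv_into\<close> is arbitrary; by
  \<open>germ_eq_iff\<close> the power \<open>e t\<close> of its coordinate is the same for all
  representatives in \<open>U t\<close>.\<close>

definition quot_chart where
  "quot_chart t s = \<phi> t (inv_into (U t) germ s) ^ e t"

lemma quot_chart_germ:
  assumes t: "t \<in> F" and u: "u \<in> U t"
  shows "quot_chart t (germ u) = \<phi> t u ^ e t"
proof -
  have "inv_into (U t) germ (germ u) \<in> U t" "germ (inv_into (U t) germ (germ u)) = germ u"
    using u by (auto simp: inv_into_into f_inv_into_f)
  then show ?thesis
    using germ_eq_iff[OF t _ u] by (simp add: quot_chart_def)
qed

end

context branched_square begin

definition quot_top :: "('a \<times> 'b) set set topology" where
  "quot_top = topology (\<lambda>A. A \<subseteq> germ ` pts R \<and>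
     openin (surface_top R) {x \<in> pts R. germ x \<in> A})"

text \<open>
  Admitting every chart whose composition with the projection has positive degree makes the
  compatibility of the charts a consequence of the composition rule.
\<close>

definition quot :: "('a \<times> 'b) set set oriented_space" where
  "quot = \<lparr>surface_top = quot_top,
     atlas = {(A, \<alpha>). plane_chart quot_top A \<alpha> \<and>
       (\<forall>s\<in>pts R. germ s \<in> A \<longrightarrow> (\<exists>k>0. has_cdeg R (\<alpha> \<circ> germ) s k))}\<rparr>"

lemma openin_quot:
  "openin quot_top A \<longleftrightarrow> A \<subseteq> germ ` pts R \<and>
     openin (surface_top R) {x \<in> pts R. germ x \<in> A}"
proof -
  let ?P = "\<lambda>A. A \<subseteq> germ ` pts R \<and>
     openin (surface_top R) {x \<in> pts R. germ x \<in> A}"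
  have "istopology ?P"
    unfolding istopology_def
  proof (intro conjI allI impI)
    fix A B assume AB: "?P A" "?P B"
    have "{x \<in> pts R. germ x \<in> A \<inter> B} =
      {x \<in> pts R. germ x \<in> A} \<inter> {x \<in> pts R. germ x \<in> B}" by auto
    then show "openin (surface_top R) {x \<in> pts R. germ x \<in> A \<inter> B}"
      using AB by (simp add: openin_Int)
    show "A \<inter> B \<subseteq> germ ` pts R" using AB by blast
  next
    fix K assume K: "\<forall>A\<in>K. ?P A"
    have "{x \<in> pts R. germ x \<in> \<Union>K} =
      (\<Union>A\<in>K. {x \<in> pts R. germ x \<in> A})" by auto
    then show "openin (surface_top R) {x \<in> pts R. germ x \<in> \<Union>K}"
      using K by (auto intro!: openin_Union)
    show "\<Union>K \<subseteq> germ ` pts R" using K by blast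
  qed
  then show ?thesis unfolding quot_top_def by (simp add: topology_inverse')
qed

lemma quot_simps [simp]: "surface_top quot = quot_top"
  by (simp add: quot_def)

lemma topspace_quot: "topspace quot_top = germ ` pts R"
proof
  show "topspace quot_top \<subseteq> germ ` pts R"
    using openin_topspace[of quot_top] unfolding openin_quot by blast
  have "{x \<in> pts R. germ x \<in> germ ` pts R} = pts R"
    by auto
  then have "openin quot_top (germ ` pts R)"
    by (simp add: openin_quot)
  then show "germ ` pts R \<subseteq> topspace quot_top" by (rule openin_subset)
qed

lemma germ_continuous: "continuous_map (surface_top R) quot_top germ"
  unfolding continuous_map_def using openin_quot topspace_quot by auto

lemma local_square_at:
  assumes "x \<in> pts R"
  obtains V \<psi> U1 \<phi>1 m1 U2 \<phi>2 m2 U \<phi> a b \<zeta> where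
    "local_square R C1 C2 C p q f g h (h x) V \<psi> U1 \<phi>1 m1 U2 \<phi>2 m2 U \<phi> a b \<zeta>"
  using local_square_exists[OF branched_covering_mapD(2)[OF h_branched assms]] by metis

text \<open>A quotient map need not be open; here openness holds because identified points have
  corresponding neighbourhoods. It is used for the charts, the Hausdorff property and second
  countability of the quotient.\<close>

lemma germ_open:
  assumes N: "openin (surface_top R) N"
  shows "openin quot_top (germ ` N)"
  unfolding openin_quot
proof
  show "germ ` N \<subseteq> germ ` pts R" using openin_subset[OF N] by blast
  let ?W = "{x \<in> pts R. germ x \<in> germ ` N}"
  show "openin (surface_top R) ?W"
    unfolding openin_subopen[of _ ?W]
  proof
    fix x assume "x \<in> ?W"
    then obtain n where x: "x \<in> pts R" and n: "n \<in> N" "germ n = germ x" by auto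
    have nR: "n \<in> pts R" using openin_subset[OF N] n(1) by blast
    obtain V \<psi> U1 \<phi>1 m1 U2 \<phi>2 m2 U \<phi> a b \<zeta> where
      "local_square R C1 C2 C p q f g h (h x) V \<psi> U1 \<phi>1 m1 U2 \<phi>2 m2 U \<phi> a b \<zeta>"
      using local_square_at[OF x] by metis
    then interpret L: local_square R C1 C2 C p q f g h "h x" V \<psi> U1 \<phi>1 m1 U2 \<phi>2 m2 U \<phi> a b \<zeta> .
    have hn: "h n = h x"
      using germ_eq_imp_pq(1)[OF nR x n(2)] hp[OF nR] hp[OF x] by simp
    have t: "n \<in> L.F" "x \<in> L.F" using x nR hn by (auto simp: fibre_def)
    have u: "n \<in> U n" "x \<in> U x" using L.dU(3) t by blast+
    obtain \<eta> where \<eta>: "L.linked n x \<eta>" "\<phi> x x ^ L.e x = \<eta> * \<phi> n n ^ L.e n"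
      using L.germ_eq_linked[OF t u n(2)] by blast
    obtain M where M: "openin (surface_top R) M" "x \<in> M" "M \<subseteq> U x"
      "\<And>v'. v' \<in> M \<Longrightarrow> \<exists>v\<in>N \<inter> U n. \<phi> x v' ^ L.e x = \<eta> * \<phi> n v ^ L.e n"
      using L.linked_nhd[OF t \<eta>(1) u \<eta>(2) N n(1)] by metis
    have "M \<subseteq> ?W"
    proof
      fix v' assume v': "v' \<in> M"
      then obtain v where v: "v \<in> N" "v \<in> U n" "\<phi> x v' ^ L.e x = \<eta> * \<phi> n v ^ L.e n" using M(4) by blast
      have "germ v = germ v'" using L.linked_germ_eq[OF t \<eta>(1) v(2) subsetD[OF M(3) v'] v(3)] .
      then have "germ v' \<in> germ ` N" using v(1) by (metis imageI)
      moreover have "v' \<in> pts R" using openin_subset[OF M(1)] v' by blast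
      ultimately show "v' \<in> ?W" by simp
    qed
    then show "\<exists>T. openin (surface_top R) T \<and> x \<in> T \<and> T \<subseteq> ?W" using M(1,2) by blast
  qed
qed

lemma germ_quotient_map: "quotient_map (surface_top R) quot_top germ"
  unfolding quotient_map_def using openin_quot topspace_quot by auto

lemma continuous_descend:
  assumes r: "continuous_map (surface_top R) X r"
    and r': "\<And>u. u \<in> pts R \<Longrightarrow> r' (germ u) = r u"
  shows "continuous_map quot_top X r'"
proof (rule continuous_compose_quotient_map[OF germ_quotient_map])
  show "continuous_map (surface_top R) X (r' \<circ> germ)"
    by (rule continuous_map_eq[OF r]) (simp add: r')
qed

text \<open>One common germ yields a rotation valid on both sheets, and every rotation matches the
  centres, where both coordinates are 0.\<close>

lemma germ_images_disjoint_or_eq: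
  assumes L: "local_square R C1 C2 C p q f g h y V \<psi> U1 \<phi>1 m1 U2 \<phi>2 m2 U \<phi> a b \<zeta>"
    and t: "t \<in> fibre R h y" "t' \<in> fibre R h y" and ne: "germ ` U t \<inter> germ ` U t' \<noteq> {}"
  shows "germ t = germ t'"
proof -
  interpret L: local_square R C1 C2 C p q f g h y V \<psi> U1 \<phi>1 m1 U2 \<phi>2 m2 U \<phi> a b \<zeta> by (rule L)
  obtain u u' where u: "u \<in> U t" "u' \<in> U t'" "germ u = germ u'"
    using ne by (auto simp: disjoint_iff)
  obtain \<eta> where \<eta>: "cmod \<eta> = 1"
    "\<And>v v'. v \<in> U t \<Longrightarrow> v' \<in> U t' \<Longrightarrow> germ v = germ v' \<longleftrightarrow> \<phi> t' v' ^ L.e t' = \<eta> * \<phi> t v ^ L.e t"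
    using L.germ_rotation[OF t u] by metis
  then show ?thesis
    using L.dU(3,5)[OF t(1)] L.dU(3,5)[OF t(2)] L.e1[OF t(1)] L.e1[OF t(2)] by (simp add: power_0_left)
qed

lemma h_germ:
  assumes "u \<in> pts R" "v \<in> pts R" "germ u = germ v"
  shows "h u = h v"
  using germ_eq_imp_pq(1)[OF assms] hp assms(1,2) by simp

definition descend where "descend r s = r (inv_into (pts R) germ s)"

lemma descend_germ:
  assumes "u \<in> pts R"
    and "\<And>u v. u \<in> pts R \<Longrightarrow> v \<in> pts R \<Longrightarrow> germ u = germ v \<Longrightarrow> r u = r v"
  shows "descend r (germ u) = r u"
  unfolding descend_def
  by (rule assms(2)) (use assms(1) in \<open>auto simp: inv_into_into f_inv_into_f\<close>)

text \<open>Germs over different points of \<open>C\<close> are separated by pulling back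
  neighbourhoods from \<open>C\<close>. Over the same point, distinct germs lie at centres of sheets
  whose images are disjoint.\<close>

lemma quot_Hausdorff: "Hausdorff_space quot_top"
  unfolding Hausdorff_space_def
proof (intro allI impI)
  fix s s' assume "s \<in> topspace quot_top \<and> s' \<in> topspace quot_top \<and> s \<noteq> s'"
  then obtain u v where uv: "u \<in> pts R" "v \<in> pts R"
    "s = germ u" "s' = germ v" "germ u \<noteq> germ v" by (auto simp: topspace_quot)
  show "\<exists>A B. openin quot_top A \<and> openin quot_top B \<and> s \<in> A \<and> s' \<in> B \<and> disjnt A B"
  proof (cases "h u = h v")
    case False
    have h': "descend h (germ x) = h x" if "x \<in> pts R" for x
      using descend_germ[OF that h_germ] .
    have cont: "continuous_map quot_top (surface_top C) (descend h)"
      by (rule continuous_descend[OF branched_covering_mapD(1)[OF h_branched] h'])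
    have "h u \<in> pts C" "h v \<in> pts C"
      using branched_covering_mapD(2)[OF h_branched] uv by blast+
    then obtain A B where AB: "openin (surface_top C) A" "openin (surface_top C) B" "h u \<in> A" "h v \<in> B" "disjnt A B"
      using sC(3) False unfolding Hausdorff_space_def by meson
    have "openin quot_top {x \<in> topspace quot_top. descend h x \<in> A}"
      "openin quot_top {x \<in> topspace quot_top. descend h x \<in> B}"
      using openin_continuous_map_preimage[OF cont] AB by blast+
    moreover have "s \<in> {x \<in> topspace quot_top. descend h x \<in> A}" "s' \<in> {x \<in> topspace quot_top. descend h x \<in> B}"
      using uv AB h' by (auto simp: topspace_quot)
    moreover have "disjnt {x \<in> topspace quot_top. descend h x \<in> A} {x \<in> topspace quot_top. descend h x \<in> B}"
      using AB(5) by (auto simp: disjnt_iff)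
    ultimately show ?thesis by blast
  next
    case True
    obtain V \<psi> U1 \<phi>1 m1 U2 \<phi>2 m2 U \<phi> a b \<zeta> where
      L0: "local_square R C1 C2 C p q f g h (h u) V \<psi> U1 \<phi>1 m1 U2 \<phi>2 m2 U \<phi> a b \<zeta>"
      using local_square_at[OF uv(1)] by metis
    then interpret L: local_square R C1 C2 C p q f g h "h u" V \<psi> U1 \<phi>1 m1 U2 \<phi>2 m2 U \<phi> a b \<zeta> .
    have t: "u \<in> L.F" "v \<in> L.F" using uv True by (auto simp: fibre_def)
    have "germ ` U u \<inter> germ ` U v = {}"
      using germ_images_disjoint_or_eq[OF L0 t] uv(5) by blast
    then have "disjnt (germ ` U u) (germ ` U v)" by (simp add: disjnt_def)
    moreover have "openin quot_top (germ ` U u)" "openin quot_top (germ ` U v)"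
      using germ_open L.dU(6) t by blast+
    moreover have "s \<in> germ ` U u" "s' \<in> germ ` U v"
      using L.dU(3) t uv by blast+
    ultimately show ?thesis by blast
  qed
qed

end

section \<open>Charts of the quotient\<close>

context local_square begin

lemma quot_chart_rotation:
  assumes t: "t \<in> F" "t' \<in> F" and u: "u \<in> U t" "u' \<in> U t'" and eq: "germ u = germ u'"
  shows "\<exists>\<eta>. \<eta> \<noteq> 0 \<and> (\<forall>v\<in>U t'. quot_chart t (germ v) = \<eta> * \<phi> t' v ^ e t')"
proof -
  obtain \<eta> where \<eta>: "cmod \<eta> = 1"
    "\<And>v v'. v \<in> U t' \<Longrightarrow> v' \<in> U t \<Longrightarrow> germ v = germ v' \<longleftrightarrow> \<phi> t v' ^ e t = \<eta> * \<phi> t' v ^ e t'"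
    using germ_rotation[OF t(2,1) u(2,1) eq[symmetric]] by metis
  have "quot_chart t (germ v) = \<eta> * \<phi> t' v ^ e t'" if v: "v \<in> U t'" for v
  proof -
    obtain v' where v': "v' \<in> U t" "germ v' = germ v"
      using germ_linked_exists[OF t u eq v] by blast
    then have "quot_chart t (germ v) = \<phi> t v' ^ e t" using quot_chart_germ[OF t(1) v'(1)] by simp
    also have "\<dots> = \<eta> * \<phi> t' v ^ e t'" using \<eta>(2)[OF v v'(1)] v'(2) by simp
    finally show ?thesis .
  qed
  moreover have "\<eta> \<noteq> 0" using \<eta>(1) by auto
  ultimately show ?thesis by blast
qed

lemma quot_chart_image:
  assumes t: "t \<in> F"
  shows "quot_chart t ` germ ` U t = ball 0 1"
proof -
  have "quot_chart t ` germ ` U t = (\<lambda>z. z ^ e t) ` \<phi> t ` U t"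
    using quot_chart_germ[OF t] by (force simp: image_image)
  also have "\<dots> = ball 0 1"
  proof
    show "(\<lambda>z. z ^ e t) ` \<phi> t ` U t \<subseteq> ball 0 1"
      using dU(9)[OF t] e1[OF t] by (auto simp: norm_power power_less_one_iff)
    show "ball 0 1 \<subseteq> (\<lambda>z. z ^ e t) ` \<phi> t ` U t"
    proof
      fix w :: complex assume w: "w \<in> ball 0 1"
      obtain z where z: "z ^ e t = w" using exists_complex_root[of "e t" w] e1[OF t] by auto
      then have "cmod z ^ e t < 1 ^ e t" using w by (simp flip: norm_power)
      then have "cmod z < 1" by (rule power_less_imp_less_base) simp
      then have "z \<in> \<phi> t ` U t" using dU(4)[OF t] by simp
      then show "w \<in> (\<lambda>z. z ^ e t) ` \<phi> t ` U t" using z by blast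
    qed
  qed
  finally show ?thesis .
qed

text \<open>Through \<open>germ\<close> the chart is a power of \<open>\<phi> t\<close>. Open sets
  are carried forward because powers are open maps, and back because powers are continuous and
  \<open>germ\<close> is open.\<close>

lemma quot_chart_plane_chart:
  assumes t: "t \<in> F"
  shows "plane_chart quot_top (germ ` U t) (quot_chart t)"
  unfolding plane_chart_iff
proof (intro conjI allI impI)
  show "openin quot_top (germ ` U t)" by (rule germ_open[OF dU(6)[OF t]])
  show inj: "inj_on (quot_chart t) (germ ` U t)"
    using quot_chart_germ[OF t] germ_eq_iff[OF t] by (auto simp: inj_on_def)
  fix A assume A: "A \<subseteq> germ ` U t"
  define N where "N = {u \<in> U t. germ u \<in> A}"
  have AN: "A = germ ` N" using A by (auto simp: N_def)
  have im: "quot_chart t ` A = (\<lambda>z. z ^ e t) ` \<phi> t ` N"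
    unfolding AN using quot_chart_germ[OF t] by (force simp: image_image N_def)
  show "openin quot_top A \<longleftrightarrow> open (quot_chart t ` A)"
  proof
    assume "openin quot_top A"
    then have "openin (surface_top R) ({x \<in> pts R. germ x \<in> A} \<inter> U t)"
      using dU(6)[OF t] unfolding openin_quot by blast
    moreover have "{x \<in> pts R. germ x \<in> A} \<inter> U t = N"
      using dU(8)[OF t] by (auto simp: N_def)
    ultimately have "open (\<phi> t ` N)"
      using plane_chartD(5)[OF dU(1)[OF t], of N] by (auto simp: N_def)
    then show "open (quot_chart t ` A)" unfolding im by (rule open_power_image[OF _ e1[OF t]])
  next
    assume o: "open (quot_chart t ` A)"
    then have "open ((\<lambda>z. z ^ e t) -` quot_chart t ` A)"
      by (intro open_vimage) (auto intro!: continuous_intros)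
    then have "openin (surface_top R) {u \<in> U t. \<phi> t u \<in> (\<lambda>z. z ^ e t) -` quot_chart t ` A}"
      by (rule plane_chart_preimage[OF dU(1)[OF t]])
    moreover have "{u \<in> U t. \<phi> t u \<in> (\<lambda>z. z ^ e t) -` quot_chart t ` A} = N"
    proof -
      have "\<phi> t u ^ e t \<in> quot_chart t ` A \<longleftrightarrow> germ u \<in> A" if u: "u \<in> U t" for u
        using quot_chart_germ[OF t u, symmetric] inj_on_image_mem_iff[OF inj imageI[OF u] A] by simp
      then show ?thesis by (auto simp: N_def)
    qed
    ultimately show "openin quot_top A" unfolding AN by (simp add: germ_open)
  qed
qed

lemma quot_chart_atlas:
  assumes t: "t \<in> F"
  shows "(germ ` U t, quot_chart t) \<in> atlas quot"
proof -
  have "\<exists>k>0. has_cdeg R (quot_chart t \<circ> germ) s k"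
    if s: "s \<in> pts R" "germ s \<in> germ ` U t" for s
  proof -
    obtain u where u: "u \<in> U t" "germ u = germ s" using s(2) by (metis imageE)
    have "h s \<in> V" using h_germ[OF UR[OF t u(1)] s(1) u(2)] c(3)[OF t u(1)] by simp
    \<comment> \<open>The point \<open>s\<close> need not lie in \<open>U t\<close>. In its own
      sheet \<open>U t'\<close> the chart reads as a rotated \<open>e t'\<close>-th power, which
      still has positive degree.\<close>
    then obtain t' where t': "t' \<in> F" "s \<in> U t'" using c(6)[OF s(1)] by blast
    obtain \<eta> where \<eta>: "\<eta> \<noteq> 0" "\<forall>v\<in>U t'. quot_chart t (germ v) = \<eta> * \<phi> t' v ^ e t'"
      using quot_chart_rotation[OF t t'(1) u(1) t'(2) u(2)] by blast
    obtain k where k: "k > 0" "has_ldeg (\<lambda>z. z ^ e t') (\<phi> t' s) k"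
      using has_ldeg_power[OF e1[OF t'(1)]] by blast
    have 1: "has_cdeg R ((\<lambda>z. z ^ e t') \<circ> \<phi> t') s (1 * k)"
      by (rule has_cdeg_comp[OF sR(1) positive_chart_has_cdeg[OF sR(1) dU(2)[OF t'(1)] t'(2)] k(2)])
    have 2: "has_cdeg R ((\<lambda>z. \<eta> * z + 0) \<circ> ((\<lambda>z. z ^ e t') \<circ> \<phi> t')) s (1 * k * 1)"
      by (rule has_cdeg_comp[OF sR(1) 1 has_ldeg_affine[OF \<eta>(1)]])
    have "has_cdeg R (quot_chart t \<circ> germ) s (1 * k * 1)"
      by (rule has_cdeg_cong[OF sR(1) 2 dU(6)[OF t'(1)] t'(2)]) (use \<eta>(2) in simp)
    then show ?thesis using k(1) by (intro exI[of _ k]) simp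
  qed
  then show ?thesis
    using quot_chart_plane_chart[OF t] by (simp add: quot_def)
qed

end

context branched_square begin

text \<open>Pulled back to \<open>R\<close>, the charts have positive degrees \<open>i\<close> and
  \<open>j\<close> at a point over \<open>x\<close>, and the degree \<open>k\<close> of the
  transition satisfies \<open>i * k = j\<close>. So \<open>k\<close> is positive, and as the degree
  of an injective transition it is 1.\<close>

lemma quot_atlas_positive:
  assumes A: "(A, \<alpha>) \<in> atlas quot"
  shows "positive_chart quot A \<alpha>"
proof -
  have pA: "plane_chart quot_top A \<alpha>" using A by (simp add: quot_def)
  have "orientation_preserving_on (\<alpha> ` (A \<inter> B)) (\<beta> \<circ> inv_into A \<alpha>)"
    if B: "(B, \<beta>) \<in> atlas quot" for B \<beta>
  proof -
    have pB: "plane_chart quot_top B \<beta>" using B by (simp add: quot_def)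
    note tr = plane_chart_transition[OF pB pA]
    have "has_ldeg (\<beta> \<circ> inv_into A \<alpha>) (\<alpha> x) 1" if x: "x \<in> B \<inter> A" for x
    proof -
      have "x \<in> topspace quot_top" using plane_chartD(3)[OF pA] x by blast
      then obtain s where s: "s \<in> pts R" "x = germ s" by (auto simp: topspace_quot)
      have mem: "\<alpha> x \<in> \<alpha> ` (B \<inter> A)" using x by blast
      have "\<exists>k. has_ldeg (\<beta> \<circ> inv_into A \<alpha>) (\<alpha> x) k"
      proof (rule has_ldeg_exists[OF tr(1) mem tr(2)])
        show "(\<beta> \<circ> inv_into A \<alpha>) v \<noteq> (\<beta> \<circ> inv_into A \<alpha>) (\<alpha> x)" if "v \<in> \<alpha> ` (B \<inter> A) - {\<alpha> x}" for v
          using inj_onD[OF tr(3) _ _ mem, of v] that by blast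
      qed
      then obtain k where k: "has_ldeg (\<beta> \<circ> inv_into A \<alpha>) (\<alpha> x) k" by blast
      obtain i where i: "i > 0" "has_cdeg R (\<alpha> \<circ> germ) s i" using A s x by (auto simp: quot_def)
      obtain j where j: "j > 0" "has_cdeg R (\<beta> \<circ> germ) s j" using B s x by (auto simp: quot_def)
      have "has_cdeg R ((\<beta> \<circ> inv_into A \<alpha>) \<circ> (\<alpha> \<circ> germ)) s (i * k)"
        by (rule has_cdeg_comp[OF sR(1) i(2)]) (use k s in simp)
      moreover have "openin (surface_top R) {u \<in> pts R. germ u \<in> A}"
        using plane_chartD(1)[OF pA] by (simp add: openin_quot)
      ultimately have "has_cdeg R (\<beta> \<circ> germ) s (i * k)"
        by (rule has_cdeg_cong[OF sR(1)]) (use s x plane_chartD(6)[OF pA] in auto)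
      then have "i * k = j" using has_cdeg_unique[OF sR(1)] j(2) by blast
      then have "k > 0" using i(1) j(1) by (metis zero_less_mult_pos)
      then show ?thesis
        using plane_chart_transition_inverse(1)[OF pB pA x k] k by simp
    qed
    then show ?thesis
      using orientation_preserving_on_iff[OF tr] by (auto simp: Int_commute)
  qed
  then show ?thesis unfolding positive_chart_iff using pA by auto
qed

lemma quot_closed_surface: "closed_surface quot"
proof -
  have "topspace quot_top \<noteq> {}" using sR(5) by (simp add: topspace_quot)
  moreover have "connected_space quot_top"
    using connected_space_quotient_map_image[OF germ_quotient_map sR(4)] .
  moreover have "compact_space quot_top"
    using image_compactin[OF _ germ_continuous, of "pts R"] sR(2)
    by (simp add: compact_space_def topspace_quot)
  moreover have "second_countable quot_top"
    by (rule second_countable_open_map_image[OF germ_continuous _ _ sR(6)])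
      (use germ_open topspace_quot in \<open>auto simp: open_map_def\<close>)
  moreover have "(\<Union>(A, \<alpha>) \<in> atlas quot. A) = topspace quot_top"
  proof
    show "(\<Union>(A, \<alpha>) \<in> atlas quot. A) \<subseteq> topspace quot_top"
      using plane_chartD(3) by (auto simp: quot_def)
    show "topspace quot_top \<subseteq> (\<Union>(A, \<alpha>) \<in> atlas quot. A)"
    proof
      fix s assume "s \<in> topspace quot_top"
      then obtain x where x: "x \<in> pts R" "s = germ x" by (auto simp: topspace_quot)
      obtain V \<psi> U1 \<phi>1 m1 U2 \<phi>2 m2 U \<phi> a b \<zeta> where
        "local_square R C1 C2 C p q f g h (h x) V \<psi> U1 \<phi>1 m1 U2 \<phi>2 m2 U \<phi> a b \<zeta>"
        using local_square_at[OF x(1)] by metis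
      then interpret L: local_square R C1 C2 C p q f g h "h x" V \<psi> U1 \<phi>1 m1 U2 \<phi>2 m2 U \<phi> a b \<zeta> .
      have "x \<in> L.F" using x(1) by (simp add: fibre_def)
      then show "s \<in> (\<Union>(A, \<alpha>) \<in> atlas quot. A)"
        using L.quot_chart_atlas[of x] L.dU(3)[of x] x(2) by fast
    qed
  qed
  ultimately show ?thesis
    using quot_Hausdorff quot_atlas_positive unfolding closed_surface_def surface_def by auto
qed

lemma quot_surface: "surface quot"
  using closed_surfaceD(1)[OF quot_closed_surface] .

end

context local_square begin

lemma quot_disc_chart:
  assumes t: "t \<in> F"
  shows "disc_chart quot (germ t) (germ ` U t) (quot_chart t)"
  unfolding disc_chart_def
  using quot_atlas_positive[OF quot_chart_atlas[OF t]] quot_chart_image[OF t] dU(3,5)[OF t]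
    quot_chart_germ[OF t dU(3)[OF t]] e1[OF t] by (simp add: power_0_left)

lemma germ_power_map_at:
  assumes t: "t \<in> F"
  shows "power_map_at R quot germ t (U t) (germ ` U t) (e t)"
  unfolding power_map_at_iff using c(1)[OF t] quot_disc_chart[OF t] quot_chart_germ[OF t] e1[OF t] by blast

text \<open>The power \<open>d * e t\<close> of \<open>\<phi> t\<close> is the \<open>d\<close>-th
  power of the quotient coordinate, so division of the exponent by \<open>e t\<close> gives the
  normal form of the factor.\<close>

lemma descend_power_map_at:
  assumes t: "t \<in> F" and r': "\<And>u. u \<in> pts R \<Longrightarrow> r' (germ u) = r u"
    and W: "disc_chart X (r t) W \<beta>" and d: "d \<ge> 1"
    and r: "\<And>u. u \<in> U t \<Longrightarrow> r u \<in> W" "\<And>u. u \<in> U t \<Longrightarrow> \<beta> (r u) = \<phi> t u ^ (d * e t)"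
  shows "power_map_at quot X r' (germ t) (germ ` U t) W d"
proof -
  have "r' s \<in> W \<and> \<beta> (r' s) = quot_chart t s ^ d" if "s \<in> germ ` U t" for s
  proof -
    obtain u where u: "u \<in> U t" "s = germ u" using \<open>s \<in> germ ` U t\<close> by blast
    then show ?thesis
      using r' UR[OF t u(1)] r[OF u(1)] quot_chart_germ[OF t u(1)] by (simp add: mult.commute flip: power_mult)
  qed
  moreover have "r' (germ t) = r t" using r' UR[OF t dU(3)[OF t]] by simp
  ultimately show ?thesis
    unfolding power_map_at_iff using d quot_disc_chart[OF t] W by metis
qed

end

section \<open>Branched coverings onto and from the quotient\<close>

context branched_square begin

lemma germ_branched: "branched_covering_map R quot germ"
proof (rule branched_covering_mapI_power_map)
  show "continuous_map (surface_top R) (surface_top quot) germ" using germ_continuous by simp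
  fix s assume "s \<in> pts quot"
  then obtain x where x: "x \<in> pts R" "s = germ x" by (auto simp: topspace_quot)
  obtain V \<psi> U1 \<phi>1 m1 U2 \<phi>2 m2 U \<phi> a b \<zeta> where
    L0: "local_square R C1 C2 C p q f g h (h x) V \<psi> U1 \<phi>1 m1 U2 \<phi>2 m2 U \<phi> a b \<zeta>"
    using local_square_at[OF x(1)] by metis
  then interpret L: local_square R C1 C2 C p q f g h "h x" V \<psi> U1 \<phi>1 m1 U2 \<phi>2 m2 U \<phi> a b \<zeta> .
  have xF: "x \<in> L.F" using x(1) by (simp add: fibre_def)
  have sub: "t \<in> L.F" "germ t = germ x" if "t \<in> fibre R germ s" for t
    using that h_germ[of t x] x by (auto simp: fibre_def)
  \<comment> \<open>All sheets whose centres have the germ \<open>s\<close> have the same image in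
    the quotient, so the image of \<open>U x\<close> is a neighbourhood that suits the whole
    fibre.\<close>
  have im: "germ ` U t = germ ` U x" if "t \<in> fibre R germ s" for t
    using L.germ_image_eq[OF sub(1)[OF that] xF] L.dU(3) sub[OF that] xF by blast
  have "x \<in> fibre R germ s" using x by (simp add: fibre_def)
  moreover have "openin quot_top (germ ` U x)" "s \<in> germ ` U x"
    using germ_open[OF L.dU(6)[OF xF]] L.dU(3)[OF xF] x(2) by auto
  moreover have "disjoint_family_on U (fibre R germ s)"
    unfolding disjoint_family_on_def using L.c(5) sub(1) by blast
  moreover have "{u \<in> pts R. germ u \<in> germ ` U x} = (\<Union>t\<in>fibre R germ s. U t)"
  proof (intro equalityI subsetI)
    fix u assume "u \<in> {u \<in> pts R. germ u \<in> germ ` U x}"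
    then obtain v where u: "u \<in> pts R" "v \<in> U x" "germ u = germ v" by auto
    have "h u \<in> V" using h_germ[OF u(1) L.UR[OF xF u(2)] u(3)] L.c(3)[OF xF u(2)] by simp
    then obtain t where t: "t \<in> L.F" "u \<in> U t" using L.c(6)[OF u(1)] by blast
    have "germ t = germ x"
      using germ_images_disjoint_or_eq[OF L0 t(1) xF] t(2) u(2,3) by blast
    then have "t \<in> fibre R germ s" using t(1) x(2) by (simp add: fibre_def)
    then show "u \<in> (\<Union>t\<in>fibre R germ s. U t)" using t(2) by blast
  next
    fix u assume "u \<in> (\<Union>t\<in>fibre R germ s. U t)"
    then obtain t where t: "t \<in> fibre R germ s" "u \<in> U t" by blast
    then show "u \<in> {u \<in> pts R. germ u \<in> germ ` U x}"
      using im[OF t(1)] L.UR[OF sub(1)[OF t(1)] t(2)] by blast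
  qed
  moreover have "\<exists>d. power_map_at R quot germ t (U t) (germ ` U x) d" if t: "t \<in> fibre R germ s" for t
    using L.germ_power_map_at[OF sub(1)[OF t]] im[OF t] by auto
  ultimately show "fibre R germ s \<noteq> {} \<and> (\<exists>V U. openin (surface_top quot) V \<and> s \<in> V \<and>
      disjoint_family_on U (fibre R germ s) \<and>
      {x \<in> pts R. germ x \<in> V} = (\<Union>t\<in>fibre R germ s. U t) \<and>
      (\<forall>t\<in>fibre R germ s. \<exists>d. power_map_at R quot germ t (U t) V d))"
    unfolding quot_simps
    by (intro conjI exI[of _ "germ ` U x"] exI[of _ U] ballI) blast+
qed

lemma germ_local_degree:
  assumes t: "t \<in> pts R"
  shows "local_degree R quot germ t = gcd (local_degree R C1 p t) (local_degree R C2 q t)"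
proof -
  obtain V \<psi> U1 \<phi>1 m1 U2 \<phi>2 m2 U \<phi> a b \<zeta> where
    "local_square R C1 C2 C p q f g h (h t) V \<psi> U1 \<phi>1 m1 U2 \<phi>2 m2 U \<phi> a b \<zeta>"
    using local_square_at[OF t] by metis
  then interpret L: local_square R C1 C2 C p q f g h "h t" V \<psi> U1 \<phi>1 m1 U2 \<phi>2 m2 U \<phi> a b \<zeta> .
  have tF: "t \<in> L.F" using t by (simp add: fibre_def)
  have "local_degree R C1 p t = a t"
    by (rule cover_over_local_degree[OF cover_overD(1)[OF L.cf L.pF(1)[OF tF]] L.cp[OF L.pF(1)[OF tF]] L.pF(2)[OF tF]])
  then show ?thesis
    using power_map_at_local_degree[OF L.germ_power_map_at[OF tF]] L.ldb[OF tF] by (simp add: L.e_def)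
qed

text \<open>The sheets of \<open>r'\<close> are the images of the sheets of \<open>r\<close>. The
  last two conditions say that such images coincide or are disjoint according to the germs of their
  centres, so one representative \<open>\<iota> s\<close> per germ indexes them without
  repetition.\<close>

lemma descend_branched:
  assumes r: "branched_covering_map R X r"
    and r': "\<And>u. u \<in> pts R \<Longrightarrow> r' (germ u) = r u"
    and loc: "\<And>x. x \<in> pts X \<Longrightarrow> \<exists>W U. openin (surface_top X) W \<and> x \<in> W \<and>
      {u \<in> pts R. r u \<in> W} = (\<Union>t\<in>fibre R r x. U t) \<and>
      (\<forall>t\<in>fibre R r x. \<exists>d. power_map_at quot X r' (germ t) (germ ` U t) W d) \<and>
      (\<forall>t\<in>fibre R r x. \<forall>t'\<in>fibre R r x. germ ` U t \<inter> germ ` U t' \<noteq> {} \<longrightarrow> germ t = germ t') \<and>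
      (\<forall>t\<in>fibre R r x. \<forall>t'\<in>fibre R r x. germ t = germ t' \<longrightarrow> germ ` U t = germ ` U t')"
  shows "branched_covering_map quot X r'"
proof (rule branched_covering_mapI_power_map)
  show "continuous_map (surface_top quot) (surface_top X) r'"
    using continuous_descend[OF branched_covering_mapD(1)[OF r] r'] by simp
  fix x assume x: "x \<in> pts X"
  obtain W U where W: "openin (surface_top X) W" "x \<in> W"
    and cov: "{u \<in> pts R. r u \<in> W} = (\<Union>t\<in>fibre R r x. U t)"
    and pow: "\<forall>t\<in>fibre R r x. \<exists>d. power_map_at quot X r' (germ t) (germ ` U t) W d"
    and dis: "\<forall>t\<in>fibre R r x. \<forall>t'\<in>fibre R r x. germ ` U t \<inter> germ ` U t' \<noteq> {} \<longrightarrow> germ t = germ t'"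
    and im: "\<forall>t\<in>fibre R r x. \<forall>t'\<in>fibre R r x. germ t = germ t' \<longrightarrow> germ ` U t = germ ` U t'"
    using loc[OF x] by (elim exE conjE) (rule that)
  define \<iota> where "\<iota> s = inv_into (pts R) germ s" for s
  have fib: "fibre quot r' x = germ ` fibre R r x"
    using r' by (auto simp: fibre_def topspace_quot)
  have \<iota>: "\<iota> s \<in> fibre R r x" "germ (\<iota> s) = s" if s: "s \<in> fibre quot r' x" for s
  proof -
    have "s \<in> germ ` pts R" using s by (simp add: fibre_def topspace_quot)
    then have 1: "\<iota> s \<in> pts R" "germ (\<iota> s) = s"
      by (auto simp: \<iota>_def inv_into_into f_inv_into_f)
    then show "\<iota> s \<in> fibre R r x" "germ (\<iota> s) = s"
      using s r'[OF 1(1)] by (auto simp: fibre_def)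
  qed
  have "fibre quot r' x \<noteq> {}"
    unfolding fib using branched_covering_mapD(3)[OF r x] by simp
  moreover have "disjoint_family_on (\<lambda>s. germ ` U (\<iota> s)) (fibre quot r' x)"
    unfolding disjoint_family_on_def using dis \<iota> by metis
  moreover have "{s \<in> pts quot. r' s \<in> W} = (\<Union>s\<in>fibre quot r' x. germ ` U (\<iota> s))"
  proof -
    have "{s \<in> pts quot. r' s \<in> W} = germ ` {u \<in> pts R. r u \<in> W}"
      using r' by (auto simp: topspace_quot)
    also have "\<dots> = (\<Union>t\<in>fibre R r x. germ ` U t)" unfolding cov by blast
    also have "\<dots> = (\<Union>s\<in>fibre quot r' x. germ ` U (\<iota> s))"
    proof -
      have "germ ` U t = germ ` U (\<iota> (germ t))" if t: "t \<in> fibre R r x" for t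
        using bspec[OF bspec[OF im t] \<iota>(1)[of "germ t"]] \<iota>(2)[of "germ t"] t fib by simp
      then show ?thesis unfolding fib by simp
    qed
    finally show ?thesis .
  qed
  moreover have "\<exists>d. power_map_at quot X r' s (germ ` U (\<iota> s)) W d" if s: "s \<in> fibre quot r' x" for s
    using bspec[OF pow \<iota>(1)[OF s]] \<iota>(2)[OF s] by simp
  ultimately show "fibre quot r' x \<noteq> {} \<and> (\<exists>V U. openin (surface_top X) V \<and> x \<in> V \<and>
      disjoint_family_on U (fibre quot r' x) \<and>
      {s \<in> pts quot. r' s \<in> V} = (\<Union>t\<in>fibre quot r' x. U t) \<and>
      (\<forall>t\<in>fibre quot r' x. \<exists>d. power_map_at quot X r' t (U t) V d))"
    using W by (intro conjI exI[of _ W] exI[of _ "\<lambda>s. germ ` U (\<iota> s)"] ballI) simp_all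
qed

end

section \<open>Factorization through the quotient\<close>

context branched_square begin

lemma descend_p:
  assumes "u \<in> pts R"
  shows "descend p (germ u) = p u"
  by (rule descend_germ[OF assms]) (rule germ_eq_imp_pq(1))

lemma descend_q:
  assumes "u \<in> pts R"
  shows "descend q (germ u) = q u"
  by (rule descend_germ[OF assms]) (rule germ_eq_imp_pq(2))

lemma descend_p_branched: "branched_covering_map quot C1 (descend p)"
proof (rule descend_branched[OF p])
  show r': "descend p (germ u) = p u" if "u \<in> pts R" for u
    using descend_p[OF that] .
  fix x assume x: "x \<in> pts C1"
  obtain V \<psi> U1 \<phi>1 m1 U2 \<phi>2 m2 U \<phi> a b \<zeta> where
    L0: "local_square R C1 C2 C p q f g h (f x) V \<psi> U1 \<phi>1 m1 U2 \<phi>2 m2 U \<phi> a b \<zeta>"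
    using local_square_exists[OF branched_covering_mapD(2)[OF f x]] by metis
  then interpret L: local_square R C1 C2 C p q f g h "f x" V \<psi> U1 \<phi>1 m1 U2 \<phi>2 m2 U \<phi> a b \<zeta> .
  have xF: "x \<in> fibre C1 f (f x)" using x by (simp add: fibre_def)
  have t: "t \<in> L.F" "p t = x" if "t \<in> fibre R p x" for t
    using that hp by (auto simp: fibre_def)
  note dx = cover_overD(1)[OF L.cf xF]
  have pow: "\<exists>d. power_map_at quot C1 (descend p) (germ t) (germ ` U t) (U1 x) d" if "t \<in> fibre R p x" for t
  proof -
    note tt = t[OF that]
    have "power_map_at quot C1 (descend p) (germ t) (germ ` U t) (U1 x) (a t div L.e t)"
      by (rule L.descend_power_map_at[where r = p and r' = "descend p", OF tt(1) r'])
        (use dx tt L.Up[OF tt(1)] L.\<phi>1p[OF tt(1)] L.ae1[OF tt(1)] L.ae in auto)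
    then show ?thesis by blast
  qed
  have cov: "{u \<in> pts R. p u \<in> U1 x} = (\<Union>t\<in>fibre R p x. U t)"
    using L.cp[OF xF] by (simp add: cover_over_def)
  have im: "germ ` U t = germ ` U t'"
    if "t \<in> fibre R p x" "t' \<in> fibre R p x" "germ t = germ t'" for t t'
    using L.germ_image_eq[OF t(1) t(1) _ _ that(3)] L.dU(3) t(1) that(1,2) by blast
  have dis: "germ t = germ t'"
    if "t \<in> fibre R p x" "t' \<in> fibre R p x" "germ ` U t \<inter> germ ` U t' \<noteq> {}" for t t'
    using germ_images_disjoint_or_eq[OF L0 t(1)[OF that(1)] t(1)[OF that(2)] that(3)] .
  show "\<exists>W U. openin (surface_top C1) W \<and> x \<in> W \<and>
      {u \<in> pts R. p u \<in> W} = (\<Union>t\<in>fibre R p x. U t) \<and>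
      (\<forall>t\<in>fibre R p x. \<exists>d. power_map_at quot C1 (descend p) (germ t) (germ ` U t) W d) \<and>
      (\<forall>t\<in>fibre R p x. \<forall>t'\<in>fibre R p x. germ ` U t \<inter> germ ` U t' \<noteq> {} \<longrightarrow> germ t = germ t') \<and>
      (\<forall>t\<in>fibre R p x. \<forall>t'\<in>fibre R p x. germ t = germ t' \<longrightarrow> germ ` U t = germ ` U t')"
    by (intro exI[of _ "U1 x"] exI[of _ U] conjI ballI impI)
      (rule disc_chartD(6)[OF dx] disc_chartD(3)[OF dx] cov pow dis im; assumption)+
qed

lemma descend_q_branched: "branched_covering_map quot C2 (descend q)"
proof (rule descend_branched[OF q])
  show r': "descend q (germ u) = q u" if "u \<in> pts R" for u
    using descend_q[OF that] .
  fix x assume x: "x \<in> pts C2"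
  obtain V \<psi> U1 \<phi>1 m1 U2 \<phi>2 m2 U \<phi> a b \<zeta> where
    L0: "local_square R C1 C2 C p q f g h (g x) V \<psi> U1 \<phi>1 m1 U2 \<phi>2 m2 U \<phi> a b \<zeta>"
    using local_square_exists[OF branched_covering_mapD(2)[OF g x]] by metis
  then interpret L: local_square R C1 C2 C p q f g h "g x" V \<psi> U1 \<phi>1 m1 U2 \<phi>2 m2 U \<phi> a b \<zeta> .
  have xF: "x \<in> fibre C2 g (g x)" using x by (simp add: fibre_def)
  have t: "t \<in> L.F" "q t = x" if "t \<in> fibre R q x" for t
    using that hq by (auto simp: fibre_def)
  note dx = cover_overD(1)[OF L.cg xF]
  have pow: "\<exists>d. power_map_at quot C2 (descend q) (germ t) (germ ` U t) (U2 x) d" if "t \<in> fibre R q x" for t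
  proof -
    note tt = t[OF that]
    have nz: "\<zeta> t \<noteq> 0" and c1: "cmod (inverse (\<zeta> t)) = 1"
      using L.\<zeta>1[OF tt(1)] by (auto simp: norm_inverse)
    \<comment> \<open>The factor \<open>\<zeta> t\<close> in the normal form of \<open>q\<close> is
      absorbed into the target chart. It depends on \<open>t\<close>, which is harmless because
      \<open>power_map_at\<close> allows a separate target chart for each sheet.\<close>
    have rot: "disc_chart C2 (q t) (U2 x) (\<lambda>u. inverse (\<zeta> t) * \<phi>2 x u)"
      using disc_chart_rotate[OF sC2(1) dx c1] tt(2) by simp
    have "power_map_at quot C2 (descend q) (germ t) (germ ` U t) (U2 x) (b t div L.e t)"
      by (rule L.descend_power_map_at[where r = q and r' = "descend q", OF tt(1) r' rot])
        (use tt L.Uq[OF tt(1)] L.\<phi>2q[OF tt(1)] L.be1[OF tt(1)] L.be nz in auto)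
    then show ?thesis by blast
  qed
  have cov: "{u \<in> pts R. q u \<in> U2 x} = (\<Union>t\<in>fibre R q x. U t)"
  proof (intro equalityI subsetI)
    fix u assume u: "u \<in> {u \<in> pts R. q u \<in> U2 x}"
    then have "h u \<in> V" using cover_overD(3)[OF L.cg xF] hq by auto
    then obtain t where t: "t \<in> L.F" "u \<in> U t" using L.c(6) u by blast
    have "q t = x" using cover_overD(5)[OF L.cg L.qF[OF t(1)] xF L.Uq[OF t]] u by simp
    then have "t \<in> fibre R q x" using t(1) by (simp add: fibre_def)
    then show "u \<in> (\<Union>t\<in>fibre R q x. U t)" using t(2) by blast
  next
    fix u assume "u \<in> (\<Union>t\<in>fibre R q x. U t)"
    then obtain s where s: "s \<in> fibre R q x" "u \<in> U s" by blast
    then show "u \<in> {u \<in> pts R. q u \<in> U2 x}"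
      using L.Uq[OF t(1)[OF s(1)] s(2)] t(2)[OF s(1)] L.UR[OF t(1)[OF s(1)] s(2)] by simp
  qed
  have im: "germ ` U t = germ ` U t'"
    if "t \<in> fibre R q x" "t' \<in> fibre R q x" "germ t = germ t'" for t t'
    using L.germ_image_eq[OF t(1) t(1) _ _ that(3)] L.dU(3) t(1) that(1,2) by blast
  have dis: "germ t = germ t'"
    if "t \<in> fibre R q x" "t' \<in> fibre R q x" "germ ` U t \<inter> germ ` U t' \<noteq> {}" for t t'
    using germ_images_disjoint_or_eq[OF L0 t(1)[OF that(1)] t(1)[OF that(2)] that(3)] .
  show "\<exists>W U. openin (surface_top C2) W \<and> x \<in> W \<and>
      {u \<in> pts R. q u \<in> W} = (\<Union>t\<in>fibre R q x. U t) \<and>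
      (\<forall>t\<in>fibre R q x. \<exists>d. power_map_at quot C2 (descend q) (germ t) (germ ` U t) W d) \<and>
      (\<forall>t\<in>fibre R q x. \<forall>t'\<in>fibre R q x. germ ` U t \<inter> germ ` U t' \<noteq> {} \<longrightarrow> germ t = germ t') \<and>
      (\<forall>t\<in>fibre R q x. \<forall>t'\<in>fibre R q x. germ t = germ t' \<longrightarrow> germ ` U t = germ ` U t')"
    by (intro exI[of _ "U2 x"] exI[of _ U] conjI ballI impI)
      (rule disc_chartD(6)[OF dx] disc_chartD(3)[OF dx] cov pow dis im; assumption)+
qed

lemma gcd_local_degrees:
  assumes ncf: "no_common_right_factor R C1 C2 p q" and t: "t \<in> pts R"
  shows "gcd (local_degree R C1 p t) (local_degree R C2 q t) = 1"
proof -
  have s: "germ t \<in> pts quot" using t by (simp add: topspace_quot)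
  \<comment> \<open>Points of \<open>quot\<close> are germs and not sets of points of
    \<open>R\<close>, so the version for arbitrary types is the one that applies.\<close>
  have "covering_degree R quot germ = 1"
    by (rule no_common_right_factorD[OF ncf quot_closed_surface germ_branched descend_p_branched descend_q_branched])
      (simp_all add: descend_p descend_q)
  then have "(\<Sum>x\<in>fibre R germ (germ t). local_degree R quot germ x) = 1"
    using covering_degree_eq[OF R quot_closed_surface germ_branched s] by simp
  moreover have "local_degree R quot germ t \<le> (\<Sum>x\<in>fibre R germ (germ t). local_degree R quot germ x)"
    by (rule member_le_sum)
      (use t finite_fibre[OF R quot_closed_surface germ_branched s] in \<open>auto simp: fibre_def\<close>)
  ultimately have "local_degree R quot germ t \<le> 1" by simp
  then show ?thesis
    using local_degree_ge_1[OF sR(1) quot_surface germ_branched t] germ_local_degree[OF t] by simp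
qed

end

section \<open>From coprime local degrees to the lcm formula and the critical values\<close>

text \<open>Coprimality forces \<open>m = b * k\<close> and, for nonzero \<open>b\<close>, also
  \<open>n = a * k\<close>; their lcm is then \<open>a * b * k\<close>.\<close>

lemma lcm_cofactors:
  fixes a b m n :: nat
  assumes "coprime a b" "m * a = n * b" "a \<ge> 1"
  shows "m * a = lcm m n"
proof -
  have "b dvd m"
    using assms(1,2) by (metis coprime_commute coprime_dvd_mult_left_iff dvd_triv_right)
  then obtain k where k: "m = b * k" unfolding dvd_def by blast
  have "n = a * k \<or> b = 0" using assms(2) k by auto
  then show ?thesis
  proof
    assume n: "n = a * k"
    have "lcm m n = lcm b a * k" using lcm_mult_right[of b k a] by (simp add: k n lcm.commute)
    also have "lcm b a = a * b" using assms(1) by (simp add: lcm_coprime coprime_commute mult.commute)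
    finally show ?thesis using k by (simp add: mult_ac)
  next
    assume "b = 0"
    then show ?thesis using assms(2,3) by simp
  qed
qed

theorem corollary3p3:
  fixes R :: "'r oriented_space" and C\<^sub>1 :: "'a oriented_space" and C\<^sub>2 :: "'b oriented_space"
    and C :: "'c oriented_space"
    and p :: "'r \<Rightarrow> 'a" and q :: "'r \<Rightarrow> 'b" and f :: "'a \<Rightarrow> 'c" and g :: "'b \<Rightarrow> 'c" and h :: "'r \<Rightarrow> 'c"
  assumes "closed_surface R" "closed_surface C\<^sub>1" "closed_surface C\<^sub>2" "closed_surface C"
    and "branched_covering_map R C\<^sub>1 p" "branched_covering_map R C\<^sub>2 q"
    and "branched_covering_map C\<^sub>1 C f" "branched_covering_map C\<^sub>2 C g"
    and "\<forall>t \<in> topspace (surface_top R). h t = f (p t)"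
    and "\<forall>t \<in> topspace (surface_top R). h t = g (q t)"
    and "no_common_right_factor R C\<^sub>1 C\<^sub>2 p q"
  shows "branched_covering_map R C h \<and>
    (\<forall>t \<in> topspace (surface_top R).
       local_degree R C h t = lcm (local_degree C\<^sub>1 C f (p t)) (local_degree C\<^sub>2 C g (q t))) \<and>
    (\<forall>t \<in> topspace (surface_top R). gcd (local_degree R C\<^sub>1 p t) (local_degree R C\<^sub>2 q t) = 1) \<and>
    critical_values R C h = critical_values C\<^sub>1 C f \<union> critical_values C\<^sub>2 C g"
proof -
  interpret branched_square R C\<^sub>1 C\<^sub>2 C p q f g h
    using assms by unfold_locales auto
  have gcd: "gcd (local_degree R C\<^sub>1 p t) (local_degree R C\<^sub>2 q t) = 1"
    if "t \<in> topspace (surface_top R)" for t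
    using gcd_local_degrees[OF assms(11) that] .
  have lcm: "local_degree R C h t = lcm (local_degree C\<^sub>1 C f (p t)) (local_degree C\<^sub>2 C g (q t))"
    if t: "t \<in> topspace (surface_top R)" for t
  proof -
    have 1: "local_degree R C h t = local_degree C\<^sub>1 C f (p t) * local_degree R C\<^sub>1 p t"
      by (rule h_local_degree(1)[OF t])
    have 2: "local_degree R C h t = local_degree C\<^sub>2 C g (q t) * local_degree R C\<^sub>2 q t"
      by (rule h_local_degree(2)[OF t])
    have "local_degree C\<^sub>1 C f (p t) * local_degree R C\<^sub>1 p t =
        lcm (local_degree C\<^sub>1 C f (p t)) (local_degree C\<^sub>2 C g (q t))"
    proof (rule lcm_cofactors)
      show "coprime (local_degree R C\<^sub>1 p t) (local_degree R C\<^sub>2 q t)"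
        using gcd[OF t] by (simp add: coprime_iff_gcd_eq_1)
      show "local_degree R C\<^sub>1 p t \<ge> 1" by (rule local_degree_ge_1[OF sR(1) sC1(1) p t])
    qed (use 1 2 in simp)
    then show ?thesis using 1 by simp
  qed
  have ge: "local_degree C\<^sub>1 C f (p t) \<ge> 1" "local_degree C\<^sub>2 C g (q t) \<ge> 1"
    if "t \<in> topspace (surface_top R)" for t
    using local_degree_ge_1[OF sC1(1) sC(1) f p_in[OF that]]
      local_degree_ge_1[OF sC2(1) sC(1) g q_in[OF that]] by blast+
  have crit: "local_degree R C h t \<ge> 2 \<longleftrightarrow>
      local_degree C\<^sub>1 C f (p t) \<ge> 2 \<or> local_degree C\<^sub>2 C g (q t) \<ge> 2"
    if t: "t \<in> topspace (surface_top R)" for t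
  proof -
    define m n where "m = local_degree C\<^sub>1 C f (p t)" and "n = local_degree C\<^sub>2 C g (q t)"
    have mn: "m \<ge> 1" "n \<ge> 1" using ge[OF t] by (simp_all add: m_def n_def)
    have "m \<le> lcm m n" "n \<le> lcm m n" using mn by (auto intro!: dvd_imp_le lcm_pos_nat)
    moreover have "lcm m n = 1" if "\<not> m \<ge> 2" "\<not> n \<ge> 2"
    proof -
      have "m = 1" "n = 1" using mn that by auto
      then show ?thesis by simp
    qed
    ultimately show ?thesis unfolding lcm[OF t] m_def[symmetric] n_def[symmetric] by force
  qed
  have "critical_values R C h = critical_values C\<^sub>1 C f \<union> critical_values C\<^sub>2 C g"
  proof (intro equalityI subsetI)
    fix y assume "y \<in> critical_values R C h"
    then obtain t where t: "t \<in> topspace (surface_top R)" "local_degree R C h t \<ge> 2" "y = h t"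
      by (auto simp: critical_values_def)
    then consider "local_degree C\<^sub>1 C f (p t) \<ge> 2" | "local_degree C\<^sub>2 C g (q t) \<ge> 2"
      using crit[OF t(1)] by blast
    then show "y \<in> critical_values C\<^sub>1 C f \<union> critical_values C\<^sub>2 C g"
    proof cases
      case 1
      then have "f (p t) \<in> critical_values C\<^sub>1 C f"
        unfolding critical_values_def using p_in[OF t(1)] by blast
      then show ?thesis using t(3) hp[OF t(1)] by simp
    next
      case 2
      then have "g (q t) \<in> critical_values C\<^sub>2 C g"
        unfolding critical_values_def using q_in[OF t(1)] by blast
      then show ?thesis using t(3) hq[OF t(1)] by simp
    qed
  next
    fix y assume "y \<in> critical_values C\<^sub>1 C f \<union> critical_values C\<^sub>2 C g"
    \<comment> \<open>Critical points of \<open>f\<close> and \<open>g\<close> are lifted to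
      \<open>R\<close> by surjectivity of \<open>p\<close> and \<open>q\<close>; there
      \<open>crit\<close> applies.\<close>
    then obtain t where "t \<in> topspace (surface_top R)" "y = h t" "local_degree R C h t \<ge> 2"
    proof
      assume "y \<in> critical_values C\<^sub>1 C f"
      then obtain x where x: "x \<in> topspace (surface_top C\<^sub>1)" "local_degree C\<^sub>1 C f x \<ge> 2" "y = f x"
        by (auto simp: critical_values_def)
      then obtain t where "t \<in> topspace (surface_top R)" "p t = x"
        using branched_covering_map_surj[OF p] by blast
      then show thesis using that[of t] crit hp x by auto
    next
      assume "y \<in> critical_values C\<^sub>2 C g"
      then obtain x where x: "x \<in> topspace (surface_top C\<^sub>2)" "local_degree C\<^sub>2 C g x \<ge> 2" "y = g x"
        by (auto simp: critical_values_def)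
      then obtain t where "t \<in> topspace (surface_top R)" "q t = x"
        using branched_covering_map_surj[OF q] by blast
      then show thesis using that[of t] crit hq x by auto
    qed
    then show "y \<in> critical_values R C h" by (auto simp: critical_values_def)
  qed
  then show ?thesis using h_branched lcm gcd by blast
qed

end
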